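(* Let $f:(0,\infty)\to\mathbb R$ be operator convex, with integral representation $$f(t)=a+b(t-1)+c(t-1)^2+d\,\frac{(t-1)^2}{t}+\int_{(0,\infty)}\frac{(t-1)^2}{t+\lambda}\,d\mu(\lambda),\qquad t\in(0,\infty),$$ where $a,b\in\mathbb R$, $c,d\ge0$ and $\mu$ is a positive measure on $(0,\infty)$ with $\int_{(0,\infty)}(1+\lambda)^{-1}\,d\mu(\lambda)<\infty$. For each $n\in\mathbb N$ set $$\alpha_n:=b+nc+d+\int_{[1/n,n]}d\mu(\lambda),\qquad\beta_n:=a-b+c+nd+\int_{[1/n,n]}\frac1\lambda\,d\mu(\lambda),$$ $$d\nu_n(\lambda):=(1+n)c\,\delta_n+(1+n)d\,\delta_{1/n}+\chi_{[1/n,n]}(\lambda)\frac{1+\lambda}{\lambda}\,d\mu(\lambda),$$ where $\delta_n,\delta_{1/n}$ are the point masses at $n$ and $1/n$. Then for every Hilbert space $\mathcal H$, every $A,B\in B(\mathcal H)_+$ and $\xi\in\mathcal H$, $$\phi_f(A,B)(\omega_\xi)=\sup_n\sup_{\eta(\cdot),\zeta(\cdot)}\Bigl[\alpha_n\langle A\xi,\xi\rangle+\beta_n\langle B\xi,\xi\rangle-\int_{[1/n,n]}\frac{1+t}{t}\bigl(\langle A\eta(t),\eta(t)\rangle+t\langle B\zeta(t),\zeta(t)\rangle\bigr)\,d\nu_n(t)\Bigr],$$ where the second supremum is taken over all pairs $(\eta(\cdot),\zeta(\cdot))$ of piecewise constant functions on $[1/n,n]$ with finitely many values in $\mathcal H$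 such that $\eta(t)+\zeta(t)=\xi$ for all $t\in[1/n,n]$.
   Context: $B(\mathcal H)_+$ is the set of positive bounded operators on $\mathcal H$. $B(\mathcal H)_*^+$ is the set of positive normal functionals on $B(\mathcal H)$; $\omega_\xi:=\langle\,\cdot\,\xi,\xi\rangle$. Every operator convex $f:(0,\infty)\to\mathbb R$ has a unique representation of the displayed form. Extended operator perspective: for operator convex $f:(0,\infty)\to\mathbb R$ put $f'(\infty):=\lim_{t\to\infty}f(t)/t$ and $f(0^+):=\lim_{t\searrow0}f(t)$, in $(-\infty,\infty]$, and $\phi_f(x,y):=yf(x/y)$ for $x,y>0$, $\phi_f(x,0):=f'(\infty)x$ for $x\ge0$, $\phi_f(0,y):=f(0^+)y$ for $y\ge0$ (with $0\cdot\infty=0$). For $A,B\in B(\mathcal H)_+$ put $\mathcal H_{A,B}:=\overline{\mathrm{ran}}(A+B)$ and $T_{A,B}:\mathcal H\to\mathcal H_{A,B}$, $T_{A,B}\xi:=(A+B)^{1/2}\xi$. There are unique positive contractions $R_{A,B},S_{A,B}$ on $\mathcal H_{A,B}$ with $R_{A,B}+S_{A,B}=I$, $A=T_{A,B}^*R_{A,B}T_{A,B}$, $B=T_{A,B}^*S_{A,B}T_{A,B}$. Then $\phi_f(A,B):B(\mathcal H)_*^+\to(-\infty,\infty]$ is defined by $\phi_f(A,B)(\rho):=\int_{[0,1]}\phi_f(r,1-r)\,d\rho(T_{A,B}^*E_{R_{A,B}}(r)T_{A,B})$, with $E_{R_{A,B}}$ the spectral measure of $R_{A,B}$. *)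

theory Defs
  imports
    "HOL-Analysis.Analysis"
    "Jordan_Normal_Form.Schur_Decomposition"
begin

section \<open>Complex Hilbert spaces\<close>

text \<open>
  The real vector space structure, norm and real inner product are those of the underlying
  real Hilbert space; in particular positive definiteness of \<open>cinner\<close> and
  \<open>norm x = sqrt (Re (cinner x x))\<close> follow from \<open>inner_cinner\<close> and the axioms of
  \<^class>\<open>real_inner\<close>, and \<open>1 *\<^sub>C x = x\<close> follows from \<open>scaleR_scaleC\<close>.
  The inner product is linear in the first argument.
\<close>

class complex_hilbert = real_inner + banach +
  fixes scaleC :: "complex \<Rightarrow> 'a \<Rightarrow> 'a"  (infixr \<open>*\<^sub>C\<close> 75)
    and cinner :: "'a \<Rightarrow> 'a \<Rightarrow> complex"
  assumes scaleC_add_right: "z *\<^sub>C (x + y) = z *\<^sub>C x + z *\<^sub>C y"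
    and scaleC_add_left: "(z + w) *\<^sub>C x = z *\<^sub>C x + w *\<^sub>C x"
    and scaleC_scaleC: "z *\<^sub>C (w *\<^sub>C x) = (z * w) *\<^sub>C x"
    and scaleR_scaleC: "r *\<^sub>R x = complex_of_real r *\<^sub>C x"
    and cinner_commute: "cinner x y = cnj (cinner y x)"
    and cinner_add_left: "cinner (x + y) u = cinner x u + cinner y u"
    and cinner_scaleC_left: "cinner (z *\<^sub>C x) y = z * cinner x y"
    and inner_cinner: "inner x y = Re (cinner x y)"

instantiation complex :: complex_hilbert
begin

definition scaleC_complex :: "complex \<Rightarrow> complex \<Rightarrow> complex"
  where "scaleC_complex z x = z * x"

definition cinner_complex :: "complex \<Rightarrow> complex \<Rightarrow> complex"
  where "cinner_complex x y = x * cnj y"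

instance
  by standard
    (auto simp: scaleC_complex_def cinner_complex_def algebra_simps scaleR_conv_of_real
      inner_complex_def)

end


section \<open>Operators on a closed subspace\<close>

text \<open>
  An operator on a closed subspace \<open>K\<close> is a function on the ambient space of which only the
  values on \<open>K\<close> matter. The operators on the whole space are the case \<open>K = UNIV\<close>.
\<close>

definition bounded_clinear_on :: "'a::complex_hilbert set \<Rightarrow> ('a \<Rightarrow> 'a) \<Rightarrow> bool"
  where "bounded_clinear_on K T \<longleftrightarrow>
    (\<forall>x\<in>K. T x \<in> K) \<and>
    (\<forall>x\<in>K. \<forall>y\<in>K. T (x + y) = T x + T y) \<and>
    (\<forall>z. \<forall>x\<in>K. T (z *\<^sub>C x) = z *\<^sub>C T x) \<and>
    (\<exists>M. \<forall>x\<in>K. norm (T x) \<le> M * norm x)"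

definition positive_op_on :: "'a::complex_hilbert set \<Rightarrow> ('a \<Rightarrow> 'a) \<Rightarrow> bool"
  where "positive_op_on K T \<longleftrightarrow>
    bounded_clinear_on K T \<and> (\<forall>x\<in>K. cinner (T x) x \<in> \<real>\<^sub>\<ge>\<^sub>0)"

abbreviation positive_op :: "('a::complex_hilbert \<Rightarrow> 'a) \<Rightarrow> bool"
  where "positive_op \<equiv> positive_op_on UNIV"

definition positive_contraction_on :: "'a::complex_hilbert set \<Rightarrow> ('a \<Rightarrow> 'a) \<Rightarrow> bool"
  where "positive_contraction_on K T \<longleftrightarrow>
    positive_op_on K T \<and> (\<forall>x\<in>K. norm (T x) \<le> norm x)"

definition op_sqrt :: "('a::complex_hilbert \<Rightarrow> 'a) \<Rightarrow> 'a \<Rightarrow> 'a"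
  where "op_sqrt P = (SOME Q. positive_op Q \<and> (\<forall>x. Q (Q x) = P x))"

text \<open>
  If \<open>T\<close> maps the whole space into a closed subspace \<open>K\<close>, then \<open>hadjoint T\<close>, restricted to
  \<open>K\<close>, is the adjoint of \<open>T\<close> regarded as an operator into \<open>K\<close>.
\<close>

definition hadjoint :: "('a::complex_hilbert \<Rightarrow> 'a) \<Rightarrow> 'a \<Rightarrow> 'a"
  where "hadjoint T y = (THE z. \<forall>x. cinner (T x) y = cinner x z)"

definition vector_functional :: "'a::complex_hilbert \<Rightarrow> ('a \<Rightarrow> 'a) \<Rightarrow> complex"
  where "vector_functional \<xi> X = cinner (X \<xi>) \<xi>"


section \<open>Spectral measures\<close>

definition projection_on :: "'a::complex_hilbert set \<Rightarrow> ('a \<Rightarrow> 'a) \<Rightarrow> bool"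
  where "projection_on K P \<longleftrightarrow>
    bounded_clinear_on K P \<and>
    (\<forall>x\<in>K. P (P x) = P x) \<and>
    (\<forall>x\<in>K. \<forall>y\<in>K. cinner (P x) y = cinner x (P y))"

definition projection_valued_measure_on ::
    "'a::complex_hilbert set \<Rightarrow> (real set \<Rightarrow> 'a \<Rightarrow> 'a) \<Rightarrow> bool"
  where "projection_valued_measure_on K E \<longleftrightarrow>
    (\<forall>M\<in>sets borel. projection_on K (E M)) \<and>
    (\<forall>x\<in>K. E UNIV x = x) \<and>
    (\<forall>M :: nat \<Rightarrow> real set. range M \<subseteq> sets borel \<longrightarrow> disjoint_family M \<longrightarrow>
       (\<forall>x\<in>K. (\<lambda>i. E (M i) x) sums E (\<Union>i. M i) x))"

text \<open>
  \<open>E\<close> is the spectral measure of the bounded self-adjoint operator \<open>R\<close> on \<open>K\<close> if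
  \<open>R = \<integral> r dE(r)\<close>, here in the form \<open>\<langle>R x, x\<rangle> = \<integral> r d\<langle>E(r) x, x\<rangle>\<close>; integrability is part of
  \<open>has_bochner_integral\<close>.
\<close>

definition spectral_measure_on ::
    "'a::complex_hilbert set \<Rightarrow> ('a \<Rightarrow> 'a) \<Rightarrow> (real set \<Rightarrow> 'a \<Rightarrow> 'a) \<Rightarrow> bool"
  where "spectral_measure_on K R E \<longleftrightarrow>
    projection_valued_measure_on K E \<and>
    (\<forall>x\<in>K. cinner (R x) x \<in> \<real> \<and>
      has_bochner_integral
        (measure_of UNIV (sets borel) (\<lambda>M. ennreal (Re (cinner (E M x) x))))
        (\<lambda>r. r) (Re (cinner (R x) x)))"


section \<open>The extended operator perspective\<close>

definition H_AB :: "('a::complex_hilbert \<Rightarrow> 'a) \<Rightarrow> ('a \<Rightarrow> 'a) \<Rightarrow> 'a set"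
  where "H_AB A B = closure (range (\<lambda>x. A x + B x))"

definition T_AB :: "('a::complex_hilbert \<Rightarrow> 'a) \<Rightarrow> ('a \<Rightarrow> 'a) \<Rightarrow> 'a \<Rightarrow> 'a"
  where "T_AB A B = op_sqrt (\<lambda>x. A x + B x)"

text \<open>
  \<open>R_AB A B\<close> is unique on \<open>H_AB A B\<close> only (its values elsewhere are irrelevant), and likewise
  \<open>E_AB A B\<close> is unique on Borel sets and vectors of \<open>H_AB A B\<close> only; hence \<open>SOME\<close>
  rather than \<open>THE\<close>.
\<close>

definition R_AB :: "('a::complex_hilbert \<Rightarrow> 'a) \<Rightarrow> ('a \<Rightarrow> 'a) \<Rightarrow> 'a \<Rightarrow> 'a"
  where "R_AB A B = (SOME R. \<exists>S.
    positive_contraction_on (H_AB A B) R \<and>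
    positive_contraction_on (H_AB A B) S \<and>
    (\<forall>x\<in>H_AB A B. R x + S x = x) \<and>
    (\<forall>x. A x = hadjoint (T_AB A B) (R (T_AB A B x))) \<and>
    (\<forall>x. B x = hadjoint (T_AB A B) (S (T_AB A B x))))"

definition E_AB :: "('a::complex_hilbert \<Rightarrow> 'a) \<Rightarrow> ('a \<Rightarrow> 'a) \<Rightarrow> real set \<Rightarrow> 'a \<Rightarrow> 'a"
  where "E_AB A B = (SOME E. spectral_measure_on (H_AB A B) (R_AB A B) E)"

definition slope_at_infinity :: "(real \<Rightarrow> real) \<Rightarrow> ereal"
  where "slope_at_infinity f = Lim at_top (\<lambda>t. ereal (f t / t))"

definition limit_at_zero :: "(real \<Rightarrow> real) \<Rightarrow> ereal"
  where "limit_at_zero f = Lim (at_right 0) (\<lambda>t. ereal (f t))"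

text \<open>Meant for \<open>x, y \<ge> 0\<close>. In \<^typ>\<open>ereal\<close>, \<open>\<infinity> * 0 = 0\<close>.\<close>

definition persp :: "(real \<Rightarrow> real) \<Rightarrow> real \<Rightarrow> real \<Rightarrow> ereal"
  where "persp f x y =
    (if y = 0 then slope_at_infinity f * ereal x
     else if x = 0 then limit_at_zero f * ereal y
     else ereal (y * f (x / y)))"

text \<open>The measure \<open>d\<rho>(T* E(r) T)\<close>.\<close>

definition persp_measure ::
    "('a::complex_hilbert \<Rightarrow> 'a) \<Rightarrow> ('a \<Rightarrow> 'a) \<Rightarrow> (('a \<Rightarrow> 'a) \<Rightarrow> complex) \<Rightarrow> real measure"
  where "persp_measure A B \<rho> = measure_of UNIV (sets borel)
    (\<lambda>M. ennreal (Re (\<rho> (\<lambda>x. hadjoint (T_AB A B) (E_AB A B M (T_AB A B x))))))"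

text \<open>
  The integral of the \<^typ>\<open>ereal\<close>-valued integrand, as the difference of the integrals of its
  positive and negative parts. For convex \<open>f\<close> the integrand is bounded below on \<open>[0,1]\<close> and
  for a positive normal functional \<open>\<rho>\<close> the measure is finite, so the subtrahend is finite.
\<close>

definition op_persp ::
    "(real \<Rightarrow> real) \<Rightarrow> ('a::complex_hilbert \<Rightarrow> 'a) \<Rightarrow> ('a \<Rightarrow> 'a) \<Rightarrow>
     (('a \<Rightarrow> 'a) \<Rightarrow> complex) \<Rightarrow> ereal"
  where "op_persp f A B \<rho> =
    enn2ereal (\<integral>\<^sup>+r\<in>{0..1}. e2ennreal (persp f r (1 - r)) \<partial>persp_measure A B \<rho>) -
    enn2ereal (\<integral>\<^sup>+r\<in>{0..1}. e2ennreal (- persp f r (1 - r)) \<partial>persp_measure A B \<rho>)"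


section \<open>Operator convexity\<close>

definition pos_def_mat :: "nat \<Rightarrow> complex mat \<Rightarrow> bool"
  where "pos_def_mat n A \<longleftrightarrow> A \<in> carrier_mat n n \<and> mat_adjoint A = A \<and>
    (\<forall>v\<in>carrier_vec n. v \<noteq> 0\<^sub>v n \<longrightarrow> Re ((A *\<^sub>v v) \<bullet>c v) > 0)"

definition loewner_le :: "nat \<Rightarrow> complex mat \<Rightarrow> complex mat \<Rightarrow> bool"
  where "loewner_le n A B \<longleftrightarrow>
    (\<forall>v\<in>carrier_vec n. ((B - A) *\<^sub>v v) \<bullet>c v \<in> \<real>\<^sub>\<ge>\<^sub>0)"

text \<open>\<open>f(A) = U diag(f(d)) U*\<close> for \<open>A = U diag(d) U*\<close> with \<open>U\<close> unitary and \<open>d\<close> real.\<close>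

definition mat_fun :: "nat \<Rightarrow> (real \<Rightarrow> real) \<Rightarrow> complex mat \<Rightarrow> complex mat"
  where "mat_fun n f A = (THE C. \<exists>U (d :: nat \<Rightarrow> real).
    U \<in> carrier_mat n n \<and> U * mat_adjoint U = 1\<^sub>m n \<and>
    A = U * mat_diag n (\<lambda>i. complex_of_real (d i)) * mat_adjoint U \<and>
    C = U * mat_diag n (\<lambda>i. complex_of_real (f (d i))) * mat_adjoint U)"

text \<open>\<open>f\<close> is operator convex on \<open>(0,\<infinity>)\<close>: matrix convex of every order.\<close>

definition operator_convex :: "(real \<Rightarrow> real) \<Rightarrow> bool"
  where "operator_convex f \<longleftrightarrow>
    (\<forall>n A B. \<forall>s\<in>{0..1}. pos_def_mat n A \<longrightarrow> pos_def_mat n B \<longrightarrow>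
      loewner_le n
        (mat_fun n f (complex_of_real s \<cdot>\<^sub>m A + complex_of_real (1 - s) \<cdot>\<^sub>m B))
        (complex_of_real s \<cdot>\<^sub>m mat_fun n f A + complex_of_real (1 - s) \<cdot>\<^sub>m mat_fun n f B))"


section \<open>The data of the variational expression\<close>

text \<open>Throughout, \<open>\<mu>\<close> is a Borel measure whose space is \<open>(0,\<infinity>)\<close>.\<close>

definition alpha_n :: "real \<Rightarrow> real \<Rightarrow> real \<Rightarrow> real measure \<Rightarrow> nat \<Rightarrow> real"
  where "alpha_n b c d \<mu> n = b + real n * c + d + measure \<mu> {1 / real n..real n}"

definition beta_n :: "real \<Rightarrow> real \<Rightarrow> real \<Rightarrow> real \<Rightarrow> real measure \<Rightarrow> nat \<Rightarrow> real"
  where "beta_n a b c d \<mu> n =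
    a - b + c + real n * d + (LINT l:{1 / real n..real n}|\<mu>. 1 / l)"

definition nu_n :: "real \<Rightarrow> real \<Rightarrow> real measure \<Rightarrow> nat \<Rightarrow> real measure"
  where "nu_n c d \<mu> n = measure_of (space \<mu>) (sets \<mu>)
    (\<lambda>M. ennreal ((1 + real n) * c) * indicator M (real n) +
         ennreal ((1 + real n) * d) * indicator M (1 / real n) +
         emeasure (density \<mu>
           (\<lambda>l. indicator {1 / real n..real n} l * ennreal ((1 + l) / l))) M)"

text \<open>
  Only the restriction to \<open>[p,q]\<close> matters. The intervals of the partition may be open,
  half-open, closed or single points.
\<close>

definition piecewise_constant_on :: "real \<Rightarrow> real \<Rightarrow> (real \<Rightarrow> 'a) \<Rightarrow> bool"
  where "piecewise_constant_on p q g \<longleftrightarrow>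
    (\<exists>J. finite J \<and> partition_on {p..q} J \<and>
      (\<forall>I\<in>J. is_interval I \<and> g constant_on I))"

definition decompositions :: "nat \<Rightarrow> 'a::complex_hilbert \<Rightarrow> ((real \<Rightarrow> 'a) \<times> (real \<Rightarrow> 'a)) set"
  where "decompositions n \<xi> = {(\<eta>, \<zeta>).
    piecewise_constant_on (1 / real n) (real n) \<eta> \<and>
    piecewise_constant_on (1 / real n) (real n) \<zeta> \<and>
    (\<forall>t\<in>{1 / real n..real n}. \<eta> t + \<zeta> t = \<xi>)}"

end

theory Submission
  imports Defs "HOL-Probability.Probability" "HOL-Real_Asymp.Real_Asymp"
begin

hide_const (open) Module.smult VectorSpace.subspace

text \<open>
  With \<open>m\<close> the measure \<open>d\<omega>\<^sub>\<xi>(T* E(r) T)\<close> on \<open>[0,1]\<close>, both sides reduce to integrals against \<open>m\<close>. The scalar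
  perspective satisfies \<open>\<phi>\<^sub>f(r, 1 - r) = a (1 - r) + b (2 r - 1) + sup\<^sub>n \<Phi>\<^sub>n(r)\<close> with the increasing sequence
  \<open>\<Phi>\<^sub>n(r) = \<integral> t / (1 + t) k(t, r) d\<nu>\<^sub>n(t)\<close>, \<open>k(t, r) = (2 r - 1)\<^sup>2 / (r + t (1 - r))\<close>, and
  \<open>t / (1 + t) k(t, r) = (t r + (1 - r)) / (1 + t) - (1 + t) / t p(t, r)\<close>, where
  \<open>p(t, r) = t r (1 - r) / (r + t (1 - r))\<close>. By Fubini the \<open>n\<close>-th approximant is
  \<open>\<alpha>\<^sub>n \<langle>A\<xi>, \<xi>\<rangle> + \<beta>\<^sub>n \<langle>B\<xi>, \<xi>\<rangle> - \<integral> (1 + t) / t q(t) d\<nu>\<^sub>n(t)\<close>, and \<open>q(t) = \<integral> p(t, r) dm(r)\<close> is the infimum of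
  \<open>\<langle>A\<eta>, \<eta>\<rangle> + t \<langle>B\<zeta>, \<zeta>\<rangle>\<close> over \<open>\<eta> + \<zeta> = \<xi>\<close>; near-minimisers on a fine grid of \<open>t\<close> give piecewise constant
  \<open>\<eta>(\<cdot>), \<zeta>(\<cdot>)\<close>. The spectral theorem needed for \<open>m\<close> is obtained from the moments
  \<open>\<langle>p(R) x, x\<rangle>\<close> by solving the Hausdorff moment problem and extending the polynomial calculus by
  \<open>L\<^sup>2\<close>-density.
\<close>

section \<open>The Hausdorff moment problem\<close>

text \<open>The obstacle is that the scalar perspective may be infinite at \<open>r = 0\<close> and
  \<open>r = 1\<close>, where \<open>m\<close> can have atoms. Splitting off the affine part leaves
  a nonnegative remainder, to which monotone convergence and Tonelli apply in [0, infinity]. The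
  atoms of \<open>nu_n\<close> imitate the two boundary cases of the kernel:
  \<open>n k(n, r) = (2 r - 1)^2 / (r / n + 1 - r)\<close> increases to the perspective of
  \<open>(t - 1)^2\<close>, and \<open>k(1 / n, r)\<close> increases to that of
  \<open>(t - 1)^2 / t\<close>. The cutoff to [1 / n, n] makes \<open>nu_n\<close> finite, and the
  weight \<open>(1 + l) / l\<close> cancels the factor \<open>t / (1 + t)\<close>. A second
  constraint is that \<open>R_AB\<close> and \<open>E_AB\<close> are arbitrary choices, meaningful
  only on the closure of the range of \<open>A + B\<close>. Every fact about them is therefore drawn
  from their specifications: the factorisation of \<open>A\<close> and \<open>B\<close>, additivity
  of the projections, and the first moment of \<open>E_AB\<close>. For the same reason the value
  \<open>q(t)\<close> is found by cutting [0, 1] into cells, minimising on each spectral component,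
  and then approximating the resulting vector by vectors in the range of \<open>T\<close>.\<close>

definition bernstein_poly :: "nat \<Rightarrow> nat \<Rightarrow> real poly"
  where "bernstein_poly n k = smult (real (n choose k)) ([:0, 1:] ^ k * [:1, -1:] ^ (n - k))"

text \<open>The identity \<open>choose_mult\<close> pulls \<open>(n choose j) X^j\<close> out of
  each summand, and what is left is the binomial expansion of \<open>(X + Y)^(n - j)\<close> with
  \<open>X + Y = 1\<close>. It makes the discrete masses \<open>L (bernstein_poly n k)\<close> at
  \<open>k / n\<close> reproduce the binomial moments of \<open>L\<close> exactly.\<close>

lemma sum_binomial_bernstein_poly:
  assumes "j \<le> n"
  shows "(\<Sum>k\<le>n. smult (real (k choose j)) (bernstein_poly n k)) =
    smult (real (n choose j)) ([:0, 1:] ^ j)"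
proof -
  let ?X = "[:0, 1:] :: real poly" and ?Y = "[:1, -1:] :: real poly"
  have XY: "?X + ?Y = 1" by (simp add: one_pCons)
  have "(\<Sum>k\<le>n. smult (real (k choose j)) (bernstein_poly n k)) =
      (\<Sum>k\<in>{j..n}. smult (real (k choose j)) (bernstein_poly n k))"
    by (rule sum.mono_neutral_right) (auto simp: binomial_eq_0)
  also have "\<dots> = (\<Sum>k\<in>{j..n}. smult (real (n choose j))
      (?X ^ j * (of_nat ((n - j) choose (k - j)) * ?X ^ (k - j) * ?Y ^ ((n - j) - (k - j)))))"
  proof (rule sum.cong)
    fix k assume k: "k \<in> {j..n}"
    have c: "real (k choose j) * real (n choose k) = real (n choose j) * real ((n - j) choose (k - j))"
      using choose_mult[of j k n] k by (simp flip: of_nat_mult add: mult.commute)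
    have X: "?X ^ k = ?X ^ j * ?X ^ (k - j)" using k by (simp flip: power_add)
    have Y: "(n - j) - (k - j) = n - k" using k by auto
    have "smult (real (k choose j)) (bernstein_poly n k)
        = smult (real (k choose j) * real (n choose k)) (?X ^ k * ?Y ^ (n - k))"
      by (simp add: bernstein_poly_def)
    also have "\<dots> = smult (real (n choose j)) (smult (real ((n - j) choose (k - j))) (?X ^ k * ?Y ^ (n - k)))"
      by (simp only: c smult_smult)
    also have "\<dots> = smult (real (n choose j))
      (?X ^ j * (of_nat ((n - j) choose (k - j)) * ?X ^ (k - j) * ?Y ^ ((n - j) - (k - j))))"
      by (simp only: X Y of_nat_poly) (simp add: algebra_simps)
    finally show "smult (real (k choose j)) (bernstein_poly n k) = \<dots>" .
  qed simp
  also have "\<dots> = smult (real (n choose j)) (?X ^ j *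
      (\<Sum>k\<in>{j..n}. of_nat ((n - j) choose (k - j)) * ?X ^ (k - j) * ?Y ^ ((n - j) - (k - j))))"
    by (simp add: sum_distrib_left smult_sum2)
  also have "(\<Sum>k\<in>{j..n}. of_nat ((n - j) choose (k - j)) * ?X ^ (k - j) * ?Y ^ ((n - j) - (k - j)))
      = (\<Sum>i\<le>n - j. of_nat ((n - j) choose i) * ?X ^ i * ?Y ^ ((n - j) - i))"
    by (rule sum.reindex_bij_witness[of _ "\<lambda>i. i + j" "\<lambda>k. k - j"]) (use assms in auto)
  also have "\<dots> = (?X + ?Y) ^ (n - j)" by (rule binomial_ring[symmetric])
  finally show ?thesis unfolding XY by simp
qed

text \<open>Both quantities are products of \<open>j\<close> factors of modulus at most 1, and the
  factors \<open>(k - i) / (n - i)\<close> and \<open>k / n\<close> differ by at most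
  \<open>2 j / n\<close>, so \<open>norm_prod_diff\<close> adds up \<open>j\<close> such errors. The
  condition \<open>2 * j \<le> n\<close> keeps \<open>n - i\<close> above \<open>n / 2\<close>,
  which also covers \<open>k < j\<close>, where factors may be negative or zero.\<close>

lemma binomial_quotient_approx_power:
  assumes "k \<le> n" "2 * j \<le> n" "0 < n"
  shows "\<bar>real (k choose j) / real (n choose j) - (real k / real n) ^ j\<bar> \<le> 2 * (real j)\<^sup>2 / real n"
proof -
  have P: "fact j * real (m choose j) = (\<Prod>i<j. real m - real i)" for m
    using gbinomial_mult_fact[of j "real m"] by (simp add: binomial_gbinomial atLeast0LessThan)
  have "real (k choose j) / real (n choose j) =
      (fact j * real (k choose j)) / (fact j * real (n choose j))" by simp
  also have "\<dots> = (\<Prod>i<j. (real k - real i) / (real n - real i))"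
    by (simp only: P prod_dividef)
  finally have 1: "real (k choose j) / real (n choose j) = (\<Prod>i<j. (real k - real i) / (real n - real i))" .
  have a: "\<bar>(real k - real i) / (real n - real i)\<bar> \<le> 1" if "i < j" for i
    using that assms by (simp add: abs_le_iff field_simps)
  have b: "\<bar>(real k - real i) / (real n - real i) - real k / real n\<bar> \<le> 2 * real j / real n"
    if "i < j" for i
  proof -
    have pos: "real n - real i > 0" using that assms by simp
    have eq: "(real k - real i) / (real n - real i) - real k / real n
        = - (real i / real n * ((real n - real k) / (real n - real i)))"
      using pos assms by (simp add: field_simps)
    have "(real n - real k) / (real n - real i) \<le> 2"
      using pos that assms by (simp add: field_simps)
    moreover have 0: "0 \<le> (real n - real k) / (real n - real i)" using pos assms by simp
    moreover have "real i / real n \<le> real j / real n" using that assms by (simp add: field_simps)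
    ultimately have le: "real i / real n * ((real n - real k) / (real n - real i)) \<le> real j / real n * 2"
      by (intro mult_mono) auto
    have ab: "\<bar>real i / real n * ((real n - real k) / (real n - real i))\<bar> =
        real i / real n * ((real n - real k) / (real n - real i))"
      using 0 by (intro abs_of_nonneg mult_nonneg_nonneg) auto
    have "2 * real j / real n = real j / real n * 2" by simp
    then show ?thesis unfolding eq abs_minus_cancel ab using le by (simp only:)
  qed
  have "norm ((\<Prod>i<j. (real k - real i) / (real n - real i)) - (\<Prod>i<j. real k / real n))
     \<le> (\<Sum>i<j. norm ((real k - real i) / (real n - real i) - real k / real n))"
    by (rule norm_prod_diff) (use a assms in auto)
  also have "\<dots> \<le> (\<Sum>i<j. 2 * real j / real n)"
    by (rule sum_mono) (use b in auto)
  finally show ?thesis unfolding 1 by (simp add: power2_eq_square mult.left_commute)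
qed

text \<open>Positivity on \<open>X^i (1 - X)^j\<close> is Hausdorff's condition; it makes
  \<open>w n k\<close> probability weights. Placed at the points \<open>k / n\<close> they form a
  tight sequence of laws, and Helly selection yields a weak limit. Its moments are those of
  \<open>L\<close> because the binomial moments agree exactly once \<open>n \<ge> j\<close> and
  differ from the power moments by \<open>O(1 / n)\<close>.\<close>

lemma hausdorff_moment:
  fixes L :: "real poly \<Rightarrow> real"
  assumes add: "\<And>p q. L (p + q) = L p + L q"
    and smult: "\<And>r p. L (smult r p) = r * L p"
    and pos: "\<And>i j. L ([:0, 1:] ^ i * [:1, -1:] ^ j) \<ge> 0"
    and one: "L 1 = 1"
  shows "\<exists>M. prob_space M \<and> sets M = sets borel \<and> (AE r in M. r \<in> {0..1}) \<and>
    (\<forall>p. (\<integral>r. poly p r \<partial>M) = L p)"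
proof -
  let ?X = "[:0, 1:] :: real poly"
  define w where "w n k = (if k \<le> n then L (bernstein_poly n k) else 0)" for n k
  have L0: "L 0 = 0" using add[of 0 0] by simp
  have Lsum: "L (\<Sum>k\<in>K. g k) = (\<Sum>k\<in>K. L (g k))" if "finite K" for K :: "nat set" and g
    using that by (induction K) (auto simp: L0 add)
  have w0: "w n k \<ge> 0" for n k
    using pos by (auto simp: w_def bernstein_poly_def smult)
  have w1: "(\<Sum>k\<le>n. real (k choose j) * w n k) = real (n choose j) * L (?X ^ j)" if "j \<le> n" for n j
    using arg_cong[OF sum_binomial_bernstein_poly[OF that], of L]
    by (simp add: Lsum smult w_def del: sum_mult_of_bool_eq sum_of_bool_mult_eq)
  have wsum: "(\<Sum>k\<le>n. w n k) = 1" for n using w1[of 0 n] by (simp add: one)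
  define P where "P n = embed_pmf (w n)" for n
  have pmfP: "pmf (P n) k = w n k" for n k
    unfolding P_def
  proof (rule pmf_embed_pmf)
    have "(\<integral>\<^sup>+x. ennreal (w n x) \<partial>count_space UNIV) = (\<Sum>k\<in>{..n}. ennreal (w n k))"
      by (rule nn_integral_count_space') (auto simp: w_def)
    then show "(\<integral>\<^sup>+x. ennreal (w n x) \<partial>count_space UNIV) = 1"
      by (simp add: sum_ennreal w0 wsum)
  qed (rule w0)
  \<comment> \<open>\<open>Suc n\<close> in place of \<open>n\<close> avoids division by zero in the
    positions of the masses.\<close>
  define D where "D n = distr (measure_pmf (P (Suc n))) borel (\<lambda>k. real k / real (Suc n))" for n
  have D: "real_distribution (D n)" for n
    unfolding D_def by (intro real_distribution.intro real_distribution_axioms.intro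
      prob_space.prob_space_distr measure_pmf.prob_space_axioms) auto
  have intD: "(\<integral>r. g r \<partial>D n) = (\<Sum>k\<le>Suc n. g (real k / real (Suc n)) * w (Suc n) k)"
    if [measurable]: "g \<in> borel_measurable borel" for g :: "real \<Rightarrow> real" and n
    unfolding D_def
    by (subst integral_distr, simp, simp,
        subst integral_measure_pmf_real[of "{..Suc n}"])
       (auto simp: pmfP w_def set_pmf_iff split: if_splits)
  \<comment> \<open>\<open>tight\<close> is stated with half-open intervals, hence a left end
    strictly below the possible atom at 0.\<close>
  have supD: "measure (D n) {-1<..1} = 1" for n
  proof -
    have "measure (D n) {-1<..1} = (\<integral>r. indicator {-1<..1} r \<partial>D n)"
      using D[of n] by (simp add: real_distribution.space_eq_univ D_def)
    also have "\<dots> = (\<Sum>k\<le>Suc n. w (Suc n) k)"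
    proof (subst intD)
      show "(\<Sum>k\<le>Suc n. indicat_real {- 1<..1} (real k / real (Suc n)) * w (Suc n) k) =
          sum (w (Suc n)) {..Suc n}"
      proof (rule sum.cong[OF refl])
        fix k assume "k \<in> {..Suc n}"
        then have "0 \<le> real k / real (Suc n)" "real k / real (Suc n) \<le> 1" by simp_all
        then show "indicat_real {- 1<..1} (real k / real (Suc n)) * w (Suc n) k = w (Suc n) k"
          by (subst indicator_simps(1)) (auto simp del: of_nat_Suc intro: less_le_trans[of _ 0])
      qed
    qed simp
    finally show ?thesis using wsum[of "Suc n"] by simp
  qed
  have "tight D"
    unfolding tight_def using D supD
    by (intro conjI allI impI) (simp, rule exI[of _ "-1"], rule exI[of _ 1], simp)
  from tight_imp_convergent_subsubsequence[OF this strict_mono_id] obtain r M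
    where r: "strict_mono r" and M: "real_distribution M" and wc: "weak_conv_m (D \<circ> r) M"
    by (auto simp: o_def)
  interpret M: real_distribution M by fact
  have Dr: "real_distribution ((D \<circ> r) n)" for n using D by simp
  \<comment> \<open>Weak convergence tests bounded continuous functions on the whole line; clamping
    to [0, 1] makes the powers admissible without changing them at the masses of
    \<open>D n\<close>.\<close>
  define cl where "cl x = max 0 (min 1 x)" for x :: real
  have clm[measurable]: "cl \<in> borel_measurable borel" unfolding cl_def by measurable
  have clc: "isCont cl x" for x unfolding cl_def by (intro continuous_intros)
  have cl01: "0 \<le> cl x" "cl x \<le> 1" for x by (auto simp: cl_def)
  have clk: "cl (real k / real (Suc n)) = real k / real (Suc n)" if "k \<le> Suc n" for k n
    using that by (simp add: cl_def divide_le_eq max_def min_def)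
  \<comment> \<open>A bounded continuous test function that vanishes exactly on [0, 1] and has
    integral zero under every \<open>D n\<close>, so the limit law is concentrated on
    [0, 1].\<close>
  have "(\<lambda>n. \<integral>x. min 1 \<bar>x - cl x\<bar> \<partial>(D \<circ> r) n) \<longlonglongrightarrow> (\<integral>x. min 1 \<bar>x - cl x\<bar> \<partial>M)"
    by (rule weak_conv_imp_integral_bdd_continuous_conv[OF Dr M wc, where B = 1])
       (auto intro!: continuous_intros clc)
  moreover have "(\<integral>x. min 1 \<bar>x - cl x\<bar> \<partial>(D \<circ> r) n) = 0" for n
    by (simp only: o_apply, subst intD, measurable)
       (auto intro!: sum.neutral simp del: of_nat_Suc simp: clk)
  ultimately have "(\<lambda>n. 0) \<longlonglongrightarrow> (\<integral>x. min 1 \<bar>x - cl x\<bar> \<partial>M)" by (simp only:)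
  then have "(\<integral>x. min 1 \<bar>x - cl x\<bar> \<partial>M) = 0" by (simp add: LIMSEQ_const_iff)
  moreover have "integrable M (\<lambda>x. min 1 \<bar>x - cl x\<bar>)"
    by (rule M.integrable_const_bound[where B = 1]) auto
  ultimately have "AE x in M. min 1 \<bar>x - cl x\<bar> = 0"
    by (subst (asm) integral_nonneg_eq_0_iff_AE) auto
  then have AE: "AE x in M. x \<in> {0..1}"
    by eventually_elim (auto simp: cl_def min_def max_def split: if_splits)
  have mom: "(\<integral>x. x ^ j \<partial>M) = L (?X ^ j)" for j
  proof -
    have c1: "(\<lambda>n. \<integral>x. (cl x) ^ j \<partial>(D \<circ> r) n) \<longlonglongrightarrow> (\<integral>x. (cl x) ^ j \<partial>M)"
      by (rule weak_conv_imp_integral_bdd_continuous_conv[OF Dr M wc, where B = 1])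
         (auto intro!: continuous_intros clc power_le_one cl01 simp: power_abs abs_of_nonneg[OF cl01(1)])
    have bnd: "\<bar>(\<integral>x. (cl x) ^ j \<partial>D n) - L (?X ^ j)\<bar> \<le> 2 * (real j)\<^sup>2 / real (Suc n)"
      if n: "2 * j \<le> Suc n" for n
    proof -
      have "(\<integral>x. (cl x) ^ j \<partial>D n) = (\<Sum>k\<le>Suc n. (real k / real (Suc n)) ^ j * w (Suc n) k)"
        by (subst intD) (auto intro!: sum.cong simp del: of_nat_Suc sum.atMost_Suc simp: clk)
      moreover have "L (?X ^ j) = (\<Sum>k\<le>Suc n. real (k choose j) / real (Suc n choose j) * w (Suc n) k)"
        using w1[of j "Suc n"] n
        by (simp add: sum_divide_distrib[symmetric] field_simps del: sum.atMost_Suc binomial_Suc_Suc)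
      ultimately have "\<bar>(\<integral>x. (cl x) ^ j \<partial>D n) - L (?X ^ j)\<bar>
          = \<bar>\<Sum>k\<le>Suc n. (real (k choose j) / real (Suc n choose j) - (real k / real (Suc n)) ^ j) * w (Suc n) k\<bar>"
        by (simp only: left_diff_distrib sum_subtractf abs_minus_commute)
      also have "\<dots> \<le> (\<Sum>k\<le>Suc n. \<bar>(real (k choose j) / real (Suc n choose j) - (real k / real (Suc n)) ^ j) * w (Suc n) k\<bar>)"
        by (rule sum_abs)
      also have "\<dots> \<le> (\<Sum>k\<le>Suc n. 2 * (real j)\<^sup>2 / real (Suc n) * w (Suc n) k)"
        unfolding abs_mult using n w0
        by (intro sum_mono mult_mono binomial_quotient_approx_power) auto
      also have "\<dots> = 2 * (real j)\<^sup>2 / real (Suc n)"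
        by (simp only: sum_distrib_left[symmetric] wsum mult_1_right)
      finally show ?thesis .
    qed
    have "(\<lambda>n. \<integral>x. (cl x) ^ j \<partial>D n) \<longlonglongrightarrow> L (?X ^ j)"
    proof (rule LIM_zero_cancel)
      show "(\<lambda>n. (\<integral>x. (cl x) ^ j \<partial>D n) - L (?X ^ j)) \<longlonglongrightarrow> 0"
      proof (rule Lim_null_comparison)
        show "\<forall>\<^sub>F n in sequentially. norm ((\<integral>x. (cl x) ^ j \<partial>D n) - L (?X ^ j)) \<le> 2 * (real j)\<^sup>2 / real (Suc n)"
          using eventually_ge_at_top[of "2 * j"]
          by eventually_elim (use bnd in \<open>auto simp del: of_nat_Suc\<close>)
        show "(\<lambda>n. 2 * (real j)\<^sup>2 / real (Suc n)) \<longlonglongrightarrow> 0"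
          using LIMSEQ_Suc[OF lim_const_over_n[of "2 * (real j)\<^sup>2"]] by simp
      qed
    qed
    from LIMSEQ_subseq_LIMSEQ[OF this r] have "(\<lambda>n. \<integral>x. (cl x) ^ j \<partial>(D \<circ> r) n) \<longlonglongrightarrow> L (?X ^ j)"
      by (simp add: o_def)
    with c1 have "(\<integral>x. (cl x) ^ j \<partial>M) = L (?X ^ j)" by (rule LIMSEQ_unique)
    moreover have "(\<integral>x. (cl x) ^ j \<partial>M) = (\<integral>x. x ^ j \<partial>M)"
    proof (rule integral_cong_AE)
      show "AE x in M. cl x ^ j = x ^ j"
        using AE by eventually_elim (auto simp: cl_def)
    qed simp_all
    ultimately show ?thesis by simp
  qed
  have "(\<integral>x. poly p x \<partial>M) = L p" for p
  proof -
    have int: "integrable M (\<lambda>x. coeff p i * x ^ i)" for i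
    proof (rule M.integrable_const_bound[where B = "\<bar>coeff p i\<bar>"])
      show "AE x in M. norm (coeff p i * x ^ i) \<le> \<bar>coeff p i\<bar>"
      proof (rule AE_mp[OF AE], rule AE_I2, rule impI)
        fix x :: real assume "x \<in> {0..1}"
        then have "x ^ i \<le> 1" "0 \<le> x ^ i" by (auto intro: power_le_one)
        then show "norm (coeff p i * x ^ i) \<le> \<bar>coeff p i\<bar>"
          using mult_left_mono[of "x ^ i" 1 "\<bar>coeff p i\<bar>"] by (simp only: real_norm_def abs_mult abs_of_nonneg abs_ge_zero mult_1_right)
      qed
      show "(\<lambda>x. coeff p i * x ^ i) \<in> borel_measurable M"
        by (intro borel_measurable_times borel_measurable_power borel_measurable_const
            measurable_ident_sets M.events_eq_borel)
    qed
    have "(\<integral>x. poly p x \<partial>M) = (\<Sum>i\<le>degree p. coeff p i * L (?X ^ i))"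
      unfolding poly_altdef
      by (subst Bochner_Integration.integral_sum[OF int])
         (simp only: integral_mult_right_zero mom)
    also have "\<dots> = L (\<Sum>i\<le>degree p. monom (coeff p i) i)"
      by (simp add: Lsum monom_altdef smult)
    finally show ?thesis by (simp add: poly_as_sum_of_monoms)
  qed
  then show ?thesis
    using M.prob_space_axioms AE M.events_eq_borel by (intro exI[of _ M] conjI allI) simp_all
qed

section \<open>Functional calculus for positive contractions\<close>

text \<open>Boundedness is demanded on [0, 1] only, where the measures of the calculus live, so that
  polynomials and \<open>sqrt\<close> qualify.\<close>

definition bounded_borel_01 :: "(real \<Rightarrow> real) \<Rightarrow> bool"
  where "bounded_borel_01 f \<longleftrightarrow> f \<in> borel_measurable borel \<and> (\<exists>B. \<forall>r\<in>{0..1}. \<bar>f r\<bar> \<le> B)"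

lemma bounded_borel_01_add:
  assumes "bounded_borel_01 f" "bounded_borel_01 g"
  shows "bounded_borel_01 (\<lambda>r. f r + g r)"
proof -
  from assms obtain B C where "\<forall>r\<in>{0..1}. \<bar>f r\<bar> \<le> B" "\<forall>r\<in>{0..1}. \<bar>g r\<bar> \<le> C"
    unfolding bounded_borel_01_def by blast
  then have "\<forall>r\<in>{0..1}. \<bar>f r + g r\<bar> \<le> B + C" by (metis abs_triangle_ineq add_mono order_trans)
  with assms show ?thesis unfolding bounded_borel_01_def by (auto intro: borel_measurable_add)
qed

lemma bounded_borel_01_mult:
  assumes "bounded_borel_01 f" "bounded_borel_01 g"
  shows "bounded_borel_01 (\<lambda>r. f r * g r)"
proof -
  from assms obtain B C where BC: "\<forall>r\<in>{0..1}. \<bar>f r\<bar> \<le> B" "\<forall>r\<in>{0..1}. \<bar>g r\<bar> \<le> C"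
    unfolding bounded_borel_01_def by blast
  have "\<bar>f r * g r\<bar> \<le> B * C" if "r \<in> {0..1}" for r
    unfolding abs_mult using BC that by (intro mult_mono) (force intro: order_trans[of 0 "\<bar>f r\<bar>"])+
  then have "\<exists>D. \<forall>r\<in>{0..1}. \<bar>f r * g r\<bar> \<le> D" by blast
  with assms show ?thesis unfolding bounded_borel_01_def by (simp add: borel_measurable_times)
qed

lemma bounded_borel_01_continuous:
  assumes "continuous_on {0..1} f" "f \<in> borel_measurable borel"
  shows "bounded_borel_01 f"
proof -
  have "compact (f ` {0..1})" using assms by (intro compact_continuous_image) auto
  then obtain B where "\<forall>y\<in>f ` {0..1}. norm y \<le> B"
    using compact_imp_bounded bounded_iff by metis
  with assms show ?thesis unfolding bounded_borel_01_def by auto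
qed

lemma bounded_borel_01_poly: "bounded_borel_01 (poly p)"
  by (intro bounded_borel_01_continuous continuous_intros borel_measurable_continuous_onI)

lemma bounded_borel_01_const: "bounded_borel_01 (\<lambda>r. c)"
  by (intro bounded_borel_01_continuous) auto

lemma bounded_borel_01_diff:
  assumes "bounded_borel_01 f" "bounded_borel_01 g"
  shows "bounded_borel_01 (\<lambda>r. f r - g r)"
  using bounded_borel_01_add[OF assms(1) bounded_borel_01_mult[OF bounded_borel_01_const[of "-1"] assms(2)]]
  by simp

lemma bounded_borel_01_power2: "bounded_borel_01 f \<Longrightarrow> bounded_borel_01 (\<lambda>r. (f r)\<^sup>2)"
  unfolding power2_eq_square by (rule bounded_borel_01_mult)

lemma bounded_borel_01_abs: "bounded_borel_01 f \<Longrightarrow> bounded_borel_01 (\<lambda>r. \<bar>f r\<bar>)"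
  unfolding bounded_borel_01_def by (auto intro: borel_measurable_abs)

lemma bounded_borel_01_indicator:
  assumes "M \<in> sets borel"
  shows "bounded_borel_01 (indicator M)"
  unfolding bounded_borel_01_def
  using assms by (auto intro!: exI[of _ 1] simp: indicator_def)

lemmas bounded_borel_01_intros =
  bounded_borel_01_add bounded_borel_01_mult bounded_borel_01_diff bounded_borel_01_power2
  bounded_borel_01_poly bounded_borel_01_const bounded_borel_01_abs bounded_borel_01_indicator

section \<open>Finite measures on the unit interval\<close>

definition finite_measure_01 :: "real measure \<Rightarrow> bool"
  where "finite_measure_01 M \<longleftrightarrow>
    finite_measure M \<and> sets M = sets borel \<and> (AE r in M. r \<in> {0..1})"

lemma integrable_bounded_borel_01:
  assumes "finite_measure_01 M" "bounded_borel_01 f"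
  shows "integrable M f"
proof -
  from assms(2) obtain B where B: "\<forall>r\<in>{0..1}. \<bar>f r\<bar> \<le> B" unfolding bounded_borel_01_def by blast
  from assms(1) have M: "finite_measure M" and s: "sets M = sets borel" and AE: "AE r in M. r \<in> {0..1}"
    unfolding finite_measure_01_def by auto
  show ?thesis
  proof (rule finite_measure.integrable_const_bound[OF M])
    show "AE r in M. norm (f r) \<le> B" using AE by eventually_elim (use B in auto)
    show "f \<in> borel_measurable M"
      using assms(2) unfolding bounded_borel_01_def by (simp add: measurable_cong_sets[OF s refl])
  qed
qed

lemma integral_mono_01:
  assumes "finite_measure_01 M" "bounded_borel_01 f" "bounded_borel_01 g"
    and "\<And>r. r \<in> {0..1} \<Longrightarrow> f r \<le> g r"
  shows "integral\<^sup>L M f \<le> integral\<^sup>L M g"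
proof (rule integral_mono_AE)
  show "AE r in M. f r \<le> g r"
    using assms(1)[unfolded finite_measure_01_def, THEN conjunct2, THEN conjunct2]
    by eventually_elim (rule assms(4))
qed (use assms in \<open>auto intro: integrable_bounded_borel_01\<close>)

text \<open>On a finite measure the inequality \<open>\<bar>y\<bar> \<le> d + y^2 / d\<close> turns
  L2 convergence into L1 convergence, which gives the first claim. The second follows from
  \<open>P^2 - g^2 = (P - g)^2 + 2 g (P - g)\<close> and the bound on \<open>g\<close>.\<close>

lemma L2_conv_01:
  assumes M: "finite_measure_01 M" and g: "bounded_borel_01 g"
    and P: "\<And>n. bounded_borel_01 (P n)"
    and lim: "(\<lambda>n::nat. \<integral>r. (P n r - g r)\<^sup>2 \<partial>M) \<longlonglongrightarrow> 0"
  shows "(\<lambda>n. \<integral>r. P n r \<partial>M) \<longlonglongrightarrow> (\<integral>r. g r \<partial>M)"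
    and "(\<lambda>n. \<integral>r. (P n r)\<^sup>2 \<partial>M) \<longlonglongrightarrow> (\<integral>r. (g r)\<^sup>2 \<partial>M)"
proof -
  note I = integrable_bounded_borel_01[OF M]
  note bi = bounded_borel_01_intros g P
  have abs0: "(\<lambda>n. \<integral>r. \<bar>P n r - g r\<bar> \<partial>M) \<longlonglongrightarrow> 0"
  proof (rule LIMSEQ_I)
    fix e :: real assume e: "e > 0"
    define m :: real where "m = (\<integral>r. 1 \<partial>M)"
    have m: "m \<ge> 0" unfolding m_def by (rule integral_nonneg_AE) simp
    \<comment> \<open>\<open>d\<close> times the total mass stays below \<open>e / 2\<close>; the
      squared L2 distance is pushed below \<open>e / 4 * d\<close>, so that its share after division
      by \<open>d\<close> is below \<open>e / 4\<close>.\<close>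
    define d where "d = e / (2 * (m + 1))"
    have d: "d > 0" "d * m < e / 2 + e / 4" using e m by (auto simp: d_def field_simps intro: add_pos_nonneg)
    have "e / 4 * d > 0" using e d by simp
    from LIMSEQ_D[OF lim this] obtain n0 where
      n0: "\<And>n. n \<ge> n0 \<Longrightarrow> norm ((\<integral>r. (P n r - g r)\<^sup>2 \<partial>M) - 0) < e / 4 * d" by blast
    have "norm ((\<integral>r. \<bar>P n r - g r\<bar> \<partial>M) - 0) < e" if "n \<ge> n0" for n
    proof -
      have pt: "\<bar>y\<bar> \<le> d + (1 / d) * y\<^sup>2" for y :: real
      proof (cases "\<bar>y\<bar> \<le> d")
        case True
        have "0 \<le> (1 / d) * y\<^sup>2" using d by simp
        with True show ?thesis by linarith
      next
        case False
        then have "d * \<bar>y\<bar> \<le> \<bar>y\<bar> * \<bar>y\<bar>" using d by (intro mult_right_mono) auto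
          then have "d * \<bar>y\<bar> \<le> y\<^sup>2" by (simp add: power2_eq_square)
        then have "\<bar>y\<bar> \<le> (1 / d) * y\<^sup>2" using d by (simp add: field_simps)
        then show ?thesis using d by linarith
      qed
      have "(\<integral>r. \<bar>P n r - g r\<bar> \<partial>M) \<le> (\<integral>r. d + (1 / d) * (P n r - g r)\<^sup>2 \<partial>M)"
        by (rule integral_mono_01[OF M]) (intro bi, intro bi, rule pt)
      also have "\<dots> = d * m + (1 / d) * (\<integral>r. (P n r - g r)\<^sup>2 \<partial>M)"
        unfolding m_def integral_mult_right_zero[symmetric] mult_1_right
        by (rule Bochner_Integration.integral_add) (intro I bi)+
      also have "(1 / d) * (\<integral>r. (P n r - g r)\<^sup>2 \<partial>M) < e / 4"
        using n0[OF that] d by (simp add: field_simps abs_less_iff)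
      finally have "(\<integral>r. \<bar>P n r - g r\<bar> \<partial>M) < e" using d by linarith
      moreover have "0 \<le> (\<integral>r. \<bar>P n r - g r\<bar> \<partial>M)" by (rule integral_nonneg_AE) simp
      ultimately show ?thesis by simp
    qed
    then show "\<exists>no. \<forall>n\<ge>no. norm ((\<integral>r. \<bar>P n r - g r\<bar> \<partial>M) - 0) < e" by blast
  qed
  show "(\<lambda>n. \<integral>r. P n r \<partial>M) \<longlonglongrightarrow> (\<integral>r. g r \<partial>M)"
  proof (rule LIM_zero_cancel, rule Lim_null_comparison[OF always_eventually abs0], rule allI)
    fix n
    have "(\<integral>r. P n r \<partial>M) - (\<integral>r. g r \<partial>M) = (\<integral>r. P n r - g r \<partial>M)"
      by (rule Bochner_Integration.integral_diff[symmetric]) (intro I bi)+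
    then show "norm ((\<integral>r. P n r \<partial>M) - (\<integral>r. g r \<partial>M)) \<le> (\<integral>r. \<bar>P n r - g r\<bar> \<partial>M)"
      using integral_norm_bound[of M "\<lambda>r. P n r - g r"] by simp
  qed
  show "(\<lambda>n. \<integral>r. (P n r)\<^sup>2 \<partial>M) \<longlonglongrightarrow> (\<integral>r. (g r)\<^sup>2 \<partial>M)"
  proof (rule LIM_zero_cancel)
    from g obtain B where B: "\<And>r. r \<in> {0..1} \<Longrightarrow> \<bar>g r\<bar> \<le> B" unfolding bounded_borel_01_def by blast
    show "(\<lambda>n. (\<integral>r. (P n r)\<^sup>2 \<partial>M) - (\<integral>r. (g r)\<^sup>2 \<partial>M)) \<longlonglongrightarrow> 0"
    proof (rule Lim_null_comparison[OF always_eventually], rule allI)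
      fix n
      have "(\<integral>r. (P n r)\<^sup>2 \<partial>M) - (\<integral>r. (g r)\<^sup>2 \<partial>M) = (\<integral>r. (P n r)\<^sup>2 - (g r)\<^sup>2 \<partial>M)"
        by (rule Bochner_Integration.integral_diff[symmetric]) (intro I bi)+
      also have "norm \<dots> \<le> (\<integral>r. \<bar>(P n r)\<^sup>2 - (g r)\<^sup>2\<bar> \<partial>M)"
        using integral_norm_bound[of M "\<lambda>r. (P n r)\<^sup>2 - (g r)\<^sup>2"] by simp
      also have "\<dots> \<le> (\<integral>r. (P n r - g r)\<^sup>2 + 2 * B * \<bar>P n r - g r\<bar> \<partial>M)"
      proof (rule integral_mono_01[OF M])
        fix r :: real assume "r \<in> {0..1}"
        have "\<bar>(P n r)\<^sup>2 - (g r)\<^sup>2\<bar> = \<bar>(P n r - g r)\<^sup>2 + 2 * g r * (P n r - g r)\<bar>"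
          by (simp add: power2_eq_square algebra_simps)
        also have "\<dots> \<le> (P n r - g r)\<^sup>2 + \<bar>2 * g r * (P n r - g r)\<bar>"
          using abs_triangle_ineq[of "(P n r - g r)\<^sup>2" "2 * g r * (P n r - g r)"] by simp
        also have "\<bar>2 * g r * (P n r - g r)\<bar> \<le> 2 * B * \<bar>P n r - g r\<bar>"
          unfolding abs_mult using B[OF \<open>r \<in> {0..1}\<close>] by (intro mult_right_mono) auto
        finally show "\<bar>(P n r)\<^sup>2 - (g r)\<^sup>2\<bar> \<le> (P n r - g r)\<^sup>2 + 2 * B * \<bar>P n r - g r\<bar>" by simp
      qed (intro bi)+
      also have "\<dots> = (\<integral>r. (P n r - g r)\<^sup>2 \<partial>M) + 2 * B * (\<integral>r. \<bar>P n r - g r\<bar> \<partial>M)"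
        unfolding integral_mult_right_zero[symmetric]
        by (rule Bochner_Integration.integral_add) (intro I bi)+
      finally show "norm ((\<integral>r. (P n r)\<^sup>2 \<partial>M) - (\<integral>r. (g r)\<^sup>2 \<partial>M)) \<le>
        (\<integral>r. (P n r - g r)\<^sup>2 \<partial>M) + 2 * B * (\<integral>r. \<bar>P n r - g r\<bar> \<partial>M)" .
    next
      show "(\<lambda>n. (\<integral>r. (P n r - g r)\<^sup>2 \<partial>M) + 2 * B * (\<integral>r. \<bar>P n r - g r\<bar> \<partial>M)) \<longlonglongrightarrow> 0"
        using tendsto_add[OF lim tendsto_mult_left[OF abs0, of "2 * B"]] by simp
    qed
  qed
qed

section \<open>Polynomial calculus and moment measures of a positive contraction\<close>

locale positive_contraction =
  fixes R :: "'a::{real_inner,banach} \<Rightarrow> 'a"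
  assumes bounded_linear: "bounded_linear R"
    and sym: "inner (R x) y = inner x (R y)"
    and nonneg: "0 \<le> inner (R x) x"
    and le_id: "inner (R x) x \<le> inner x x"
begin

lemma add: "R (x + y) = R x + R y" and scaleR: "R (c *\<^sub>R x) = c *\<^sub>R R x"
  and zero: "R 0 = 0"
  using bounded_linear
  by (simp_all add: linear_simps)

definition poly_op :: "real poly \<Rightarrow> 'a \<Rightarrow> 'a"
  where "poly_op p x = fold_coeffs (\<lambda>c y. c *\<^sub>R x + R y) p 0"

lemma poly_op_0[simp]: "poly_op 0 x = 0"
  by (simp add: poly_op_def)

lemma poly_op_pCons[simp]: "poly_op (pCons c p) x = c *\<^sub>R x + R (poly_op p x)"
  by (cases "p = 0 \<and> c = 0") (auto simp: poly_op_def zero)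

lemma poly_op_add: "poly_op (p + q) x = poly_op p x + poly_op q x"
  by (induction p q rule: poly_induct2) (auto simp: add scaleR_add_left)

lemma poly_op_smult: "poly_op (smult c p) x = c *\<^sub>R poly_op p x"
  by (induction p) (auto simp: scaleR scaleR_add_right)

lemma poly_op_diff: "poly_op (p - q) x = poly_op p x - poly_op q x"
  using poly_op_add[of p "smult (-1) q"] poly_op_smult[of "-1" q] by simp

lemma poly_op_mult: "poly_op (p * q) x = poly_op p (poly_op q x)"
  by (induction p) (auto simp: poly_op_add poly_op_smult)

lemma poly_op_1[simp]: "poly_op 1 x = x"
  by (simp add: one_pCons zero)

lemma bounded_linear_poly_op: "bounded_linear (poly_op p)"
proof (induction p)
  case 0
  have "poly_op 0 = (\<lambda>x. 0)" by auto
  then show ?case by simp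
next
  case (pCons c p)
  have "bounded_linear (\<lambda>x. c *\<^sub>R x + R (poly_op p x))"
    by (intro bounded_linear_add bounded_linear_scaleR_right
        bounded_linear_compose[OF bounded_linear pCons(2)])
  moreover have "poly_op (pCons c p) = (\<lambda>x. c *\<^sub>R x + R (poly_op p x))" by auto
  ultimately show ?case by simp
qed

text \<open>The calculus is built over a real inner product space, where a complex scalar is just an
  operator \<open>J\<close> commuting with \<open>R\<close>; the extension
  \<open>fcalc_commute\<close> later yields complex homogeneity. With \<open>J = R\<close> the lemma
  also gives symmetry of \<open>poly_op p\<close>.\<close>

lemma poly_op_commute:
  assumes "bounded_linear J" "\<And>x. R (J x) = J (R x)"
  shows "poly_op p (J x) = J (poly_op p x)"
  by (induction p) (use assms in \<open>auto simp: linear_simps\<close>)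

lemma poly_op_sym: "inner (poly_op p x) y = inner x (poly_op p y)"
  by (induction p arbitrary: x y)
     (auto simp: inner_add_left inner_add_right sym poly_op_commute[OF bounded_linear])

lemma poly_op_in_subspace:
  assumes "subspace K" "\<And>x. x \<in> K \<Longrightarrow> R x \<in> K" "x \<in> K"
  shows "poly_op p x \<in> K"
  by (induction p) (use assms in \<open>auto intro: subspace_add subspace_scale subspace_0\<close>)

text \<open>Even powers are moved to both sides of the inner product as squares of a symmetric
  operator, which leaves exponents 0 or 1. The remaining mixed product is
  \<open>X Y = X^2 Y + Y^2 X\<close>, valid because \<open>X + Y = 1\<close>. Positivity thus
  follows from \<open>0 \<le> R \<le> I\<close> before any square root is available.\<close>

lemma bernstein_pos: "0 \<le> inner (poly_op ([:0, 1:] ^ i * [:1, -1:] ^ j) x) x"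
proof -
  let ?X = "[:0, 1:] :: real poly" and ?Y = "[:1, -1:] :: real poly"
  have sq: "inner (poly_op (q * q * p) x) x = inner (poly_op p (poly_op q x)) (poly_op q x)" for p q x
    by (metis mult.assoc mult.commute poly_op_mult poly_op_sym)
  have X: "0 \<le> inner (poly_op ?X x) x" for x using nonneg by (simp add: zero)
  have Y: "0 \<le> inner (poly_op ?Y x) x" for x
    using le_id by (simp add: zero linear_simps[OF bounded_linear] add scaleR inner_diff_left)
  have "?X * ?Y = ?X * ?X * ?Y + ?Y * ?Y * ?X" by simp
  then have XY: "0 \<le> inner (poly_op (?X * ?Y) x) x" for x
    by (simp only: poly_op_add inner_add_left sq) (use X Y in auto)
  have ev: "p ^ n = p ^ (n div 2) * p ^ (n div 2) * p ^ (n mod 2)" for p :: "real poly" and n :: nat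
  proof -
    have "n = n div 2 + n div 2 + n mod 2" by presburger
    then show ?thesis by (metis power_add)
  qed
  have "?X ^ i * ?Y ^ j = (?X ^ (i div 2) * ?Y ^ (j div 2)) * (?X ^ (i div 2) * ?Y ^ (j div 2)) *
      (?X ^ (i mod 2) * ?Y ^ (j mod 2))"
    by (subst ev[of ?X i], subst ev[of ?Y j]) (simp only: mult_ac)
  moreover have "0 \<le> inner (poly_op (?X ^ (i mod 2) * ?Y ^ (j mod 2)) x) x" for x
    using X[of x] Y[of x] XY[of x] mod_less_divisor[of 2 i] mod_less_divisor[of 2 j]
    by (cases "i mod 2"; cases "j mod 2") (auto simp del: mult_pCons_left mult_pCons_right poly_op_pCons)
  ultimately show ?thesis by (simp only: sq)
qed

definition moment_measure :: "'a \<Rightarrow> real measure"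
  where "moment_measure x = (SOME M. finite_measure_01 M \<and>
    (\<forall>p. (\<integral>r. poly p r \<partial>M) = inner (poly_op p x) x))"

text \<open>Divided by \<open>inner x x\<close>, the functional
  \<open>p \<mapsto> <p(R) x, x>\<close> satisfies Hausdorff's condition by
  \<open>bernstein_pos\<close>; a constant density restores the total mass. The zero vector gets the
  null measure.\<close>

lemma moment_measure:
  shows moment_measure_01: "finite_measure_01 (moment_measure x)"
    and moment_measure_poly: "(\<integral>r. poly p r \<partial>moment_measure x) = inner (poly_op p x) x"
proof -
  have "\<exists>M. finite_measure_01 M \<and> (\<forall>p. (\<integral>r. poly p r \<partial>M) = inner (poly_op p x) x)"
  proof (cases "x = 0")
    case True
    show ?thesis
      unfolding finite_measure_01_def
      by (intro exI[of _ "null_measure borel"])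
         (auto simp: True linear_simps[OF bounded_linear_poly_op] AE_iff_null intro!: finite_measureI)
  next
    case False
    define L where "L p = inner (poly_op p x) x / inner x x" for p
    have "\<exists>M. prob_space M \<and> sets M = sets borel \<and> (AE r in M. r \<in> {0..1}) \<and>
      (\<forall>p. (\<integral>r. poly p r \<partial>M) = L p)"
      by (rule hausdorff_moment)
         (use False bernstein_pos in \<open>auto simp: L_def poly_op_add poly_op_smult inner_add_left add_divide_distrib\<close>)
    then obtain M where M: "prob_space M" "sets M = sets borel" "AE r in M. r \<in> {0..1}"
      "\<And>p. (\<integral>r. poly p r \<partial>M) = L p" by blast
    interpret prob_space M by fact
    let ?D = "density M (\<lambda>_. ennreal (inner x x))"
    have sD: "borel_measurable M = borel_measurable borel" by (rule measurable_cong_sets[OF M(2) refl])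
    show ?thesis
    proof (intro exI[of _ ?D] conjI allI)
      show "finite_measure_01 ?D"
        unfolding finite_measure_01_def
      proof (intro conjI)
        show "finite_measure ?D"
          by (rule finite_measureI) (simp add: emeasure_density emeasure_space_1)
        show "AE r in ?D. r \<in> {0..1}" using M(3) by (subst AE_density) (auto elim: eventually_mono)
      qed (simp add: M(2))
      fix p :: "real poly"
      have "(\<integral>r. poly p r \<partial>?D) = (\<integral>r. inner x x * poly p r \<partial>M)"
        by (subst integral_real_density)
           (auto simp: sD intro!: borel_measurable_continuous_onI continuous_intros)
      also have "\<dots> = inner x x * L p" by (simp only: integral_mult_right_zero M(4))
      also have "\<dots> = inner (poly_op p x) x" using False by (simp add: L_def)
      finally show "(\<integral>r. poly p r \<partial>?D) = inner (poly_op p x) x" .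
    qed
  qed
  from someI_ex[OF this] show "finite_measure_01 (moment_measure x)"
    "(\<integral>r. poly p r \<partial>moment_measure x) = inner (poly_op p x) x"
    unfolding moment_measure_def[symmetric] by auto
qed

text \<open>An isometry from the polynomials in \<open>L^2(moment_measure x)\<close> into the
  Hilbert space; the functional calculus is its extension by continuity.\<close>

lemma norm_poly_op: "(norm (poly_op p x))\<^sup>2 = (\<integral>r. (poly p r)\<^sup>2 \<partial>moment_measure x)"
proof -
  have "(\<integral>r. (poly p r)\<^sup>2 \<partial>moment_measure x) = (\<integral>r. poly (p * p) r \<partial>moment_measure x)"
    by (simp add: power2_eq_square)
  then show ?thesis
    by (simp only: moment_measure_poly) (simp add: power2_norm_eq_inner poly_op_mult poly_op_sym)
qed

end

context positive_contraction
begin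

text \<open>Density of the polynomials in every \<open>L\<^sup>2(moment_measure x)\<close>, simultaneously for finitely many \<open>x\<close>.\<close>

abbreviation L2_dist :: "(real \<Rightarrow> real) \<Rightarrow> (real \<Rightarrow> real) \<Rightarrow> 'a \<Rightarrow> real"
  where "L2_dist f g x \<equiv> \<integral>r. (f r - g r)\<^sup>2 \<partial>moment_measure x"

definition approximable :: "(real \<Rightarrow> real) \<Rightarrow> bool"
  where "approximable g \<longleftrightarrow> bounded_borel_01 g \<and>
    (\<forall>F. finite F \<longrightarrow> (\<forall>e>0. \<exists>p. \<forall>x\<in>F. L2_dist (poly p) g x < e))"

lemma approximable_bounded_borel: "approximable g \<Longrightarrow> bounded_borel_01 g"
  by (simp add: approximable_def)

text \<open>Distances are kept squared throughout. This factor 2 stands in for Minkowski's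
  inequality and is the origin of the fractions \<open>e / 4\<close> below.\<close>

lemma L2_triangle:
  assumes "bounded_borel_01 f" "bounded_borel_01 g"
  shows "(\<integral>r. (f r + g r)\<^sup>2 \<partial>moment_measure x) \<le>
    2 * (\<integral>r. (f r)\<^sup>2 \<partial>moment_measure x) + 2 * (\<integral>r. (g r)\<^sup>2 \<partial>moment_measure x)"
proof -
  have "(\<integral>r. (f r + g r)\<^sup>2 \<partial>moment_measure x) \<le> (\<integral>r. 2 * (f r)\<^sup>2 + 2 * (g r)\<^sup>2 \<partial>moment_measure x)"
  proof (rule integral_mono_01[OF moment_measure_01])
    fix r :: real
    have "0 \<le> (f r - g r)\<^sup>2" by simp
    then show "(f r + g r)\<^sup>2 \<le> 2 * (f r)\<^sup>2 + 2 * (g r)\<^sup>2"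
      by (simp add: power2_eq_square algebra_simps)
  qed (intro bounded_borel_01_intros assms)+
  also have "\<dots> = 2 * (\<integral>r. (f r)\<^sup>2 \<partial>moment_measure x) + 2 * (\<integral>r. (g r)\<^sup>2 \<partial>moment_measure x)"
    unfolding integral_mult_right_zero[symmetric]
    by (rule Bochner_Integration.integral_add)
       (intro integrable_bounded_borel_01[OF moment_measure_01] bounded_borel_01_intros assms)+
  finally show ?thesis .
qed

lemma approximable_limit:
  assumes g: "bounded_borel_01 g"
    and ap: "\<And>F e. finite F \<Longrightarrow> e > 0 \<Longrightarrow>
      \<exists>h. approximable h \<and> (\<forall>x\<in>F. L2_dist h g x < e)"
  shows "approximable g"
  unfolding approximable_def
proof (intro conjI g allI impI)
  fix F :: "'a set" and e :: real
  assume F: "finite F" and e: "e > 0"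
  then have e4: "e / 4 > 0" by simp
  from ap[OF F this] obtain h where h: "approximable h"
    "\<forall>x\<in>F. L2_dist h g x < e / 4" by blast
  from h(1) F e4 obtain p where p: "\<forall>x\<in>F. L2_dist (poly p) h x < e / 4"
    unfolding approximable_def by blast
  have "L2_dist (poly p) g x < e" if "x \<in> F" for x
  proof -
    have "L2_dist (poly p) g x =
        (\<integral>r. ((poly p r - h r) + (h r - g r))\<^sup>2 \<partial>moment_measure x)" by simp
    also have "\<dots> \<le> 2 * L2_dist (poly p) h x +
        2 * L2_dist h g x"
      by (intro L2_triangle bounded_borel_01_intros approximable_bounded_borel g h(1))
    also have "\<dots> < e" using p[rule_format, OF that] h(2)[rule_format, OF that] by simp
    finally show ?thesis .
  qed
  then show "\<exists>p. \<forall>x\<in>F. L2_dist (poly p) g x < e" by blast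
qed

lemma approximable_poly: "approximable (poly p)"
  unfolding approximable_def by (auto simp: bounded_borel_01_poly intro!: exI[of _ p])

lemma approximable_add:
  assumes "approximable f" "approximable g"
  shows "approximable (\<lambda>r. f r + g r)"
  unfolding approximable_def
proof (intro conjI allI impI)
  note bb = assms[THEN approximable_bounded_borel]
  show "bounded_borel_01 (\<lambda>r. f r + g r)" by (intro bounded_borel_01_intros bb)
  fix F :: "'a set" and e :: real
  assume F: "finite F" and e: "e > 0"
  then have e4: "e / 4 > 0" by simp
  from assms(1) F e4 obtain p where p: "\<forall>x\<in>F. L2_dist (poly p) f x < e / 4"
    unfolding approximable_def by blast
  from assms(2) F e4 obtain q where q: "\<forall>x\<in>F. L2_dist (poly q) g x < e / 4"
    unfolding approximable_def by blast
  have "L2_dist (poly (p + q)) (\<lambda>r. f r + g r) x < e" if "x \<in> F" for x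
  proof -
    have "L2_dist (poly (p + q)) (\<lambda>r. f r + g r) x =
      (\<integral>r. ((poly p r - f r) + (poly q r - g r))\<^sup>2 \<partial>moment_measure x)"
      by (rule Bochner_Integration.integral_cong) (simp_all add: algebra_simps)
    also have "\<dots> \<le> 2 * L2_dist (poly p) f x +
        2 * L2_dist (poly q) g x"
      by (intro L2_triangle bounded_borel_01_intros bb)
    also have "\<dots> < e" using p[rule_format, OF that] q[rule_format, OF that] by simp
    finally show ?thesis .
  qed
  then show "\<exists>p. \<forall>x\<in>F. L2_dist (poly p) (\<lambda>r. f r + g r) x < e" by blast
qed

lemma approximable_uminus:
  assumes "approximable f"
  shows "approximable (\<lambda>r. - f r)"
  unfolding approximable_def
proof (intro conjI allI impI)
  note bb = assms[THEN approximable_bounded_borel]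
  show "bounded_borel_01 (\<lambda>r. - f r)"
    using bounded_borel_01_diff[OF bounded_borel_01_const[of 0] bb] by simp
  fix F :: "'a set" and e :: real
  assume "finite F" "e > 0"
  with assms obtain p where p: "\<forall>x\<in>F. L2_dist (poly p) f x < e"
    unfolding approximable_def by blast
  have "L2_dist (poly (- p)) (\<lambda>r. - f r) x < e" if "x \<in> F" for x
  proof -
    have "L2_dist (poly (- p)) (\<lambda>r. - f r) x = L2_dist (poly p) f x"
      by (rule Bochner_Integration.integral_cong) (simp_all add: power2_commute)
    then show ?thesis using p that by simp
  qed
  then show "\<exists>p. \<forall>x\<in>F. L2_dist (poly p) (\<lambda>r. - f r) x < e" by blast
qed

lemma approximable_continuous:
  assumes c: "continuous_on {0..1} g" and m: "g \<in> borel_measurable borel"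
  shows "approximable g"
  unfolding approximable_def
proof (intro conjI allI impI)
  show g: "bounded_borel_01 g" by (rule bounded_borel_01_continuous[OF c m])
  fix F :: "'a set" and e :: real
  assume F: "finite F" and e: "e > 0"
  \<comment> \<open>\<open>s\<close> bounds the total mass of every \<open>moment_measure x\<close>
    with \<open>x \<in> F\<close>, and the extra 1 keeps it positive. A uniform error
    \<open>d\<close> then costs at most \<open>d^2 s \<le> d s \<le> e / 2\<close>.\<close>
  define s where "s = (\<Sum>x\<in>F. inner x x) + 1"
  have s: "s \<ge> 1" "inner x x \<le> s" if "x \<in> F" for x
    using F that member_le_sum[of x F "\<lambda>x. inner x x"] unfolding s_def by (auto intro: sum_nonneg)
  have s1: "s \<ge> 1" unfolding s_def by (auto intro: sum_nonneg)
  define d where "d = min 1 (e / (2 * s))"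
  have d: "d > 0" "d\<^sup>2 * s < e"
  proof -
    show "d > 0" using e s1 by (simp add: d_def)
    then have "d\<^sup>2 \<le> d * 1" unfolding power2_eq_square by (intro mult_left_mono) (auto simp: d_def)
    then have "d\<^sup>2 * s \<le> d * s" using s1 by (intro mult_right_mono) auto
    also have "d * s \<le> e / (2 * s) * s" using s1 by (intro mult_right_mono) (auto simp: d_def)
    also have "\<dots> < e" using s1 e by simp
    finally show "d\<^sup>2 * s < e" .
  qed
  obtain q where q: "real_polynomial_function q" "\<And>r. r \<in> {0..1} \<Longrightarrow> \<bar>g r - q r\<bar> < d"
    using Stone_Weierstrass_real_polynomial_function[OF _ c d(1)] by auto
  then obtain a n where an: "q = (\<lambda>r. \<Sum>i\<le>n. a i * r ^ i)"
    unfolding real_polynomial_function_iff_sum by blast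
  define p where "p = (\<Sum>i\<le>n. monom (a i) i)"
  have pq: "poly p r = q r" for r by (simp add: p_def an poly_sum poly_monom)
  have "L2_dist (poly p) g x < e" if "x \<in> F" for x
  proof -
    have "L2_dist (poly p) g x \<le> (\<integral>r. poly [:d\<^sup>2:] r \<partial>moment_measure x)"
    proof (rule integral_mono_01[OF moment_measure_01])
      fix r :: real assume "r \<in> {0..1}"
      then have "\<bar>poly p r - g r\<bar> \<le> \<bar>d\<bar>" using q(2)[of r] d(1) by (simp add: pq abs_minus_commute)
      then show "(poly p r - g r)\<^sup>2 \<le> poly [:d\<^sup>2:] r" by (simp add: abs_le_square_iff)
    qed (intro bounded_borel_01_intros g)+
    also have "\<dots> = d\<^sup>2 * inner x x" by (simp only: moment_measure_poly) (simp add: zero)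
    also have "\<dots> \<le> d\<^sup>2 * s" using s(2)[OF that] by (intro mult_left_mono) auto
    finally show ?thesis using d(2) by simp
  qed
  then show "\<exists>p. \<forall>x\<in>F. L2_dist (poly p) g x < e" by blast
qed

text \<open>Dominated convergence applies to each measure separately; finiteness of \<open>F\<close>
  provides one index that works for all of them.\<close>

lemma approximable_pointwise_limit:
  assumes g: "bounded_borel_01 g" and h: "\<And>n. approximable (h n)"
    and B: "\<And>n r. \<bar>h n r - g r\<bar> \<le> B" and lim: "\<And>r. (\<lambda>n::nat. h n r) \<longlonglongrightarrow> g r"
  shows "approximable g"
proof (rule approximable_limit[OF g])
  fix F :: "'a set" and e :: real
  assume F: "finite F" and e: "e > 0"
  have "(\<lambda>n. L2_dist (h n) g x) \<longlonglongrightarrow> (\<integral>r. 0 \<partial>moment_measure x)" for x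
  proof (rule integral_dominated_convergence[where w = "\<lambda>r. B\<^sup>2"])
    note I = integrable_bounded_borel_01[OF moment_measure_01]
    show "integrable (moment_measure x) (\<lambda>r. B\<^sup>2)" by (intro I bounded_borel_01_intros)
    show "(\<lambda>r. (h n r - g r)\<^sup>2) \<in> borel_measurable (moment_measure x)" for n
      by (rule borel_measurable_integrable)
         (intro I bounded_borel_01_intros g approximable_bounded_borel h)
    have "(\<lambda>n. (h n r - g r)\<^sup>2) \<longlonglongrightarrow> (g r - g r)\<^sup>2" for r by (intro tendsto_intros lim)
    then show "AE r in moment_measure x. (\<lambda>n. (h n r - g r)\<^sup>2) \<longlonglongrightarrow> 0" by simp
    have "0 \<le> B" using B[of 0 0] by linarith
    then show "AE r in moment_measure x. norm ((h n r - g r)\<^sup>2) \<le> B\<^sup>2" for n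
      using B by (auto intro!: AE_I2 simp: abs_le_square_iff[symmetric])
  qed simp
  then have "\<forall>\<^sub>F n in sequentially. L2_dist (h n) g x < e" for x
    using e by (auto dest: order_tendstoD(2))
  then have "\<forall>\<^sub>F n in sequentially. \<forall>x\<in>F. L2_dist (h n) g x < e"
    using F by (simp add: eventually_ball_finite)
  then obtain n where "\<forall>x\<in>F. L2_dist (h n) g x < e"
    by (auto simp: eventually_sequentially)
  with h show "\<exists>h. approximable h \<and> (\<forall>x\<in>F. L2_dist h g x < e)" by blast
qed

lemma approximable_indicator_atMost: "approximable (indicator {..c})"
proof (rule approximable_pointwise_limit[where B = 1])
  \<comment> \<open>For \<open>n > 0\<close>, a linear ramp falling from 1 at \<open>c\<close> to 0
    at \<open>c + 1 / n\<close>.\<close>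
  define h where "h n r = max 0 (min 1 (1 - real n * (r - c)))" for n :: nat and r
  show "bounded_borel_01 (indicator {..c})" by (intro bounded_borel_01_indicator) auto
  show "approximable (h n)" for n
    unfolding h_def by (intro approximable_continuous continuous_intros) measurable
  show "\<bar>h n r - indicator {..c} r\<bar> \<le> 1" for n r by (auto simp: h_def indicator_def)
  show "(\<lambda>n. h n r) \<longlonglongrightarrow> indicator {..c} r" for r
  proof (cases "r \<le> c")
    case True
    then have "h n r = 1" for n by (simp add: h_def mult_nonneg_nonpos)
    with True show ?thesis by simp
  next
    case False
    obtain n0 where n0: "real n0 > 1 / (r - c)" using reals_Archimedean2 by blast
    have "h n r = 0" if "n \<ge> n0" for n
    proof -
      have "real n > 1 / (r - c)" using n0 that by linarith
      then have "real n * (r - c) > 1" using False by (simp add: field_simps)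
      then show ?thesis by (simp add: h_def)
    qed
    then have "\<forall>\<^sub>F n in sequentially. h n r = 0" using eventually_sequentially by blast
    with False show ?thesis by (simp add: tendsto_eventually)
  qed
qed

text \<open>Dynkin's argument: the half-lines form an intersection-stable generator, and the sets
  with approximable indicator are closed under complements and countable disjoint unions.\<close>

lemma approximable_indicator:
  assumes "M \<in> sets borel"
  shows "approximable (indicator M)"
proof -
  have b: "sets borel = sigma_sets UNIV (range (\<lambda>c::real. {..c}))"
    by (simp add: borel_eq_atMost)
  have "Int_stable (range (\<lambda>c::real. {..c}))"
    by (auto simp: Int_stable_def intro!: range_eqI[of _ _ "min _ _"])
  moreover have "range (\<lambda>c::real. {..c}) \<subseteq> Pow UNIV" by simp
  moreover have "M \<in> sigma_sets UNIV (range (\<lambda>c::real. {..c}))" using assms b by simp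
  ultimately show ?thesis
  proof (induction rule: sigma_sets_induct_disjoint)
    case (basic A) then show ?case using approximable_indicator_atMost by auto
  next
    case empty
    have e: "indicator {} = (poly 0 :: real \<Rightarrow> real)" by (auto simp: indicator_def)
    show ?case unfolding e by (rule approximable_poly)
  next
    case (compl A)
    have "indicator (UNIV - A) = (\<lambda>r. poly 1 r + - indicator A r :: real)" by (auto simp: indicator_def)
    then show ?case using compl by (simp only:) (intro approximable_add approximable_uminus approximable_poly)
  next
    case (union A)
    have fin: "approximable (indicator (\<Union>i<n. A i))" for n
    proof (induction n)
      case 0
      have e: "indicator (\<Union>i<0. A i) = (poly 0 :: real \<Rightarrow> real)" by (auto simp: indicator_def)
      show ?case unfolding e by (rule approximable_poly)
    next
      case (Suc n)
      have "A n \<inter> A i = {}" if "i < n" for i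
        using disjoint_family_onD[OF union(1), of n i] that by simp
      then have "A n \<inter> (\<Union>i<n. A i) = {}" by blast
      then have "indicator (\<Union>i<Suc n. A i) = (\<lambda>r. indicator (A n) r + indicator (\<Union>i<n. A i) r :: real)"
        by (auto simp: fun_eq_iff lessThan_Suc indicator_def)
      then show ?case using approximable_add[OF union(3)[of n] Suc] by simp
    qed
    show ?case
    proof (rule approximable_pointwise_limit[OF _ fin, where B = 1])
      have "(\<Union>i. A i) \<in> sets borel" using union(2) b by (intro sets.countable_UN) auto
      then show "bounded_borel_01 (indicator (\<Union> (range A)))" by (intro bounded_borel_01_indicator) auto
      show "\<bar>indicator (\<Union>i<n. A i) r - indicator (\<Union> (range A)) r\<bar> \<le> (1::real)" for n r
        by (auto simp: indicator_def)
      show "(\<lambda>n. indicator (\<Union>i<n. A i) r :: real) \<longlonglongrightarrow> indicator (\<Union> (range A)) r" for r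
        by (rule LIMSEQ_indicator_UN)
    qed
  qed
qed

section \<open>Borel functional calculus by extension of the isometry\<close>

definition fcalc :: "(real \<Rightarrow> real) \<Rightarrow> 'a \<Rightarrow> 'a"
  where "fcalc g x = (SOME y. \<forall>p. (norm (poly_op p x - y))\<^sup>2 \<le> 2 * L2_dist (poly p) g x)"

lemma approximating_polys:
  assumes g: "approximable g" and F: "finite F"
  obtains P where "\<And>x. x \<in> F \<Longrightarrow> (\<lambda>n::nat. L2_dist (poly (P n)) g x) \<longlonglongrightarrow> 0"
proof -
  have "\<exists>p. \<forall>x\<in>F. L2_dist (poly p) g x < 1 / real (Suc n)" for n
    using g F unfolding approximable_def by simp
  then obtain P where P: "\<And>n x. x \<in> F \<Longrightarrow> L2_dist (poly (P n)) g x < 1 / real (Suc n)"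
    by metis
  have "(\<lambda>n. L2_dist (poly (P n)) g x) \<longlonglongrightarrow> 0" if "x \<in> F" for x
  proof (rule Lim_null_comparison[OF always_eventually lim_inverse_n'[THEN LIMSEQ_Suc]], rule allI)
    fix n
    have "0 \<le> L2_dist (poly (P n)) g x" by (rule integral_nonneg_AE) simp
    then show "norm (L2_dist (poly (P n)) g x) \<le> 1 / real (Suc n)"
      using P[OF that, of n] by simp
  qed
  then show ?thesis by (rule that)
qed

text \<open>Along an approximating sequence the vectors \<open>poly_op (P n) x\<close> are Cauchy by
  the isometry, and their limit satisfies the bound against every polynomial. Describing
  \<open>fcalc g x\<close> by this inequality, with the factor 2 of \<open>L2_triangle\<close>,
  makes it the limit along every approximating sequence.\<close>

lemma fcalc_bound:
  assumes g: "approximable g"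
  shows "(norm (poly_op p x - fcalc g x))\<^sup>2 \<le> 2 * L2_dist (poly p) g x"
proof -
  note bg = approximable_bounded_borel[OF g]
  define D where "D p = L2_dist (poly p) g x" for p
  obtain P where P: "(\<lambda>n::nat. D (P n)) \<longlonglongrightarrow> 0"
    using approximating_polys[OF g, of "{x}"] unfolding D_def by auto
  have D: "(norm (poly_op p x - poly_op q x))\<^sup>2 \<le> 2 * D p + 2 * D q" for p q
  proof -
    have "(norm (poly_op p x - poly_op q x))\<^sup>2 = (\<integral>r. ((poly p r - g r) + (g r - poly q r))\<^sup>2 \<partial>moment_measure x)"
      by (simp add: poly_op_diff[symmetric] norm_poly_op)
    also have "\<dots> \<le> 2 * D p + 2 * L2_dist g (poly q) x"
      unfolding D_def by (intro L2_triangle bounded_borel_01_intros bg)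
    finally show ?thesis by (simp add: D_def power2_commute)
  qed
  have "Cauchy (\<lambda>n. poly_op (P n) x)"
  proof (rule CauchyI)
    fix e :: real assume e: "e > 0"
    then have "e\<^sup>2 / 4 > 0" by simp
    from LIMSEQ_D[OF P this] obtain n0 where n0: "\<And>n. n \<ge> n0 \<Longrightarrow> norm (D (P n) - 0) < e\<^sup>2 / 4" by blast
    have "norm (poly_op (P m) x - poly_op (P n) x) < e" if "m \<ge> n0" "n \<ge> n0" for m n
    proof -
      have "(norm (poly_op (P m) x - poly_op (P n) x))\<^sup>2 < e\<^sup>2"
        using D[of "P m" "P n"] n0[OF that(1)] n0[OF that(2)] by simp
      then show ?thesis using e by (simp add: power_less_imp_less_base)
    qed
    then show "\<exists>M. \<forall>m\<ge>M. \<forall>n\<ge>M. norm (poly_op (P m) x - poly_op (P n) x) < e" by blast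
  qed
  then obtain y where y: "(\<lambda>n. poly_op (P n) x) \<longlonglongrightarrow> y"
    using Cauchy_convergent_iff convergent_def by metis
  have "(norm (poly_op p x - y))\<^sup>2 \<le> 2 * D p" for p
  proof (rule LIMSEQ_le)
    show "(\<lambda>n. (norm (poly_op p x - poly_op (P n) x))\<^sup>2) \<longlonglongrightarrow> (norm (poly_op p x - y))\<^sup>2"
      by (intro tendsto_intros y)
    show "(\<lambda>n. 2 * D p + 2 * D (P n)) \<longlonglongrightarrow> 2 * D p"
      using tendsto_add[OF tendsto_const tendsto_mult_left[OF P, of 2], of "2 * D p"] by simp
  qed (use D in blast)
  then have "\<exists>y. \<forall>p. (norm (poly_op p x - y))\<^sup>2 \<le> 2 * D p" by blast
  from someI_ex[OF this] show ?thesis unfolding D_def fcalc_def by blast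
qed

lemma poly_op_tendsto_fcalc:
  assumes g: "approximable g" and P: "(\<lambda>n::nat. L2_dist (poly (P n)) g x) \<longlonglongrightarrow> 0"
  shows "(\<lambda>n. poly_op (P n) x) \<longlonglongrightarrow> fcalc g x"
proof -
  have "(\<lambda>n. (norm (poly_op (P n) x - fcalc g x))\<^sup>2) \<longlonglongrightarrow> 0"
  proof (rule Lim_null_comparison[OF always_eventually])
    show "(\<lambda>n. 2 * L2_dist (poly (P n)) g x) \<longlonglongrightarrow> 0"
      using tendsto_mult_left[OF P, of 2] by simp
    show "\<forall>n. norm ((norm (poly_op (P n) x - fcalc g x))\<^sup>2) \<le> 2 * L2_dist (poly (P n)) g x"
      using fcalc_bound[OF g] by simp
  qed
  then have "(\<lambda>n. sqrt ((norm (poly_op (P n) x - fcalc g x))\<^sup>2)) \<longlonglongrightarrow> sqrt 0"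
    by (rule tendsto_real_sqrt)
  then show ?thesis by (simp add: tendsto_norm_zero_iff LIM_zero_iff)
qed

lemma fcalc_commute:
  assumes g: "approximable g" and J: "bounded_linear J" "\<And>x. R (J x) = J (R x)"
  shows "fcalc g (J x) = J (fcalc g x)"
proof -
  obtain P where P: "\<And>z. z \<in> {x, J x} \<Longrightarrow>
      (\<lambda>n::nat. L2_dist (poly (P n)) g z) \<longlonglongrightarrow> 0"
    using approximating_polys[OF g, of "{x, J x}"] by auto
  have "(\<lambda>n. poly_op (P n) (J x)) \<longlonglongrightarrow> J (fcalc g x)"
    unfolding poly_op_commute[OF J]
    by (rule bounded_linear.tendsto[OF J(1)]) (intro poly_op_tendsto_fcalc g P, simp)
  moreover have "(\<lambda>n. poly_op (P n) (J x)) \<longlonglongrightarrow> fcalc g (J x)"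
    by (intro poly_op_tendsto_fcalc g P) simp
  ultimately show ?thesis by (rule LIMSEQ_unique[symmetric])
qed

text \<open>One polynomial sequence has to converge at \<open>x\<close>, \<open>y\<close> and
  \<open>x + y\<close> together, although these vectors have different moment measures. This is why
  \<open>approximable\<close> quantifies over finite sets of vectors.\<close>

lemma fcalc_add:
  assumes g: "approximable g"
  shows "fcalc g (x + y) = fcalc g x + fcalc g y"
proof -
  obtain P where P: "\<And>z. z \<in> {x, y, x + y} \<Longrightarrow>
      (\<lambda>n::nat. L2_dist (poly (P n)) g z) \<longlonglongrightarrow> 0"
    using approximating_polys[OF g, of "{x, y, x + y}"] by auto
  have "(\<lambda>n. poly_op (P n) (x + y)) \<longlonglongrightarrow> fcalc g x + fcalc g y"
    unfolding linear_simps(1)[OF bounded_linear_poly_op]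
    by (intro tendsto_add poly_op_tendsto_fcalc g P) auto
  moreover have "(\<lambda>n. poly_op (P n) (x + y)) \<longlonglongrightarrow> fcalc g (x + y)"
    by (intro poly_op_tendsto_fcalc g P) simp
  ultimately show ?thesis by (rule LIMSEQ_unique[symmetric])
qed

lemma fcalc_sym:
  assumes g: "approximable g"
  shows "inner (fcalc g x) y = inner x (fcalc g y)"
proof -
  obtain P where P: "\<And>z. z \<in> {x, y} \<Longrightarrow>
      (\<lambda>n::nat. L2_dist (poly (P n)) g z) \<longlonglongrightarrow> 0"
    using approximating_polys[OF g, of "{x, y}"] by auto
  have "(\<lambda>n. inner (poly_op (P n) x) y) \<longlonglongrightarrow> inner (fcalc g x) y"
    by (intro tendsto_intros poly_op_tendsto_fcalc g P) simp
  moreover have "(\<lambda>n. inner (poly_op (P n) x) y) \<longlonglongrightarrow> inner x (fcalc g y)"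
    unfolding poly_op_sym by (intro tendsto_intros poly_op_tendsto_fcalc g P) simp
  ultimately show ?thesis by (rule LIMSEQ_unique)
qed

text \<open>Both identities pass to the limit by \<open>L2_conv_01\<close>. With symmetry they show
  that \<open>fcalc g\<close> applied twice has the quadratic form of \<open>g^2\<close>, which is
  how products are controlled below.\<close>

lemma inner_fcalc:
  assumes g: "approximable g"
  shows "inner (fcalc g x) x = (\<integral>r. g r \<partial>moment_measure x)"
    and "inner (fcalc g x) (fcalc g x) = (\<integral>r. (g r)\<^sup>2 \<partial>moment_measure x)"
proof -
  obtain P where P: "(\<lambda>n::nat. L2_dist (poly (P n)) g x) \<longlonglongrightarrow> 0"
    using approximating_polys[OF g, of "{x}"] by auto
  note t = poly_op_tendsto_fcalc[OF g P]
  note c = L2_conv_01[OF moment_measure_01 approximable_bounded_borel[OF g] bounded_borel_01_poly P]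
  have "(\<lambda>n. inner (poly_op (P n) x) x) \<longlonglongrightarrow> inner (fcalc g x) x" by (intro tendsto_intros t)
  then show "inner (fcalc g x) x = (\<integral>r. g r \<partial>moment_measure x)"
    using LIMSEQ_unique[OF c(1)] unfolding moment_measure_poly by simp
  have "(\<lambda>n. (norm (poly_op (P n) x))\<^sup>2) \<longlonglongrightarrow> (norm (fcalc g x))\<^sup>2" by (intro tendsto_intros t)
  then show "inner (fcalc g x) (fcalc g x) = (\<integral>r. (g r)\<^sup>2 \<partial>moment_measure x)"
    using LIMSEQ_unique[OF c(2)] unfolding norm_poly_op by (simp add: power2_norm_eq_inner)
qed

lemma norm_fcalc_le:
  assumes g: "approximable g" and B: "\<And>r. r \<in> {0..1} \<Longrightarrow> \<bar>g r\<bar> \<le> B"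
  shows "norm (fcalc g x) \<le> B * norm x"
proof -
  have B0: "0 \<le> B" using B[of 0] by simp
  have "(norm (fcalc g x))\<^sup>2 = (\<integral>r. (g r)\<^sup>2 \<partial>moment_measure x)"
    using inner_fcalc(2)[OF g] by (simp add: power2_norm_eq_inner)
  also have "\<dots> \<le> (\<integral>r. poly [:B\<^sup>2:] r \<partial>moment_measure x)"
  proof (rule integral_mono_01[OF moment_measure_01])
    fix r :: real assume "r \<in> {0..1}"
    then show "(g r)\<^sup>2 \<le> poly [:B\<^sup>2:] r" using B B0 by (simp add: abs_le_square_iff[symmetric])
  qed (intro bounded_borel_01_intros approximable_bounded_borel g)+
  also have "\<dots> = (B * norm x)\<^sup>2"
    by (simp only: moment_measure_poly) (simp add: zero power_mult_distrib power2_norm_eq_inner)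
  finally show ?thesis by (rule power2_le_imp_le) (simp add: B0)
qed

text \<open>Lets the spectral projections act on the closed subspace \<open>H_AB A B\<close>
  although the calculus runs on the ambient space.\<close>

lemma fcalc_in_subspace:
  assumes g: "approximable g" and K: "subspace K" "closed K" "\<And>x. x \<in> K \<Longrightarrow> R x \<in> K" "x \<in> K"
  shows "fcalc g x \<in> K"
proof -
  obtain P where P: "(\<lambda>n::nat. L2_dist (poly (P n)) g x) \<longlonglongrightarrow> 0"
    using approximating_polys[OF g, of "{x}"] by auto
  show ?thesis
    by (rule closed_sequentially[OF K(2) _ poly_op_tendsto_fcalc[OF g P]])
       (rule poly_op_in_subspace[OF K(1,3,4)])
qed

lemma fcalc_add_fun:
  assumes f: "approximable f" and g: "approximable g"
  shows "fcalc (\<lambda>r. f r + g r) x = fcalc f x + fcalc g x"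
proof -
  obtain P where P: "(\<lambda>n::nat. L2_dist (poly (P n)) f x) \<longlonglongrightarrow> 0"
    using approximating_polys[OF f, of "{x}"] by auto
  obtain Q where Q: "(\<lambda>n::nat. L2_dist (poly (Q n)) g x) \<longlonglongrightarrow> 0"
    using approximating_polys[OF g, of "{x}"] by auto
  have "(\<lambda>n. L2_dist (poly (P n + Q n)) (\<lambda>r. f r + g r) x) \<longlonglongrightarrow> 0"
  proof (rule Lim_null_comparison[OF always_eventually], rule allI)
    fix n
    have "L2_dist (poly (P n + Q n)) (\<lambda>r. f r + g r) x =
      (\<integral>r. ((poly (P n) r - f r) + (poly (Q n) r - g r))\<^sup>2 \<partial>moment_measure x)"
      by (rule Bochner_Integration.integral_cong) (simp_all add: algebra_simps)
    also have "\<dots> \<le> 2 * L2_dist (poly (P n)) f x +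
        2 * L2_dist (poly (Q n)) g x"
      by (intro L2_triangle bounded_borel_01_intros approximable_bounded_borel f g)
    finally show "norm (L2_dist (poly (P n + Q n)) (\<lambda>r. f r + g r) x) \<le>
        2 * L2_dist (poly (P n)) f x +
        2 * L2_dist (poly (Q n)) g x"
      by (simp add: integral_nonneg_AE)
  next
    show "(\<lambda>n. 2 * L2_dist (poly (P n)) f x +
        2 * L2_dist (poly (Q n)) g x) \<longlonglongrightarrow> 0"
      using tendsto_add[OF tendsto_mult_left[OF P, of 2] tendsto_mult_left[OF Q, of 2]] by simp
  qed
  then have "(\<lambda>n. poly_op (P n + Q n) x) \<longlonglongrightarrow> fcalc (\<lambda>r. f r + g r) x"
    by (intro poly_op_tendsto_fcalc approximable_add f g)
  moreover have "(\<lambda>n. poly_op (P n + Q n) x) \<longlonglongrightarrow> fcalc f x + fcalc g x"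
    unfolding poly_op_add by (intro tendsto_add poly_op_tendsto_fcalc f g P Q)
  ultimately show ?thesis by (rule LIMSEQ_unique)
qed

lemma fcalc_scaleR:
  assumes "approximable g"
  shows "fcalc g (c *\<^sub>R x) = c *\<^sub>R fcalc g x"
  by (rule fcalc_commute[OF assms bounded_linear_scaleR_right]) (rule scaleR)

end

section \<open>Bounded operators on complex Hilbert spaces\<close>

lemma cinner_add_right: "cinner x (y + z) = cinner x y + cinner x z"
  by (metis cinner_add_left cinner_commute complex_cnj_add)

lemma cinner_scaleC_right: "cinner x (z *\<^sub>C y) = cnj z * cinner x y"
  by (metis cinner_commute cinner_scaleC_left complex_cnj_mult)

lemma inner_scaleC_left: "inner (z *\<^sub>C x) y = inner x (cnj z *\<^sub>C y)"
  by (simp add: inner_cinner cinner_scaleC_left cinner_scaleC_right)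

lemma scaleC_one [simp]: "1 *\<^sub>C x = x"
  using scaleR_scaleC[of 1 x] by simp

lemma Im_cinner: "Im (cinner x y) = - inner (\<i> *\<^sub>C x) y"
  by (simp add: inner_cinner cinner_scaleC_left)

text \<open>The case \<open>z = 1\<close> compares real parts and \<open>z = \<i>\<close> imaginary
  parts, so identities for the real inner product lift to \<open>cinner\<close>.\<close>

lemma cinner_eqI:
  assumes "\<And>z. inner (z *\<^sub>C x) y = inner (z *\<^sub>C x') y'"
  shows "cinner x y = cinner x' y'"
  using assms[of 1] assms[of \<i>] by (simp add: complex_eq_iff Im_cinner inner_cinner)

lemma inner_scaleC_scaleC: "inner (z *\<^sub>C x) (z *\<^sub>C x) = (cmod z)\<^sup>2 * inner x x"
proof -
  have "Im (cinner x x) = 0" using arg_cong[OF cinner_commute[of x x], of Im] by simp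
  then have "cinner x x = complex_of_real (inner x x)" by (simp add: complex_eq_iff inner_cinner)
  then have "cinner (z *\<^sub>C x) (z *\<^sub>C x) = (z * cnj z) * complex_of_real (inner x x)"
    by (simp add: cinner_scaleC_left cinner_scaleC_right)
  also have "\<dots> = complex_of_real ((cmod z)\<^sup>2 * inner x x)"
    by (simp only: of_real_mult complex_norm_square)
  finally show ?thesis by (simp add: inner_cinner)
qed

lemma norm_scaleC: "norm (z *\<^sub>C x) = cmod z * norm (x :: 'a::complex_hilbert)"
  by (simp add: norm_eq_sqrt_inner inner_scaleC_scaleC real_sqrt_mult)

lemma scaleC_scaleR_commute: "z *\<^sub>C (r *\<^sub>R x) = r *\<^sub>R (z *\<^sub>C x)"
  by (simp add: scaleR_scaleC scaleC_scaleC mult.commute)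

lemma bounded_linear_scaleC: "bounded_linear (\<lambda>x :: 'a::complex_hilbert. z *\<^sub>C x)"
  by (rule bounded_linear_intro[where K = "cmod z"])
     (auto simp: scaleC_add_right scaleC_scaleR_commute norm_scaleC mult.commute)

definition bounded_clinear :: "('a::complex_hilbert \<Rightarrow> 'a) \<Rightarrow> bool"
  where "bounded_clinear T \<longleftrightarrow> bounded_linear T \<and> (\<forall>z x. T (z *\<^sub>C x) = z *\<^sub>C T x)"

lemma bounded_clinear_on_UNIV: "bounded_clinear_on UNIV T \<longleftrightarrow> bounded_clinear T"
proof
  assume *: "bounded_clinear_on UNIV T"
  then obtain M where "\<forall>x. norm (T x) \<le> M * norm x" unfolding bounded_clinear_on_def by auto
  with * show "bounded_clinear T"
    unfolding bounded_clinear_def bounded_clinear_on_def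
    by (auto intro!: bounded_linear_intro[where K = M] simp: scaleR_scaleC mult.commute)
next
  assume *: "bounded_clinear T"
  then obtain M where "\<forall>x. norm (T x) \<le> norm x * M"
    using bounded_linear.bounded unfolding bounded_clinear_def by blast
  with * show "bounded_clinear_on UNIV T"
    unfolding bounded_clinear_def bounded_clinear_on_def
    by (auto simp: linear_simps mult.commute intro!: exI[of _ M])
qed

lemma bounded_clinear_on_subset:
  assumes "bounded_clinear T" "\<And>x. x \<in> K \<Longrightarrow> T x \<in> K"
  shows "bounded_clinear_on K T"
  using assms unfolding bounded_clinear_on_UNIV[symmetric] by (auto simp: bounded_clinear_on_def)

lemma cinner_sym_if_inner_sym:
  assumes "\<And>z x. T (z *\<^sub>C x) = z *\<^sub>C T x" "\<And>x y. inner (T x) y = inner x (T y)"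
  shows "cinner (T x) y = cinner x (T y)"
  by (rule cinner_eqI) (metis assms)

lemma positive_opD:
  assumes "positive_op T"
  shows positive_op_clinear: "bounded_clinear T"
    and positive_op_sym: "inner (T x) y = inner x (T y)"
    and positive_op_nonneg: "0 \<le> inner (T x) x"
proof -
  show T: "bounded_clinear T" using assms by (simp add: positive_op_on_def bounded_clinear_on_UNIV)
  have pos: "cinner (T x) x \<in> \<real>\<^sub>\<ge>\<^sub>0" for x using assms by (simp add: positive_op_on_def)
  then show "0 \<le> inner (T x) x" by (simp add: inner_cinner complex_nonneg_Reals_iff)
  have add: "T (x + y) = T x + T y" for x y using T by (simp add: bounded_clinear_def linear_simps)
  have C: "T (z *\<^sub>C x) = z *\<^sub>C T x" for z x using T by (simp add: bounded_clinear_def)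
  have Im: "Im (cinner (T x) x) = 0" for x using pos[of x] by (simp add: complex_nonneg_Reals_iff)
  have "Im (cinner (T u) v + cinner (T v) u) = 0" for u v
    using Im[of "u + v"] Im[of u] Im[of v] by (simp add: add cinner_add_left cinner_add_right)
  \<comment> \<open>Polarisation: replacing \<open>u\<close> by \<open>\<i> u\<close> turns the
    vanishing imaginary part of the form into symmetry of its real part. On a complex space
    positivity thus forces self-adjointness.\<close>
  from this[of "\<i> *\<^sub>C x" y] have "Re (cinner (T x) y) = Re (cinner (T y) x)"
    by (simp add: C cinner_scaleC_left cinner_scaleC_right)
  then show "inner (T x) y = inner x (T y)" by (simp add: inner_cinner[symmetric] inner_commute)
qed

lemma positive_opI:
  assumes T: "bounded_clinear T" and sym: "\<And>x y. inner (T x) y = inner x (T y)"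
    and pos: "\<And>x. 0 \<le> inner (T x) x"
  shows "positive_op T"
proof -
  have "cinner (T x) x \<in> \<real>\<^sub>\<ge>\<^sub>0" for x
  proof -
    have "cinner (T x) x = cinner x (T x)"
      using T by (intro cinner_sym_if_inner_sym sym) (simp add: bounded_clinear_def)
    then have "Im (cinner (T x) x) = 0"
      using arg_cong[OF cinner_commute[of "T x" x], of Im] by simp
    then show ?thesis using pos[of x] by (simp add: inner_cinner complex_nonneg_Reals_iff)
  qed
  then show ?thesis using T by (simp add: positive_op_on_def bounded_clinear_on_UNIV)
qed

lemma positive_op_add:
  assumes "positive_op A" "positive_op B"
  shows "positive_op (\<lambda>x. A x + B x)"
proof (rule positive_opI)
  show "bounded_clinear (\<lambda>x. A x + B x)"
    using positive_op_clinear[OF assms(1)] positive_op_clinear[OF assms(2)]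
    by (auto simp: bounded_clinear_def scaleC_add_right intro: bounded_linear_add)
qed (use positive_op_sym[OF assms(1)] positive_op_sym[OF assms(2)]
    positive_op_nonneg[OF assms(1)] positive_op_nonneg[OF assms(2)]
    in \<open>auto simp: inner_add_left inner_add_right\<close>)

section \<open>Quadratic forms and square roots\<close>

lemma symmetric_eqI:
  fixes T S :: "'a::real_inner \<Rightarrow> 'a"
  assumes T: "\<And>x y. T (x + y) = T x + T y" "\<And>x y. inner (T x) y = inner x (T y)"
    and S: "\<And>x y. S (x + y) = S x + S y" "\<And>x y. inner (S x) y = inner x (S y)"
    and eq: "\<And>x. inner (T x) x = inner (S x) x"
  shows "T x = S x"
proof -
  have "inner (T x) y = inner (S x) y" for y
    using eq[of "x + y"] eq[of x] eq[of y] T(2)[of y x] S(2)[of y x]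
    by (simp add: T(1) S(1) inner_add_left inner_add_right inner_commute)
  then have "inner (T x - S x) (T x - S x) = 0" by (simp add: inner_diff_left)
  then show ?thesis by simp
qed

text \<open>Division by a norm bound \<open>N\<close> gives a positive contraction \<open>R\<close>,
  and \<open>sqrt N\<close> times its \<open>fcalc sqrt\<close> is the root. That \<open>F\<close>
  squares to \<open>R\<close> is read off quadratic forms: both equal the integral of
  \<open>r\<close> against \<open>moment_measure x\<close>, and symmetric additive maps with equal
  forms coincide.\<close>

lemma positive_sqrt_exists:
  fixes P :: "'a::complex_hilbert \<Rightarrow> 'a"
  assumes P: "positive_op P"
  shows "\<exists>Q. positive_op Q \<and> (\<forall>x. Q (Q x) = P x)"
proof -
  note bl = positive_op_clinear[OF P, unfolded bounded_clinear_def, THEN conjunct1]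
  from bounded_linear.pos_bounded[OF bl] obtain N where N: "N > 0" "\<And>x. norm (P x) \<le> norm x * N" by blast
  define R where "R x = (1 / N) *\<^sub>R P x" for x
  interpret positive_contraction R
  proof (rule positive_contraction.intro)
    show "bounded_linear R" unfolding R_def
      by (rule bounded_linear_compose[OF bounded_linear_scaleR_right bl])
    show "inner (R x) y = inner x (R y)" for x y by (simp add: R_def positive_op_sym[OF P])
    show "0 \<le> inner (R x) x" for x using positive_op_nonneg[OF P] N by (simp add: R_def)
    show "inner (R x) x \<le> inner x x" for x
    proof -
      have "inner (P x) x \<le> norm (P x) * norm x" by (rule norm_cauchy_schwarz)
      also have "\<dots> \<le> (norm x * N) * norm x" by (intro mult_right_mono N) simp
      finally show ?thesis using N by (simp add: R_def field_simps power2_norm_eq_inner[symmetric] power2_eq_square)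
    qed
  qed
  have ap: "approximable sqrt" by (intro approximable_continuous continuous_intros) measurable
  define F where "F = fcalc sqrt"
  have RC: "R (z *\<^sub>C x) = z *\<^sub>C R x" for z x
    using positive_op_clinear[OF P] by (simp add: R_def bounded_clinear_def scaleC_scaleR_commute)
  have FC: "F (z *\<^sub>C x) = z *\<^sub>C F x" for z x
    unfolding F_def by (rule fcalc_commute[OF ap bounded_linear_scaleC RC])
  have Fadd: "F (x + y) = F x + F y" for x y unfolding F_def by (rule fcalc_add[OF ap])
  have Fsym: "inner (F x) y = inner x (F y)" for x y unfolding F_def by (rule fcalc_sym[OF ap])
  have FF: "F (F x) = R x" for x
  proof (rule symmetric_eqI[of "\<lambda>x. F (F x)" R])
    fix x
    have "inner (F (F x)) x = inner (F x) (F x)" by (rule Fsym)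
    also have "\<dots> = (\<integral>r. (sqrt r)\<^sup>2 \<partial>moment_measure x)"
      by (simp add: F_def inner_fcalc(2)[OF ap])
    also have "\<dots> = (\<integral>r. poly [:0, 1:] r \<partial>moment_measure x)"
    proof (intro antisym integral_mono_01[OF moment_measure_01] bounded_borel_01_intros
        approximable_bounded_borel ap)
    qed auto
    also have "\<dots> = inner (R x) x" by (simp only: moment_measure_poly) (simp add: zero)
    finally show "inner (F (F x)) x = inner (R x) x" .
  qed (simp_all add: Fadd Fsym add sym)
  define Q where "Q x = sqrt N *\<^sub>R F x" for x
  have FR: "F (c *\<^sub>R x) = c *\<^sub>R F x" for c x unfolding F_def by (rule fcalc_scaleR[OF ap])
  have "bounded_linear F"
    by (rule bounded_linear_intro[where K = 1])
       (use norm_fcalc_le[OF ap, of 1] in \<open>auto simp: Fadd FR F_def[symmetric] abs_le_iff\<close>)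
  then have "positive_op Q"
    unfolding Q_def
  proof (intro positive_opI)
    show "0 \<le> inner (sqrt N *\<^sub>R F x) x" for x
    proof -
      have "0 \<le> (\<integral>r. sqrt r \<partial>moment_measure x)"
        using integral_mono_01[OF moment_measure_01 bounded_borel_01_const[of 0] approximable_bounded_borel[OF ap]]
        by simp
      then show ?thesis using N by (simp add: F_def inner_fcalc(1)[OF ap])
    qed
  qed (auto simp: bounded_clinear_def Fsym FC scaleC_scaleR_commute
      intro: bounded_linear_compose[OF bounded_linear_scaleR_right])
  moreover have "Q (Q x) = P x" for x
    using N by (simp add: Q_def FR FF R_def)
  ultimately show ?thesis by blast
qed

text \<open>With a square root \<open>Q\<close> of \<open>A\<close> the form is
  \<open><Q x, Q y>\<close>, to which the ordinary inequality applies.\<close>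

lemma positive_op_cauchy_schwarz:
  assumes "positive_op A"
  shows "\<bar>inner (A x) y\<bar> \<le> sqrt (inner (A x) x) * sqrt (inner (A y) y)"
proof -
  from positive_sqrt_exists[OF assms] obtain Q where Q: "positive_op Q" "\<And>x. Q (Q x) = A x" by blast
  have "inner (A x) y = inner (Q x) (Q y)" for x y using positive_op_sym[OF Q(1)] Q(2) by metis
  then show ?thesis
    using Cauchy_Schwarz_ineq2[of "Q x" "Q y"] by (simp add: norm_eq_sqrt_inner)
qed

section \<open>Riesz representation, closed ranges and projections\<close>

lemma riesz_representation_range:
  fixes T :: "'a::real_inner \<Rightarrow> 'b::{real_inner,banach}"
  assumes T: "bounded_linear T" and \<psi>: "linear \<psi>"
    and le: "\<And>y. \<bar>\<psi> y\<bar> \<le> c * norm (T y)"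
  shows "\<exists>z\<in>closure (range T). \<forall>y. \<psi> y = inner (T y) z"
proof -
  \<comment> \<open>Dirichlet's principle: \<open>J\<close> is bounded below, and a minimiser would
    represent \<open>\<psi>\<close>. Convergence is sought for \<open>T y\<close> rather than for
    \<open>y\<close>, as \<open>T\<close> may have a kernel and a range that is not closed.\<close>
  define J where "J y = inner (T y) (T y) / 2 - \<psi> y" for y
  have \<psi>s: "\<psi> (x + y) = \<psi> x + \<psi> y" "\<psi> (r *\<^sub>R x) = r * \<psi> x" for x y r
    using \<psi> by (simp_all add: linear_add linear_scale)
  note Ts = linear_simps[OF T]
  have lb: "- c\<^sup>2 / 2 \<le> J y" for y
  proof -
    have "0 \<le> (norm (T y) - c)\<^sup>2" by simp
    then show ?thesis using le[of y]
      by (simp add: J_def power2_eq_square algebra_simps dot_square_norm)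
  qed
  define m where "m = Inf (range J)"
  have bdd: "bdd_below (range J)" using lb by (intro bdd_belowI[of _ "- c\<^sup>2 / 2"]) auto
  have m: "m \<le> J y" for y unfolding m_def by (rule cInf_lower[OF _ bdd]) simp
  have "\<exists>y. J y < m + 1 / real (Suc n)" for n
  proof -
    have "Inf (range J) < m + 1 / real (Suc n)" by (simp add: m_def)
    then show ?thesis by (subst (asm) cInf_less_iff[OF _ bdd]) auto
  qed
  then obtain Y where Y: "\<And>n. J (Y n) < m + 1 / real (Suc n)" by metis
  \<comment> \<open>The parallelogram law, with \<open>J\<close> at the midpoint still at least
    \<open>m\<close>.\<close>
  have par: "(norm (T x - T y))\<^sup>2 \<le> 4 * (J x - m) + 4 * (J y - m)" for x y
  proof -
    have "(norm (T x - T y))\<^sup>2 = 4 * J x + 4 * J y - 8 * J ((1 / 2) *\<^sub>R (x + y))"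
      by (simp add: J_def \<psi>s Ts power2_norm_eq_inner inner_add_left inner_add_right
          inner_diff_left inner_diff_right inner_commute field_simps)
    then show ?thesis using m[of "(1 / 2) *\<^sub>R (x + y)"] by simp
  qed
  have inv0: "(\<lambda>n. 1 / real (Suc n)) \<longlonglongrightarrow> 0" by (rule lim_inverse_n'[THEN LIMSEQ_Suc])
  have Jm: "(\<lambda>n. J (Y n)) \<longlonglongrightarrow> m"
  proof (rule LIM_zero_cancel, rule Lim_null_comparison[OF always_eventually inv0], rule allI)
    fix n
    show "norm (J (Y n) - m) \<le> 1 / real (Suc n)" using Y[of n] m[of "Y n"] by simp
  qed
  have "Cauchy (\<lambda>n. T (Y n))"
  proof (rule CauchyI)
    fix e :: real assume e: "e > 0"
    then have "e\<^sup>2 / 8 > 0" by simp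
    from LIMSEQ_D[OF Jm this] obtain n0 where n0: "\<And>n. n \<ge> n0 \<Longrightarrow> norm (J (Y n) - m) < e\<^sup>2 / 8" by blast
    have "norm (T (Y k) - T (Y n)) < e" if "k \<ge> n0" "n \<ge> n0" for k n
    proof -
      have "(norm (T (Y k) - T (Y n)))\<^sup>2 < e\<^sup>2"
        using par[of "Y k" "Y n"]
          order.strict_trans1[OF abs_ge_self n0[OF that(1), unfolded real_norm_def]]
          order.strict_trans1[OF abs_ge_self n0[OF that(2), unfolded real_norm_def]]
        by argo
      then show ?thesis using e by (simp add: power_less_imp_less_base)
    qed
    then show "\<exists>M. \<forall>k\<ge>M. \<forall>n\<ge>M. norm (T (Y k) - T (Y n)) < e" by blast
  qed
  then have "convergent (\<lambda>n. T (Y n))" by (rule Cauchy_convergent)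
  then obtain z where z: "(\<lambda>n. T (Y n)) \<longlonglongrightarrow> z" unfolding convergent_def by blast
  have "\<psi> y = inner (T y) z" for y
  proof -
    define b where "b = inner z (T y) - \<psi> y"
    define a where "a = inner (T y) (T y) / 2"
    have a: "a \<ge> 0" by (simp add: a_def)
    \<comment> \<open>First variation of the minimising sequence in the direction \<open>y\<close>,
      in the limit.\<close>
    have q: "0 \<le> e * b + e\<^sup>2 * a" for e
    proof -
      have "m \<le> J (Y n) + e * (inner (T (Y n)) (T y) - \<psi> y) + e\<^sup>2 * a" for n
        using m[of "Y n + e *\<^sub>R y"]
        by (simp add: J_def \<psi>s Ts a_def inner_add_left inner_add_right inner_commute
            power2_eq_square field_simps)
      moreover have "(\<lambda>n. J (Y n) + e * (inner (T (Y n)) (T y) - \<psi> y) + e\<^sup>2 * a) \<longlonglongrightarrow> m + e * b + e\<^sup>2 * a"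
        unfolding b_def by (intro tendsto_intros Jm z)
      ultimately have "m \<le> m + e * b + e\<^sup>2 * a" by (intro LIMSEQ_le_const) auto
      then show ?thesis by simp
    qed
    \<comment> \<open>The step \<open>e = - b / k\<close> leaves exactly \<open>- (b / k)^2\<close>;
      taking \<open>k = a + 1\<close> keeps the divisor positive when
      \<open>T y = 0\<close>.\<close>
    define k where "k = a + 1"
    have k: "k > 0" "a = k - 1" using a by (simp_all add: k_def)
    have "0 \<le> (- b / k) * b + (- b / k)\<^sup>2 * a" by (rule q)
    also have "\<dots> = - ((b / k)\<^sup>2)"
      using k(1) unfolding k(2) by (simp add: field_simps power2_eq_square)
    finally have "(b / k)\<^sup>2 \<le> 0" by linarith
    then have "b / k = 0" by (simp only: power2_less_eq_zero_iff)
    then have "b = 0" using k(1) by simp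
    then show ?thesis by (simp add: b_def inner_commute)
  qed
  moreover have "z \<in> closure (range T)" 
    unfolding closure_sequential using z by (intro exI[of _ "\<lambda>n. T (Y n)"]) simp
  ultimately show ?thesis by blast
qed

lemma inner_eq_on_closure:
  assumes "\<And>x. x \<in> S \<Longrightarrow> inner x u = inner x v" "w \<in> closure S"
  shows "inner w u = inner w v"
proof -
  from assms(2) obtain s where s: "\<And>n. s n \<in> S" "s \<longlonglongrightarrow> w" unfolding closure_sequential by blast
  have "(\<lambda>n. inner (s n) u) \<longlonglongrightarrow> inner w u" "(\<lambda>n. inner (s n) v) \<longlonglongrightarrow> inner w v"
    by (intro tendsto_intros s)+
  then show ?thesis using assms(1)[OF s(1)] LIMSEQ_unique by simp
qed

lemma subspace_closure_range:
  assumes "bounded_linear T"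
  shows "subspace (closure (range T))"
proof (rule subspaceI)
  note lin = linear_simps[OF assms]
  show "0 \<in> closure (range T)"
    using closure_subset[of "range T"] lin(3) by (metis rangeI subsetD)
  fix x y assume "x \<in> closure (range T)" "y \<in> closure (range T)"
  then obtain s t where s: "\<And>n. s n \<in> range T" "s \<longlonglongrightarrow> x" and t: "\<And>n. t n \<in> range T" "t \<longlonglongrightarrow> y"
    unfolding closure_sequential by metis
  have "s n + t n \<in> range T" for n
    using s(1)[of n] t(1)[of n] by (auto simp: lin(1)[symmetric])
  moreover have "(\<lambda>n. s n + t n) \<longlonglongrightarrow> x + y" by (intro tendsto_intros s t)
  ultimately show "x + y \<in> closure (range T)"
    unfolding closure_sequential by (intro exI[of _ "\<lambda>n. s n + t n"] conjI allI)
  fix c :: real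
  have "c *\<^sub>R s n \<in> range T" for n
    using s(1)[of n] by (auto simp: lin(5)[symmetric])
  moreover have "(\<lambda>n. c *\<^sub>R s n) \<longlonglongrightarrow> c *\<^sub>R x" by (intro tendsto_intros s)
  ultimately show "c *\<^sub>R x \<in> closure (range T)"
    unfolding closure_sequential by (intro exI[of _ "\<lambda>n. c *\<^sub>R s n"] conjI allI)
qed

text \<open>The difference lies in the closure of the range and is orthogonal to the range, hence to
  itself. This uniqueness makes the maps obtained from \<open>riesz_representation_range\<close>
  linear.\<close>

lemma closure_range_eqI:
  assumes T: "bounded_linear T" and "u \<in> closure (range T)" "v \<in> closure (range T)"
    and "\<And>x. inner (T x) u = inner (T x) v"
  shows "u = v"
proof -
  have "u - v \<in> closure (range T)"
    using assms subspace_closure_range[OF T] by (intro subspace_diff)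
  then have "inner (u - v) u = inner (u - v) v"
    by (rule inner_eq_on_closure[rotated]) (use assms(4) in auto)
  then have "inner (u - v) (u - v) = 0" by (simp add: inner_diff_right)
  then show ?thesis by simp
qed

lemma closure_range_scaleC:
  assumes T: "bounded_clinear T" and u: "u \<in> closure (range T)"
  shows "z *\<^sub>C u \<in> closure (range T)"
proof -
  from u obtain s where s: "\<And>n. s n \<in> range T" "s \<longlonglongrightarrow> u" unfolding closure_sequential by blast
  have "z *\<^sub>C s n \<in> range T" for n
    using s(1)[of n] T unfolding bounded_clinear_def by (metis rangeE rangeI)
  moreover have "(\<lambda>n. z *\<^sub>C s n) \<longlonglongrightarrow> z *\<^sub>C u"
    by (rule bounded_linear.tendsto[OF bounded_linear_scaleC s(2)])
  ultimately show ?thesis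
    unfolding closure_sequential by (intro exI[of _ "\<lambda>n. z *\<^sub>C s n"] conjI allI)
qed

text \<open>\<open>P u\<close> is the Riesz representative of \<open>y \<mapsto> <T y, u>\<close>
  inside the closure of the range, that is, the orthogonal projection of \<open>u\<close>.\<close>

lemma closure_range_projection:
  fixes T :: "'a::complex_hilbert \<Rightarrow> 'a"
  assumes T: "bounded_clinear T"
  shows "\<exists>P. bounded_clinear P \<and> (\<forall>u. P u \<in> closure (range T)) \<and>
    (\<forall>u\<in>closure (range T). P u = u) \<and>
    (\<forall>u. \<forall>w\<in>closure (range T). cinner w (P u) = cinner w u)"
proof -
  have bl: "bounded_linear T" using T by (simp add: bounded_clinear_def)
  note K = subspace_closure_range[OF bl]
  have "\<exists>k\<in>closure (range T). \<forall>y. inner (T y) u = inner (T y) k" for u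
  proof (rule riesz_representation_range[OF bl])
    show "linear (\<lambda>y. inner (T y) u)"
      by (intro linearI) (simp_all add: linear_simps[OF bl] inner_add_left)
    show "\<bar>inner (T y) u\<bar> \<le> norm u * norm (T y)" for y
      using Cauchy_Schwarz_ineq2[of "T y" u] by (simp add: mult.commute)
  qed
  then obtain P where P: "\<And>u. P u \<in> closure (range T)" "\<And>u y. inner (T y) u = inner (T y) (P u)" by metis
  have orth: "inner w (P u) = inner w u" if "w \<in> closure (range T)" for w u
    by (rule inner_eq_on_closure[OF _ that]) (use P(2) in auto)
  note eqI = closure_range_eqI[OF bl]
  have add: "P (u + v) = P u + P v" for u v
    by (rule eqI) (use P subspace_add[OF K] in \<open>auto simp: P(2)[symmetric] inner_add_right\<close>)
  have C: "P (z *\<^sub>C u) = z *\<^sub>C P u" for z u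
  proof (rule eqI)
    fix x
    have "inner (T x) (z *\<^sub>C P u) = inner (T (cnj z *\<^sub>C x)) (P u)"
      using T by (simp add: inner_scaleC_left bounded_clinear_def)
    also have "\<dots> = inner (T (cnj z *\<^sub>C x)) u" by (rule P(2)[symmetric])
    also have "\<dots> = inner (T x) (z *\<^sub>C u)"
      using T by (simp add: inner_scaleC_left bounded_clinear_def)
    finally show "inner (T x) (P (z *\<^sub>C u)) = inner (T x) (z *\<^sub>C P u)" by (simp add: P(2)[symmetric])
  qed (use P closure_range_scaleC[OF T] in auto)
  have N: "norm (P u) \<le> norm u" for u
  proof (cases "P u = 0")
    case False
    have "norm (P u) * norm (P u) = inner (P u) u"
      using orth[OF P(1), of u u] by (simp add: dot_square_norm power2_eq_square)
    also have "\<dots> \<le> norm (P u) * norm u" by (rule norm_cauchy_schwarz)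
    finally show ?thesis using False by simp
  qed simp
  have "bounded_clinear P"
    unfolding bounded_clinear_def
    by (intro conjI allI C bounded_linear_intro[where K = 1])
       (auto simp: add C scaleR_scaleC N)
  moreover have "P u = u" if "u \<in> closure (range T)" for u
    by (rule eqI) (use P that in auto)
  moreover have "cinner w (P u) = cinner w u" if "w \<in> closure (range T)" for w u
    by (rule cinner_eqI) (rule orth[OF closure_range_scaleC[OF T that]])
  ultimately show ?thesis using P(1) by blast
qed

section \<open>Factorisation of a dominated positive operator\<close>

lemma norm_le_if_inner_le_on_closure:
  assumes "w \<in> closure (range T)" "\<And>x. inner (T x) w \<le> c * norm (T x)" "c \<ge> 0"
  shows "norm w \<le> c"
proof -
  obtain s where s: "\<And>n. s n \<in> range T" "s \<longlonglongrightarrow> w"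
    using assms(1) unfolding closure_sequential by metis
  have "(\<lambda>n. inner (s n) w) \<longlonglongrightarrow> inner w w" "(\<lambda>n. c * norm (s n)) \<longlonglongrightarrow> c * norm w"
    by (intro tendsto_intros s)+
  moreover have "inner (s n) w \<le> c * norm (s n)" for n using s(1)[of n] assms(2) by auto
  ultimately have "inner w w \<le> c * norm w" by (intro LIMSEQ_le) auto
  then show ?thesis using assms(3)
    by (cases "w = 0") (auto simp: dot_square_norm power2_eq_square)
qed

text \<open>A factorisation of Douglas type by two Riesz steps. As \<open>A \<le> T^2\<close>, the
  form \<open><A y, x>\<close> is bounded by \<open>|T x| |T y|\<close>, which gives
  \<open>W\<close> with \<open>A = T W\<close>. As \<open>|W x| \<le> |T x|\<close>, a second step
  gives \<open>R\<close> such that \<open>T R\<close> is the adjoint of \<open>W\<close>. Hence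
  \<open>T R T = A\<close>.\<close>

lemma positive_contraction_factor:
  fixes A T :: "'a::complex_hilbert \<Rightarrow> 'a"
  assumes A: "positive_op A" and T: "positive_op T"
    and le: "\<And>x. inner (A x) x \<le> inner (T x) (T x)"
  shows "\<exists>R. positive_op R \<and> (\<forall>u. norm (R u) \<le> norm u) \<and>
    (\<forall>u. R u \<in> closure (range T)) \<and> (\<forall>x. T (R (T x)) = A x)"
proof -
  let ?K = "closure (range T)"
  note TC = positive_op_clinear[OF T] and AC = positive_op_clinear[OF A]
  have bT: "bounded_linear T" using TC by (simp add: bounded_clinear_def)
  have bA: "bounded_linear A" using AC by (simp add: bounded_clinear_def)
  have scT: "T (z *\<^sub>C x) = z *\<^sub>C T x" and scA: "A (z *\<^sub>C x) = z *\<^sub>C A x" for z x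
    using TC AC by (simp_all add: bounded_clinear_def)
  note K = subspace_closure_range[OF bT] and KC = closure_range_scaleC[OF TC]
  note eqI = closure_range_eqI[OF bT]
  have cs: "\<bar>inner (A y) x\<bar> \<le> norm (T x) * norm (T y)" for x y
  proof -
    have "\<bar>inner (A y) x\<bar> \<le> sqrt (inner (A y) y) * sqrt (inner (A x) x)"
      by (rule positive_op_cauchy_schwarz[OF A])
    also have "\<dots> \<le> sqrt (inner (T y) (T y)) * sqrt (inner (T x) (T x))"
      using positive_op_nonneg[OF A] le by (intro mult_mono real_sqrt_le_mono) auto
    finally show ?thesis by (simp add: norm_eq_sqrt_inner mult.commute)
  qed
  have "\<exists>w\<in>?K. \<forall>y. inner (A y) x = inner (T y) w" for x
    by (rule riesz_representation_range[OF bT _ cs])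
       (intro linearI, simp_all add: linear_simps[OF bA] inner_add_left)
  then obtain W where W: "\<And>x. W x \<in> ?K" "\<And>x y. inner (A y) x = inner (T y) (W x)" by metis
  have Wadd: "W (x + x') = W x + W x'" for x x'
    by (rule eqI) (use W subspace_add[OF K] in \<open>auto simp: W(2)[symmetric] inner_add_right\<close>)
  have WC: "W (z *\<^sub>C x) = z *\<^sub>C W x" for z x
  proof (rule eqI)
    fix y
    show "inner (T y) (W (z *\<^sub>C x)) = inner (T y) (z *\<^sub>C W x)"
      using W(2)[where y = y and x = "z *\<^sub>C x"] W(2)[where y = "cnj z *\<^sub>C y" and x = x]
      by (simp add: scA scT inner_scaleC_left)
  qed (use W KC in auto)
  have WR: "W (r *\<^sub>R x) = r *\<^sub>R W x" for r x by (simp only: scaleR_scaleC WC)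
  have WN: "norm (W x) \<le> norm (T x)" for x
    by (rule norm_le_if_inner_le_on_closure[OF W(1)])
       (use cs in \<open>auto simp: W(2)[symmetric] intro: order_trans[OF abs_ge_self]\<close>)
  have "\<exists>k\<in>?K. \<forall>x. inner (W x) u = inner (T x) k" for u
  proof (rule riesz_representation_range[OF bT])
    show "linear (\<lambda>x. inner (W x) u)"
      by (intro linearI) (simp_all add: Wadd WR inner_add_left)
    show "\<bar>inner (W x) u\<bar> \<le> norm u * norm (T x)" for x
    proof -
      have "\<bar>inner (W x) u\<bar> \<le> norm (W x) * norm u" by (rule Cauchy_Schwarz_ineq2)
      also have "\<dots> \<le> norm (T x) * norm u" by (intro mult_right_mono WN) simp
      finally show ?thesis by (simp add: mult.commute)
    qed
  qed
  then obtain R where R: "\<And>u. R u \<in> ?K" "\<And>u x. inner (W x) u = inner (T x) (R u)" by metis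
  have Radd: "R (u + v) = R u + R v" for u v
    by (rule eqI) (use R subspace_add[OF K] in \<open>auto simp: R(2)[symmetric] inner_add_right\<close>)
  have RC: "R (z *\<^sub>C u) = z *\<^sub>C R u" for z u
  proof (rule eqI)
    fix x
    show "inner (T x) (R (z *\<^sub>C u)) = inner (T x) (z *\<^sub>C R u)"
      using R(2)[where x = x and u = "z *\<^sub>C u"] R(2)[where x = "cnj z *\<^sub>C x" and u = u]
      by (simp add: WC scT inner_scaleC_left)
  qed (use R KC in auto)
  have RN: "norm (R u) \<le> norm u" for u
  proof (rule norm_le_if_inner_le_on_closure[OF R(1)])
    fix x
    have "inner (W x) u \<le> norm (W x) * norm u" by (rule norm_cauchy_schwarz)
    also have "\<dots> \<le> norm (T x) * norm u" by (intro mult_right_mono WN) simp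
    finally show "inner (T x) (R u) \<le> norm u * norm (T x)" by (simp add: R(2)[symmetric] mult.commute)
  qed simp
  have bR: "bounded_linear R"
    by (rule bounded_linear_intro[where K = 1]) (auto simp: Radd RC RN scaleR_scaleC)
  have TRT: "inner (R (T x)) (T y) = inner (A x) y" for x y
    using R(2)[where x = y and u = "T x"] W(2)[where y = x and x = y] by (simp add: inner_commute)
  obtain P where P: "\<And>u. P u \<in> ?K" "\<And>w u. w \<in> ?K \<Longrightarrow> cinner w (P u) = cinner w u"
    using closure_range_projection[OF TC] by blast
  have Pin: "inner w (P u) = inner w u" if "w \<in> ?K" for w u
    using P(2)[OF that] by (simp add: inner_cinner)
  have RP: "R (P u) = R u" for u
    by (rule eqI) (use R Pin W in \<open>auto simp: R(2)[symmetric]\<close>)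
  \<comment> \<open>\<open>R\<close> sees only the projection \<open>P\<close>, and every
    \<open>P w\<close> is a limit of vectors \<open>T (s n)\<close>; so the form of \<open>R\<close>
    is a limit of values of the form of \<open>A\<close>. The clause for \<open>u = v\<close> lets
    one statement serve both symmetry and positivity.\<close>
  have lim: "\<exists>s t. (\<lambda>n::nat. inner (A (s n)) (t n)) \<longlonglongrightarrow> inner (R u) v \<and>
      (\<lambda>n. inner (A (t n)) (s n)) \<longlonglongrightarrow> inner (R v) u \<and> (u = v \<longrightarrow> s = t)" for u v
  proof -
    have "\<exists>s. (\<lambda>n::nat. T (s n)) \<longlonglongrightarrow> P w" for w
    proof -
      obtain s where s: "\<And>n. s n \<in> range T" "s \<longlonglongrightarrow> P w"
        using P(1)[of w] unfolding closure_sequential by metis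
      then have "\<forall>n. \<exists>y. s n = T y" by auto
      then obtain y where "\<And>n. s n = T (y n)" by metis
      then have "s = (\<lambda>n. T (y n))" by (simp add: fun_eq_iff)
      with s(2) show ?thesis by blast
    qed
    then obtain s where s: "\<And>w. (\<lambda>n::nat. T (s w n)) \<longlonglongrightarrow> P w" by metis
    have "(\<lambda>n. inner (R (T (s w n))) (T (s w' n))) \<longlonglongrightarrow> inner (R (P w)) (P w')" for w w'
      by (intro tendsto_intros bounded_linear.tendsto[OF bR] s)
    then have "(\<lambda>n. inner (A (s w n)) (s w' n)) \<longlonglongrightarrow> inner (R w) w'" for w w'
      unfolding TRT RP Pin[OF R(1)] .
    then show ?thesis by (intro exI[of _ "s u"] exI[of _ "s v"]) auto
  qed
  have "positive_op R"
  proof (rule positive_opI)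
    show "bounded_clinear R" using bR RC by (simp add: bounded_clinear_def)
    fix u v
    obtain s t where st: "(\<lambda>n::nat. inner (A (s n)) (t n)) \<longlonglongrightarrow> inner (R u) v"
      "(\<lambda>n. inner (A (t n)) (s n)) \<longlonglongrightarrow> inner (R v) u" using lim by blast
    have "inner (A (s n)) (t n) = inner (A (t n)) (s n)" for n
      using positive_op_sym[OF A] by (simp add: inner_commute)
    then show "inner (R u) v = inner u (R v)" using st LIMSEQ_unique by (simp add: inner_commute)
  next
    fix u
    obtain s where s: "(\<lambda>n::nat. inner (A (s n)) (s n)) \<longlonglongrightarrow> inner (R u) u" using lim[of u u] by blast
    show "0 \<le> inner (R u) u" by (rule LIMSEQ_le_const[OF s]) (use positive_op_nonneg[OF A] in auto)
  qed
  moreover have "T (R (T x)) = A x" for x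
  proof -
    have "inner (T (R (T x))) y = inner (A x) y" for y using positive_op_sym[OF T] TRT by simp
    then have "inner (T (R (T x)) - A x) (T (R (T x)) - A x) = 0" by (simp add: inner_diff_left)
    then show ?thesis by simp
  qed
  ultimately show ?thesis using R(1) RN by blast
qed

lemma hadjoint_positive_op:
  assumes T: "positive_op T"
  shows "hadjoint T y = T y"
  unfolding hadjoint_def
proof (rule the_equality)
  have c: "cinner (T x) y = cinner x (T y)" for x
    using positive_op_clinear[OF T] by (intro cinner_sym_if_inner_sym positive_op_sym[OF T])
      (simp add: bounded_clinear_def)
  show "\<forall>x. cinner (T x) y = cinner x (T y)" using c by blast
  fix z assume "\<forall>x. cinner (T x) y = cinner x z"
  then have "inner x (T y) = inner x z" for x using c by (metis inner_cinner)
  then have "inner (z - T y) (z - T y) = 0" by (simp add: inner_diff_right)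
  then show "z = T y" by simp
qed

section \<open>The contraction attached to a pair of positive operators\<close>

locale positive_op_pair =
  fixes A B :: "'a::complex_hilbert \<Rightarrow> 'a"
  assumes A: "positive_op A" and B: "positive_op B"
begin

abbreviation "T \<equiv> T_AB A B"
abbreviation "K \<equiv> H_AB A B"

lemma T_positive: "positive_op T" and T_T: "T (T x) = A x + B x"
proof -
  have "\<exists>Q. positive_op Q \<and> (\<forall>x. Q (Q x) = A x + B x)"
    by (rule positive_sqrt_exists[OF positive_op_add[OF A B]])
  from someI_ex[OF this] show "positive_op T" "T (T x) = A x + B x"
    unfolding T_AB_def op_sqrt_def by auto
qed

lemmas T_clinear = positive_op_clinear[OF T_positive]

lemma T_linear: "bounded_linear T"
  using T_clinear by (simp add: bounded_clinear_def)

text \<open>\<open>T u = T (P u)\<close> because the symmetric \<open>T\<close> kills the complement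
  of its range, and \<open>P u\<close> is a limit of vectors \<open>T x\<close>. Hence
  \<open>T u\<close> is a limit of vectors \<open>T (T x) = A x + B x\<close>.\<close>

lemma K_eq: "K = closure (range T)"
proof
  show "K \<subseteq> closure (range T)"
    unfolding H_AB_def T_T[symmetric] by (intro closure_mono) auto
  obtain P where P: "\<And>u. P u \<in> closure (range T)"
    "\<And>w u. w \<in> closure (range T) \<Longrightarrow> cinner w (P u) = cinner w u"
    using closure_range_projection[OF T_clinear] by blast
  have "T u \<in> K" for u
  proof -
    have "inner (T y) (P u) = inner (T y) u" for y
    proof -
      have "T y \<in> closure (range T)" using closure_subset by (rule subsetD) simp
      from P(2)[OF this, of u] show ?thesis by (simp add: inner_cinner)
    qed
    then have "inner y (T (P u) - T u) = 0" for y
      using positive_op_sym[OF T_positive] by (simp add: inner_diff_right)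
    from this[of "T (P u) - T u"] have TP: "T (P u) = T u" by simp
    obtain s where s: "\<And>n. s n \<in> range T" "s \<longlonglongrightarrow> P u"
      using P(1)[of u] unfolding closure_sequential by metis
    have "T (s n) \<in> range (\<lambda>x. A x + B x)" for n
      using s(1)[of n] by (auto simp: T_T)
    moreover have "(\<lambda>n. T (s n)) \<longlonglongrightarrow> T u"
      using bounded_linear.tendsto[OF T_linear s(2)] by (simp add: TP)
    ultimately show ?thesis
      unfolding H_AB_def closure_sequential by (intro exI[of _ "\<lambda>n. T (s n)"] conjI allI)
  qed
  then show "closure (range T) \<subseteq> K"
    by (intro closure_minimal) (auto simp: H_AB_def)
qed

lemma T_in_K: "T x \<in> K"
  unfolding K_eq using closure_subset by (rule subsetD) simp

lemma K_subspace: "subspace K"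
  unfolding K_eq by (rule subspace_closure_range[OF T_linear])

abbreviation "R \<equiv> R_AB A B"

lemma R_contraction: "positive_contraction_on K R"
  and R_le: "x \<in> K \<Longrightarrow> inner (R x) x \<le> inner x x"
  and A_eq: "A x = T (R (T x))"
  and B_eq: "B x = T (T x - R (T x))"
proof -
  have "inner (A x) x \<le> inner (T x) (T x)" for x
    using positive_op_nonneg[OF B, of x] positive_op_sym[OF T_positive, of "T x" x]
    by (simp add: T_T inner_add_left)
  from positive_contraction_factor[OF A T_positive this] obtain R\<^sub>0 where R0: "positive_op R\<^sub>0"
    "\<And>u. norm (R\<^sub>0 u) \<le> norm u" "\<And>u. R\<^sub>0 u \<in> K" "\<And>x. T (R\<^sub>0 (T x)) = A x"
    unfolding K_eq by blast
  define S\<^sub>0 where "S\<^sub>0 x = x - R\<^sub>0 x" for x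
  have le: "inner (R\<^sub>0 x) x \<le> inner x x" for x
    using norm_cauchy_schwarz[of "R\<^sub>0 x" x] mult_right_mono[OF R0(2)[of x], of "norm x"]
    by (simp add: dot_square_norm power2_eq_square)
  have S0: "positive_op S\<^sub>0"
  proof (rule positive_opI)
    show "bounded_clinear S\<^sub>0"
      using positive_op_clinear[OF R0(1)]
      unfolding bounded_clinear_def S\<^sub>0_def[abs_def]
      by (auto simp: linear_simps(2)[OF bounded_linear_scaleC]
          intro: bounded_linear_sub[OF bounded_linear_ident])
    show "inner (S\<^sub>0 x) y = inner x (S\<^sub>0 y)" for x y
      using positive_op_sym[OF R0(1)] by (simp add: S\<^sub>0_def inner_diff_left inner_diff_right)
    show "0 \<le> inner (S\<^sub>0 x) x" for x using le by (simp add: S\<^sub>0_def inner_diff_left)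
  qed
  have S0le: "inner (S\<^sub>0 x) x \<le> inner x x" for x
    using positive_op_nonneg[OF R0(1), of x] by (simp add: S\<^sub>0_def inner_diff_left)
  \<comment> \<open>The form bound \<open>S\<^sub>0 \<le> I\<close> gives a norm bound through the
    Cauchy-Schwarz inequality for the form of \<open>S\<^sub>0\<close> at \<open>x\<close> and
    \<open>S\<^sub>0 x\<close>.\<close>
  have S0N: "norm (S\<^sub>0 x) \<le> norm x" for x
  proof -
    have "\<bar>inner (S\<^sub>0 x) (S\<^sub>0 x)\<bar> \<le> sqrt (inner (S\<^sub>0 x) x) * sqrt (inner (S\<^sub>0 (S\<^sub>0 x)) (S\<^sub>0 x))"
      by (rule positive_op_cauchy_schwarz[OF S0])
    also have "\<dots> \<le> sqrt (inner x x) * sqrt (inner (S\<^sub>0 x) (S\<^sub>0 x))"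
      using positive_op_nonneg[OF S0]
      by (intro mult_mono real_sqrt_le_mono S0le) auto
    finally have "norm (S\<^sub>0 x) * norm (S\<^sub>0 x) \<le> norm x * norm (S\<^sub>0 x)"
      by (simp add: norm_eq_sqrt_inner)
    then show ?thesis by (cases "S\<^sub>0 x = 0") auto
  qed
  have on_K: "positive_contraction_on K Q"
    if "positive_op Q" "\<And>x. norm (Q x) \<le> norm x" "\<And>x. x \<in> K \<Longrightarrow> Q x \<in> K" for Q
    using that bounded_clinear_on_subset[OF positive_op_clinear[OF that(1)] that(3)]
    by (auto simp: positive_contraction_on_def positive_op_on_def)
  have TS: "T (S\<^sub>0 (T x)) = B x" for x
    unfolding S\<^sub>0_def linear_simps(2)[OF T_linear] by (simp add: R0(4) T_T)
  \<comment> \<open>\<open>R\<^sub>0\<close> and \<open>S\<^sub>0\<close> only witness existence;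
    \<open>R\<close> is whatever the choice in \<open>R_AB\<close> returns, and its properties are
    read off the specification.\<close>
  have "\<exists>R S. positive_contraction_on K R \<and> positive_contraction_on K S \<and>
    (\<forall>x\<in>K. R x + S x = x) \<and> (\<forall>x. A x = hadjoint T (R (T x))) \<and> (\<forall>x. B x = hadjoint T (S (T x)))"
  proof (rule exI[of _ "R\<^sub>0"], rule exI[of _ "S\<^sub>0"], intro conjI allI ballI)
    show "positive_contraction_on K R\<^sub>0" by (rule on_K[OF R0(1,2,3)])
    show "positive_contraction_on K S\<^sub>0"
      by (rule on_K[OF S0 S0N]) (use R0(3) subspace_diff[OF K_subspace] in \<open>auto simp: S\<^sub>0_def\<close>)
  qed (simp_all add: S\<^sub>0_def hadjoint_positive_op[OF T_positive] R0(4) TS[unfolded S\<^sub>0_def])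
  from someI_ex[OF this] obtain S where S: "positive_contraction_on K R" "positive_contraction_on K S"
    "\<And>x. x \<in> K \<Longrightarrow> R x + S x = x" "\<And>x. A x = hadjoint T (R (T x))" "\<And>x. B x = hadjoint T (S (T x))"
    unfolding R_AB_def[symmetric] by blast
  show "positive_contraction_on K R" by (rule S(1))
  show "A x = T (R (T x))" using S(4) by (simp add: hadjoint_positive_op[OF T_positive])
  have Seq: "S x = x - R x" if "x \<in> K" for x using S(3)[OF that] by (simp add: algebra_simps)
  show "B x = T (T x - R (T x))"
    using S(5) Seq[OF T_in_K] by (simp add: hadjoint_positive_op[OF T_positive])
  assume x: "x \<in> K"
  have "0 \<le> inner (S x) x"
    using S(2) x by (auto simp: positive_contraction_on_def positive_op_on_def inner_cinner complex_nonneg_Reals_iff)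
  then show "inner (R x) x \<le> inner x x" by (simp add: Seq[OF x] inner_diff_left)
qed

end

section \<open>Existence of the spectral measure\<close>

lemma (in positive_contraction) fcalc_poly: "fcalc (poly p) x = poly_op p x"
  using fcalc_bound[OF approximable_poly, of p x p] by simp

lemma (in positive_contraction) moment_measure_eq:
  assumes "M \<in> sets borel"
  shows "emeasure (moment_measure x) M = ennreal (inner (fcalc (indicator M) x) x)"
proof -
  have fm: "finite_measure (moment_measure x)" and s: "sets (moment_measure x) = sets borel"
    using moment_measure_01[of x] by (auto simp: finite_measure_01_def)
  have "inner (fcalc (indicator M) x) x = (\<integral>r. indicator M r \<partial>moment_measure x)"
    by (rule inner_fcalc(1)[OF approximable_indicator[OF assms]])
  also have "\<dots> = measure (moment_measure x) M" using assms s by simp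
  finally show ?thesis using finite_measure.emeasure_eq_measure[OF fm] by simp
qed

text \<open>\<open>R\<close> is meaningful on \<open>K\<close> only, so the calculus is run for its
  composition \<open>R'\<close> with the projection onto \<open>K\<close>, and \<open>E M\<close> is
  the value at the indicator of \<open>M\<close>. Idempotence follows from quadratic forms, as an
  indicator equals its square; countable additivity follows from continuity of
  \<open>moment_measure x\<close> from below.\<close>

lemma spectral_measure_exists:
  fixes T R :: "'a::complex_hilbert \<Rightarrow> 'a"
  assumes T: "bounded_clinear T" and K: "K = closure (range T)"
    and R: "positive_contraction_on K R"
  shows "\<exists>E. spectral_measure_on K R E"
proof -
  obtain P where P: "bounded_clinear P" "\<And>u. P u \<in> K" "\<And>u. u \<in> K \<Longrightarrow> P u = u"
    "\<And>w u. w \<in> K \<Longrightarrow> cinner w (P u) = cinner w u"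
    using closure_range_projection[OF T] unfolding K by blast
  have Ks: "subspace K" "closed K"
    unfolding K using T subspace_closure_range[of T]
    by (auto simp: bounded_clinear_def)
  have Rb: "\<And>x. x \<in> K \<Longrightarrow> R x \<in> K" "\<And>x y. x \<in> K \<Longrightarrow> y \<in> K \<Longrightarrow> R (x + y) = R x + R y"
    "\<And>z x. x \<in> K \<Longrightarrow> R (z *\<^sub>C x) = z *\<^sub>C R x" "\<And>x. x \<in> K \<Longrightarrow> norm (R x) \<le> norm x"
    "\<And>x. x \<in> K \<Longrightarrow> cinner (R x) x \<in> \<real>\<^sub>\<ge>\<^sub>0"
    using R by (auto simp: positive_contraction_on_def positive_op_on_def bounded_clinear_on_def)
  have PN: "norm (P u) \<le> norm u" for u
  proof -
    have "inner (P u) (P u) = inner (P u) u" using P(4)[OF P(2), of u u] by (simp add: inner_cinner)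
    then have "norm (P u) * norm (P u) \<le> norm (P u) * norm u"
      using norm_cauchy_schwarz[of "P u" u] by (simp add: dot_square_norm power2_eq_square)
    then show ?thesis by (cases "P u = 0") auto
  qed
  define R' where "R' u = R (P u)" for u
  have N': "norm (R' u) \<le> norm u" for u using Rb(4)[OF P(2)] PN order_trans unfolding R'_def by blast
  have bP: "bounded_linear P" and PC: "\<And>z u. P (z *\<^sub>C u) = z *\<^sub>C P u"
    using P(1) by (auto simp: bounded_clinear_def)
  have C': "R' (z *\<^sub>C u) = z *\<^sub>C R' u" for z u by (simp add: R'_def PC Rb(3) P(2))
  have "bounded_clinear R'"
    unfolding bounded_clinear_def
    by (intro conjI allI C' bounded_linear_intro[where K = 1])
       (simp_all add: R'_def linear_simps(1)[OF bP] Rb(2) P(2) scaleR_scaleC PC Rb(3) N'[unfolded R'_def])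
  moreover have "cinner (R' u) u \<in> \<real>\<^sub>\<ge>\<^sub>0" for u
    using Rb(5)[OF P(2)[of u]] P(4)[OF Rb(1)[OF P(2)], of u u] by (simp add: R'_def)
  ultimately have pos': "positive_op R'" by (simp add: positive_op_on_def bounded_clinear_on_UNIV)
  interpret positive_contraction R'
  proof (rule positive_contraction.intro)
    show "bounded_linear R'" using positive_op_clinear[OF pos'] by (simp add: bounded_clinear_def)
    show "inner (R' x) x \<le> inner x x" for x
      using norm_cauchy_schwarz[of "R' x" x] mult_right_mono[OF N'[of x], of "norm x"]
      by (simp add: dot_square_norm power2_eq_square)
  qed (use positive_op_sym[OF pos'] positive_op_nonneg[OF pos'] in auto)
  define E where "E M = fcalc (indicator M)" for M
  note ap = approximable_indicator
  have inK: "E M x \<in> K" if "M \<in> sets borel" "x \<in> K" for M x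
    unfolding E_def by (rule fcalc_in_subspace[OF ap[OF that(1)] Ks _ that(2)]) (simp add: R'_def Rb(1) P(2))
  have Eadd: "E M (x + y) = E M x + E M y" if "M \<in> sets borel" for M x y
    unfolding E_def by (rule fcalc_add[OF ap[OF that]])
  have EC: "E M (z *\<^sub>C x) = z *\<^sub>C E M x" if "M \<in> sets borel" for M z x
    unfolding E_def by (rule fcalc_commute[OF ap[OF that] bounded_linear_scaleC C'])
  have Esym: "inner (E M x) y = inner x (E M y)" if "M \<in> sets borel" for M x y
    unfolding E_def by (rule fcalc_sym[OF ap[OF that]])
  have EE: "E M (E M x) = E M x" if "M \<in> sets borel" for M x
  proof (rule symmetric_eqI[of "\<lambda>x. E M (E M x)"])
    fix x
    have "inner (E M (E M x)) x = inner (E M x) (E M x)" by (rule Esym[OF that])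
    also have "\<dots> = (\<integral>r. (indicator M r)\<^sup>2 \<partial>moment_measure x)"
      unfolding E_def by (rule inner_fcalc(2)[OF ap[OF that]])
    also have "\<dots> = (\<integral>r. indicator M r \<partial>moment_measure x)"
      by (rule Bochner_Integration.integral_cong) (auto simp: indicator_def)
    also have "\<dots> = inner (E M x) x"
      unfolding E_def by (rule inner_fcalc(1)[OF ap[OF that], symmetric])
    finally show "inner (E M (E M x)) x = inner (E M x) x" .
  qed (simp_all only: Eadd[OF that] Esym[OF that])
  have proj: "projection_on K (E M)" if M: "M \<in> sets borel" for M
    unfolding projection_on_def bounded_clinear_on_def
  proof (intro conjI ballI allI exI[of _ 1])
    show "norm (E M x) \<le> 1 * norm x" for x
      unfolding E_def by (rule norm_fcalc_le[OF ap[OF M]]) (auto simp: indicator_def)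
    show "cinner (E M x) y = cinner x (E M y)" for x y
      by (rule cinner_sym_if_inner_sym) (simp_all add: EC[OF M] Esym[OF M])
  qed (simp_all add: inK[OF M] Eadd[OF M] EC[OF M] EE[OF M])
  have one: "E UNIV x = x" for x
  proof -
    have "indicator UNIV = (poly 1 :: real \<Rightarrow> real)" by (auto simp: indicator_def)
    then show ?thesis unfolding E_def by (simp only: fcalc_poly poly_op_1)
  qed
  have Eun: "E (M \<union> N) x = E M x + E N x" if "M \<in> sets borel" "N \<in> sets borel" "M \<inter> N = {}" for M N x
  proof -
    have "indicator (M \<union> N) = (\<lambda>r. indicator M r + indicator N r :: real)"
      using that(3) by (auto simp: fun_eq_iff indicator_def)
    then show ?thesis unfolding E_def by (simp only: fcalc_add_fun[OF ap[OF that(1)] ap[OF that(2)]])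
  qed
  have E0: "E {} x = 0" for x using Eun[of "{}" "{}" x] by simp
  have sums: "(\<lambda>i. E (M i) x) sums E (\<Union>i. M i) x"
    if M: "range M \<subseteq> sets borel" and d: "disjoint_family M" for M :: "nat \<Rightarrow> real set" and x
  proof -
    have Mi[measurable]: "M i \<in> sets borel" for i using M by auto
    have part: "(\<Sum>i<n. E (M i) x) = E (\<Union>i<n. M i) x" for n
    proof (induction n)
      case 0 show ?case by (simp add: E0)
    next
      case (Suc n)
      have "M i \<inter> M n = {}" if "i < n" for i
        using disjoint_family_onD[OF d, of i n] that by simp
      then have "(\<Union>i<n. M i) \<inter> M n = {}" by blast
      then have "E ((\<Union>i<n. M i) \<union> M n) x = E (\<Union>i<n. M i) x + E (M n) x" by (intro Eun) auto
      then show ?case using Suc by (simp add: lessThan_Suc Un_commute)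
    qed
    interpret mm: finite_measure "moment_measure x"
      using moment_measure_01[of x] by (simp add: finite_measure_01_def)
    have sb: "sets (moment_measure x) = sets borel"
      using moment_measure_01[of x] by (simp add: finite_measure_01_def)
    define L where "L n = (\<Union>i<n. M i)" for n
    have Lb: "L n \<in> sets borel" for n unfolding L_def by measurable
    have Ub: "(\<Union>i. M i) \<in> sets borel" by measurable
    have LU: "(\<Union>n. L n) = (\<Union>i. M i)" unfolding L_def by auto
    have "(\<lambda>n. measure (moment_measure x) (L n)) \<longlonglongrightarrow> measure (moment_measure x) (\<Union>n. L n)"
    proof (rule mm.finite_Lim_measure_incseq)
      show "incseq L" unfolding incseq_def L_def by (intro allI impI UN_mono) auto
    qed (auto simp: sb Lb)
    then have m0: "(\<lambda>n. measure (moment_measure x) (\<Union>i. M i) - measure (moment_measure x) (L n)) \<longlonglongrightarrow> 0"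
      using tendsto_diff[OF tendsto_const, of _ _ _ "measure (moment_measure x) (\<Union>i. M i)"] unfolding LU by fastforce
    \<comment> \<open>The squared norm of the remainder is the mass of the part of the union not yet
      covered, because \<open>E\<close> of that part is a projection.\<close>
    have nrm: "(norm (E (\<Union>i. M i) x - E (L n) x))\<^sup>2 =
        measure (moment_measure x) (\<Union>i. M i) - measure (moment_measure x) (L n)" for n
    proof -
      have db: "(\<Union>i. M i) - L n \<in> sets borel" using Lb Ub by auto
      have sub: "L n \<subseteq> (\<Union>i. M i)" by (auto simp: L_def)
      then have "E (\<Union>i. M i) x = E (L n) x + E ((\<Union>i. M i) - L n) x"
        using Eun[OF Lb[of n] db, of x] by (simp add: Un_absorb1)
      then have "(norm (E (\<Union>i. M i) x - E (L n) x))\<^sup>2 = inner (E ((\<Union>i. M i) - L n) x) (E ((\<Union>i. M i) - L n) x)"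
        by (simp add: dot_square_norm)
      also have "\<dots> = inner (E ((\<Union>i. M i) - L n) x) x"
        using Esym[OF db] EE[OF db] by simp
      also have "\<dots> = (\<integral>r. indicator ((\<Union>i. M i) - L n) r \<partial>moment_measure x)"
        unfolding E_def by (rule inner_fcalc(1)[OF ap[OF db]])
      also have "\<dots> = measure (moment_measure x) ((\<Union>i. M i) - L n)" using db sb by simp
      also have "\<dots> = measure (moment_measure x) (\<Union>i. M i) - measure (moment_measure x) (L n)"
        using Lb Ub sub sb by (intro mm.finite_measure_Diff) auto
      finally show ?thesis .
    qed
    have "(\<lambda>n. sqrt ((norm (E (\<Union>i. M i) x - E (L n) x))\<^sup>2)) \<longlonglongrightarrow> sqrt 0"
      unfolding nrm by (rule tendsto_real_sqrt[OF m0])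
    then have "(\<lambda>n. E (L n) x - E (\<Union>i. M i) x) \<longlonglongrightarrow> 0"
      by (simp add: norm_minus_commute tendsto_norm_zero_iff)
    then show ?thesis unfolding sums_def part L_def[symmetric] by (rule LIM_zero_cancel)
  qed
  have "spectral_measure_on K R E"
    unfolding spectral_measure_on_def projection_valued_measure_on_def
  proof (intro conjI ballI allI impI)
    fix x assume x: "x \<in> K"
    show "cinner (R x) x \<in> \<real>" using Rb(5)[OF x] by (auto simp: nonneg_Reals_def Reals_def)
    have sb: "sets (moment_measure x) = sets borel"
      using moment_measure_01[of x] by (simp add: finite_measure_01_def)
    have "measure_of UNIV (sets borel) (\<lambda>M. ennreal (Re (cinner (E M x) x))) =
        measure_of UNIV (sets borel) (emeasure (moment_measure x))"
    proof (rule measure_of_eq)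
      fix M :: "real set" assume "M \<in> sigma_sets UNIV (sets borel)"
      then have "M \<in> sets borel" by (metis sets.sigma_sets_eq space_borel)
      then show "ennreal (Re (cinner (E M x) x)) = emeasure (moment_measure x) M"
        by (simp add: moment_measure_eq E_def inner_cinner)
    qed simp
    also have "\<dots> = moment_measure x"
      using measure_of_of_measure[of "moment_measure x"] sets_eq_imp_space_eq[OF sb] by (simp add: sb)
    finally have me: "measure_of UNIV (sets borel) (\<lambda>M. ennreal (Re (cinner (E M x) x))) = moment_measure x" .
    have id: "poly [:0, 1:] = (\<lambda>r::real. r)" by (simp add: fun_eq_iff)
    have R'x: "poly_op [:0, 1:] x = R' x" by (simp add: zero)
    have "integrable (moment_measure x) (poly [:0, 1:])"
      by (rule integrable_bounded_borel_01[OF moment_measure_01 bounded_borel_01_poly])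
    moreover have "(\<integral>r. poly [:0, 1:] r \<partial>moment_measure x) = Re (cinner (R x) x)"
      unfolding moment_measure_poly R'x using x by (simp add: R'_def P(3) inner_cinner)
    ultimately show "has_bochner_integral (measure_of UNIV (sets borel) (\<lambda>M. ennreal (Re (cinner (E M x) x))))
        (\<lambda>r. r) (Re (cinner (R x) x))"
      unfolding me id by (simp add: has_bochner_integral_iff)
  qed (use proj one sums in auto)
  then show ?thesis by blast
qed

lemma (in positive_op_pair) E_spectral: "spectral_measure_on K R (E_AB A B)"
  unfolding E_AB_def by (rule someI_ex[OF spectral_measure_exists[OF T_clinear K_eq R_contraction]])

section \<open>The variational formula for the parallel sum\<close>

text \<open>The infimum of \<open>r\<bar>u\<bar>\<^sup>2 + t (1 - r)\<bar>v\<bar>\<^sup>2\<close> over \<open>u + v = 1\<close>.\<close>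

definition scalar_parallel :: "real \<Rightarrow> real \<Rightarrow> real"
  where "scalar_parallel t r = t * r * (1 - r) / (r + t * (1 - r))"

context
  fixes t r :: real
  assumes t: "t > 0" and r: "r \<in> {0..1}"
begin

lemma scalar_parallel_denominator_pos: "r + t * (1 - r) > 0"
proof (cases "r = 0")
  case False
  then show ?thesis using t r by (intro add_pos_nonneg) auto
qed (use t in simp)

text \<open>The expansion of \<open>0 \<le> |r u - t (1 - r) v|^2\<close>, divided by the
  denominator. Vectors are allowed because it is applied to the components of two vectors in the
  same spectral subspace.\<close>

lemma scalar_parallel_le:
  fixes u v :: "'a::real_inner"
  shows "scalar_parallel t r * inner (u + v) (u + v) \<le> r * inner u u + t * (1 - r) * inner v v"
proof -
  let ?d = "r + t * (1 - r)" and ?s = "t * (1 - r)"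
  have "0 \<le> inner (r *\<^sub>R u - ?s *\<^sub>R v) (r *\<^sub>R u - ?s *\<^sub>R v)" by simp
  also have "\<dots> = r * r * inner u u + ?s * ?s * inner v v - 2 * (r * ?s * inner u v)"
    by (simp add: inner_diff_left inner_diff_right inner_commute algebra_simps)
  finally have *: "0 \<le> r * r * inner u u + ?s * ?s * inner v v - 2 * (r * ?s * inner u v)" .
  have "(r * inner u u + ?s * inner v v) * ?d - t * r * (1 - r) * inner (u + v) (u + v) =
      r * r * inner u u + ?s * ?s * inner v v - 2 * (r * ?s * inner u v)"
    by (simp add: inner_add_left inner_add_right inner_commute algebra_simps)
  then have "t * r * (1 - r) * inner (u + v) (u + v) \<le> (r * inner u u + ?s * inner v v) * ?d"
    using * by linarith
  then show ?thesis
    using scalar_parallel_denominator_pos by (simp add: scalar_parallel_def pos_divide_le_eq)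
qed

text \<open>The minimising \<open>u\<close>; the corresponding \<open>v = 1 - u\<close> is
  \<open>r / (r + t * (1 - r))\<close>.\<close>

definition parallel_weight :: real
  where "parallel_weight = t * (1 - r) / (r + t * (1 - r))"

lemma parallel_weight_01: "0 \<le> parallel_weight" "parallel_weight \<le> 1"
  using scalar_parallel_denominator_pos t r by (auto simp: parallel_weight_def divide_le_eq)

lemma scalar_parallel_attained:
  "scalar_parallel t r = r * parallel_weight\<^sup>2 + t * (1 - r) * (1 - parallel_weight)\<^sup>2"
proof -
  define d where "d = r + t * (1 - r)"
  have d: "d > 0" using scalar_parallel_denominator_pos by (simp add: d_def)
  define p where "p = t * (1 - r)"
  have p: "d = r + p" "parallel_weight = p / d" by (simp_all add: d_def p_def parallel_weight_def)
  then have w: "1 - p / d = r / d" using d by (simp add: field_simps)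
  have "r * (p / d)\<^sup>2 + p * (1 - p / d)\<^sup>2 = r * p * (r + p) / (d * d)"
    unfolding w using d by (simp add: power2_eq_square add_divide_distrib algebra_simps)
  also have "\<dots> = r * p / d" using d by (simp add: p(1)[symmetric])
  finally show ?thesis
    by (simp only: p(2) scalar_parallel_def d_def p_def) (simp only: mult_ac)
qed

lemma scalar_parallel_nonneg: "0 \<le> scalar_parallel t r"
  using scalar_parallel_denominator_pos t r by (simp add: scalar_parallel_def)

end

text \<open>\<open>scalar_parallel t\<close> is a minimum of functions affine in \<open>r\<close>:
  the optimal weight \<open>w\<close> for \<open>r\<close> is tried at \<open>r'\<close>, and the
  slope \<open>w^2 - t (1 - w)^2\<close> has modulus at most \<open>1 + t\<close>.\<close>

lemma scalar_parallel_lipschitz_aux: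
  assumes t: "t > 0" and r: "r \<in> {0..1}" and r': "r' \<in> {0..1}"
  shows "scalar_parallel t r' \<le> scalar_parallel t r + (1 + t) * \<bar>r - r'\<bar>"
proof -
  define w where "w = parallel_weight t r"
  have w: "0 \<le> w" "w \<le> 1" unfolding w_def by (rule parallel_weight_01[OF t r])+
  have "scalar_parallel t r' \<le> r' * w\<^sup>2 + t * (1 - r') * (1 - w)\<^sup>2"
    using scalar_parallel_le[OF t r', of w "1 - w"] by (simp add: power2_eq_square)
  also have "\<dots> = scalar_parallel t r + ((r' - r) * w\<^sup>2 + t * (r - r') * (1 - w)\<^sup>2)"
    unfolding scalar_parallel_attained[OF t r, folded w_def] by (simp add: algebra_simps)
  also have "(r' - r) * w\<^sup>2 \<le> \<bar>r - r'\<bar> * 1"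
    using w by (intro mult_mono) (auto simp: power_le_one)
  also have "t * (r - r') * (1 - w)\<^sup>2 \<le> (t * \<bar>r - r'\<bar>) * 1"
    by (rule mult_mono) (use w t in \<open>auto simp: power_le_one intro: mult_left_mono\<close>)
  finally show ?thesis by (simp add: algebra_simps)
qed

lemma scalar_parallel_lipschitz:
  assumes "t > 0" "r \<in> {0..1}" "r' \<in> {0..1}"
  shows "\<bar>scalar_parallel t r - scalar_parallel t r'\<bar> \<le> (1 + t) * \<bar>r - r'\<bar>"
  using scalar_parallel_lipschitz_aux[OF assms] scalar_parallel_lipschitz_aux[OF assms(1,3,2)]
  by (simp add: abs_minus_commute abs_le_iff)

lemma bounded_borel_scalar_parallel:
  assumes "t > 0"
  shows "bounded_borel_01 (scalar_parallel t)"
proof (rule bounded_borel_01_continuous)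
  show "continuous_on {0..1} (scalar_parallel t)"
    unfolding scalar_parallel_def
    by (intro continuous_intros ballI) (use scalar_parallel_denominator_pos[OF assms] in force)
  show "scalar_parallel t \<in> borel_measurable borel" unfolding scalar_parallel_def by measurable
qed

lemma finite_measure_01D:
  assumes "finite_measure_01 M"
  shows "finite_measure M" "sets M = sets borel" "space M = UNIV" "AE r in M. r \<in> {0..1}"
  using assms sets_eq_imp_space_eq[of M borel] by (auto simp: finite_measure_01_def)

section \<open>Step functions on a uniform grid\<close>

definition grid_cell :: "nat \<Rightarrow> nat \<Rightarrow> real set"
  where "grid_cell n i = {real i / real n..<(real i + 1) / real n}"

lemma grid_cell_borel: "grid_cell n i \<in> sets borel"
  by (simp add: grid_cell_def)

lemma grid_cell_iff:
  assumes "n > 0" "r \<ge> 0"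
  shows "r \<in> grid_cell n i \<longleftrightarrow> nat \<lfloor>real n * r\<rfloor> = i"
proof -
  have "r \<in> grid_cell n i \<longleftrightarrow> real i \<le> real n * r \<and> real n * r < real i + 1"
    using assms by (simp add: grid_cell_def field_simps)
  also have "\<dots> \<longleftrightarrow> \<lfloor>real n * r\<rfloor> = int i" by (simp add: floor_eq_iff)
  also have "\<dots> \<longleftrightarrow> nat \<lfloor>real n * r\<rfloor> = i" using assms by auto
  finally show ?thesis .
qed

lemma grid_index_le:
  assumes "r \<in> {0..1}"
  shows "nat \<lfloor>real n * r\<rfloor> \<le> n"
proof -
  have "real n * r \<le> real n * 1" using assms by (intro mult_left_mono) auto
  then show ?thesis by (simp add: nat_le_iff floor_le_iff)
qed

lemma grid_cell_disjoint: "n > 0 \<Longrightarrow> i \<noteq> j \<Longrightarrow> grid_cell n i \<inter> grid_cell n j = {}"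
proof -
  assume n: "n > 0" and ij: "i \<noteq> j"
  have "r \<ge> 0" if "r \<in> grid_cell n i" for r i
    using that by (auto simp: grid_cell_def intro: order_trans[of 0 "real i / real n"])
  then show ?thesis using n ij by (metis disjoint_iff grid_cell_iff)
qed

text \<open>Sampling at left endpoints. The index reaches \<open>n\<close>, giving
  \<open>n + 1\<close> cells, because the cells are half-open and the point 1 lies in the last
  one.\<close>

definition grid_step :: "nat \<Rightarrow> (real \<Rightarrow> real) \<Rightarrow> real \<Rightarrow> real"
  where "grid_step n f r = (\<Sum>i\<le>n. f (real i / real n) * indicator (grid_cell n i) r)"

lemma grid_step_eq:
  assumes "n > 0" "r \<in> {0..1}"
  obtains q where "q \<in> {0..1}" "q \<le> r" "r \<le> q + 1 / real n" "\<And>f. grid_step n f r = f q"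
proof
  define i where "i = nat \<lfloor>real n * r\<rfloor>"
  have r: "r \<in> grid_cell n i" using assms grid_cell_iff by (simp add: i_def)
  have i: "i \<le> n" unfolding i_def by (rule grid_index_le[OF assms(2)])
  show "real i / real n \<in> {0..1}" using i assms by simp
  show "real i / real n \<le> r" "r \<le> real i / real n + 1 / real n"
    using r by (auto simp: grid_cell_def add_divide_distrib)
  show "grid_step n f r = f (real i / real n)" for f
  proof -
    have "grid_step n f r = (\<Sum>j\<le>n. if j = i then f (real i / real n) else 0)"
      unfolding grid_step_def
      by (intro sum.cong refl) (use assms grid_cell_iff[of n r] in \<open>auto simp: i_def indicator_def\<close>)
    then show ?thesis using i by simp
  qed
qed

lemma bounded_borel_grid_step: "bounded_borel_01 (grid_step n f)"
proof -
  have "bounded_borel_01 (\<lambda>r. \<Sum>i\<in>I. f (real i / real n) * indicator (grid_cell n i) r)"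
    if "finite I" for I
    using that
  proof (induction I)
    case empty show ?case by (simp add: bounded_borel_01_const)
  next
    case (insert i I)
    show ?case
      unfolding sum.insert[OF insert(1,2)]
      by (intro bounded_borel_01_intros grid_cell_borel insert(3))
  qed
  from this[OF finite_atMost] show ?thesis unfolding grid_step_def[abs_def] .
qed

lemma integral_grid_step:
  assumes "finite_measure_01 M"
  shows "(\<integral>r. grid_step n f r \<partial>M) = (\<Sum>i\<le>n. f (real i / real n) * measure M (grid_cell n i))"
  unfolding grid_step_def
proof (subst Bochner_Integration.integral_sum)
  fix i
  show "integrable M (\<lambda>r. f (real i / real n) * indicator (grid_cell n i) r)"
    by (intro integrable_bounded_borel_01[OF assms] bounded_borel_01_intros grid_cell_borel)
qed (simp add: finite_measure_01D(2,3)[OF assms] grid_cell_borel)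

section \<open>Spectral projections and scalar measures of the chosen \<open>E_AB\<close>\<close>

context positive_op_pair
begin

abbreviation "E \<equiv> E_AB A B"

lemma E_props:
  assumes M: "M \<in> sets borel" and x: "x \<in> K"
  shows E_in_K: "E M x \<in> K" and E_idem: "E M (E M x) = E M x"
    and E_add: "y \<in> K \<Longrightarrow> E M (x + y) = E M x + E M y"
    and E_scaleR: "E M (c *\<^sub>R x) = c *\<^sub>R E M x"
    and E_sym: "y \<in> K \<Longrightarrow> inner (E M x) y = inner x (E M y)"
    and E_UNIV: "E UNIV x = x"
  using E_spectral M x
  unfolding spectral_measure_on_def projection_valued_measure_on_def projection_on_def
    bounded_clinear_on_def
  by (auto simp: inner_cinner scaleR_scaleC)

lemma E_sums:
  assumes "range M \<subseteq> sets borel" "disjoint_family M" "x \<in> K"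
  shows "(\<lambda>i::nat. E (M i) x) sums E (\<Union>i. M i) x"
  using E_spectral assms
  unfolding spectral_measure_on_def projection_valued_measure_on_def by blast

lemma R_lin:
  assumes "x \<in> K"
  shows R_add: "y \<in> K \<Longrightarrow> R (x + y) = R x + R y"
    and R_norm: "norm (R x) \<le> norm x" and R_nonneg: "0 \<le> inner (R x) x"
  using R_contraction assms
  unfolding positive_contraction_on_def positive_op_on_def bounded_clinear_on_def
  by (auto simp: inner_cinner complex_nonneg_Reals_iff scaleR_scaleC)

lemma E_empty: "x \<in> K \<Longrightarrow> E {} x = 0"
  using E_sums[of "\<lambda>_. {}" x] by (simp add: disjoint_family_on_def sums_iff summable_const_iff)

lemma E_Un:
  assumes "M \<in> sets borel" "N \<in> sets borel" "M \<inter> N = {}" "x \<in> K"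
  shows "E (M \<union> N) x = E M x + E N x"
proof -
  have "(\<lambda>i. E (binaryset M N i) x) sums E (\<Union>i. binaryset M N i) x"
    using assms by (intro E_sums) (auto simp: range_binaryset_eq disjoint_family_on_def binaryset_def)
  moreover have "(\<lambda>i. E (binaryset M N i) x) sums (E M x + E N x)"
    by (rule binaryset_sums) (rule E_empty[OF assms(4)])
  ultimately show ?thesis using sums_unique2 by (metis UN_binaryset_eq)
qed

lemma E_inner_self:
  assumes "M \<in> sets borel" "x \<in> K"
  shows "inner (E M x) (E M x) = inner (E M x) x"
  using E_sym[OF assms(1) E_in_K[OF assms] assms(2)] E_idem[OF assms] by (simp add: inner_commute)

text \<open>For \<open>y = E N x\<close> one has \<open>E N y = y\<close>, so the form of the
  projection \<open>E (M \<union> N)\<close> at \<open>y\<close> equals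
  \<open>|E M y|^2 + |y|^2\<close>. A projection keeps this at most \<open>|y|^2\<close>, so
  \<open>E M y\<close> vanishes.\<close>

lemma E_disjoint:
  assumes "M \<in> sets borel" "N \<in> sets borel" "M \<inter> N = {}" "x \<in> K"
  shows "E M (E N x) = 0"
proof -
  define y where "y = E N x"
  have y: "y \<in> K" "E N y = y" unfolding y_def using E_in_K E_idem assms by auto
  have MN: "M \<union> N \<in> sets borel" using assms by auto
  have "inner (E (M \<union> N) y) y = inner (E M y) (E M y) + inner y y"
    by (simp add: E_Un[OF assms(1-3) y(1)] inner_add_left y(2) E_inner_self[OF assms(1) y(1)])
  moreover have "inner (E (M \<union> N) y) y \<le> inner y y"
  proof -
    have "norm (E (M \<union> N) y) * norm (E (M \<union> N) y) \<le> norm (E (M \<union> N) y) * norm y"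
      using E_inner_self[OF MN y(1)] norm_cauchy_schwarz[of "E (M \<union> N) y" y]
      by (simp add: dot_square_norm power2_eq_square)
    then have "norm (E (M \<union> N) y) \<le> norm y" by (cases "E (M \<union> N) y = 0") auto
    then have "norm (E (M \<union> N) y) * norm y \<le> norm y * norm y" by (intro mult_right_mono) auto
    then show ?thesis
      using norm_cauchy_schwarz[of "E (M \<union> N) y" y] by (simp add: dot_square_norm power2_eq_square)
  qed
  ultimately have "inner (E M y) (E M y) \<le> 0" by linarith
  then show ?thesis
    using inner_ge_zero[of "E M y"] by (metis antisym inner_eq_zero_iff y_def)
qed

lemma E_UN_lessThan:
  assumes "\<And>i. M i \<in> sets borel" "\<And>i j. i \<noteq> j \<Longrightarrow> M i \<inter> M j = {}" "x \<in> K"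
  shows "E (\<Union>i<n. M i) x = (\<Sum>i<n::nat. E (M i) x)"
proof (induction n)
  case 0 show ?case by (simp add: E_empty assms)
next
  case (Suc n)
  have "M n \<inter> M i = {}" if "i < n" for i using assms(2)[of n i] that by simp
  then have "M n \<inter> (\<Union>i<n. M i) = {}" by blast
  then have "E (M n \<union> (\<Union>i<n. M i)) x = E (M n) x + E (\<Union>i<n. M i) x"
    using assms by (intro E_Un) auto
  then show ?case using Suc by (simp add: lessThan_Suc add.commute)
qed

definition scalar_measure :: "'a \<Rightarrow> real measure"
  where "scalar_measure x = measure_of UNIV (sets borel) (\<lambda>M. ennreal (Re (cinner (E M x) x)))"

lemma sets_scalar_measure [simp]: "sets (scalar_measure x) = sets borel"
  and space_scalar_measure [simp]: "space (scalar_measure x) = UNIV"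
  unfolding scalar_measure_def
  using sets.sigma_sets_eq[of "borel :: real measure"] by (auto simp: sets_measure_of space_measure_of_conv)

text \<open>\<open>measure_of\<close> takes the prescribed values once the set function is countably
  additive, which comes from pairing the strong additivity of \<open>E\<close> with
  \<open>x\<close>. The value appears as a squared norm because \<open>E M\<close> is a
  projection.\<close>

lemma emeasure_scalar_measure:
  assumes x: "x \<in> K" and M: "M \<in> sets borel"
  shows "emeasure (scalar_measure x) M = ennreal (inner (E M x) (E M x))"
proof -
  have nn: "inner (E N x) x \<ge> 0" if "N \<in> sets borel" for N
    using E_inner_self[OF that x] by (metis inner_ge_zero)
  have "emeasure (scalar_measure x) M = ennreal (Re (cinner (E M x) x))"
  proof (rule emeasure_measure_of[OF scalar_measure_def])
    show "M \<in> sets (scalar_measure x)" using M by simp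
    show "positive (sets (scalar_measure x)) (\<lambda>M. ennreal (Re (cinner (E M x) x)))"
      by (simp add: positive_def E_empty[OF x] inner_cinner[symmetric])
    show "countably_additive (sets (scalar_measure x)) (\<lambda>M. ennreal (Re (cinner (E M x) x)))"
    proof (rule countably_additiveI)
      fix N :: "nat \<Rightarrow> real set"
      assume N: "range N \<subseteq> sets (scalar_measure x)" "disjoint_family N"
      have "(\<lambda>i. E (N i) x) sums E (\<Union>i. N i) x" using N x by (intro E_sums) auto
      from bounded_linear.sums[OF bounded_linear_inner_left this, of x]
      have s: "(\<lambda>i. inner (E (N i) x) x) sums inner (E (\<Union>i. N i) x) x" .
      have "(\<Sum>i. ennreal (inner (E (N i) x) x)) = ennreal (inner (E (\<Union>i. N i) x) x)"
        using N nn by (intro suminf_ennreal_eq[OF _ s]) auto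
      then show "(\<Sum>i. ennreal (Re (cinner (E (N i) x) x))) = ennreal (Re (cinner (E (\<Union>i. N i) x) x))"
        by (simp add: inner_cinner)
    qed
  qed auto
  then show ?thesis using E_inner_self[OF M x] by (simp add: inner_cinner)
qed

lemma measure_scalar_measure:
  assumes "x \<in> K" "M \<in> sets borel"
  shows "measure (scalar_measure x) M = inner (E M x) (E M x)"
  using emeasure_scalar_measure[OF assms] by (simp add: measure_def)

lemma finite_scalar_measure: "x \<in> K \<Longrightarrow> finite_measure (scalar_measure x)"
  by (rule finite_measureI) (simp add: emeasure_scalar_measure)

lemma scalar_measure_moment:
  assumes "x \<in> K"
  shows "integrable (scalar_measure x) (\<lambda>r. r)" "(\<integral>r. r \<partial>scalar_measure x) = inner (R x) x"
  using E_spectral assms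
  unfolding spectral_measure_on_def scalar_measure_def[symmetric]
  by (auto simp: has_bochner_integral_iff inner_cinner)

text \<open>The scalar measure of \<open>v = E M x\<close> lives on \<open>M\<close>, where
  \<open>c r > c d\<close>; if \<open>v\<close> were nonzero its first moment would violate the form
  bound on \<open>R\<close>. The sign of \<open>c\<close> treats both sides of an interval in one
  statement.\<close>

lemma E_null_outside:
  assumes x: "x \<in> K" and M: "M \<in> sets borel"
    and sgn: "\<And>r. r \<in> M \<Longrightarrow> c * r > c * d"
    and le: "\<And>v. v \<in> K \<Longrightarrow> c * inner (R v) v \<le> c * (d * inner v v)"
  shows "E M x = 0"
proof -
  define v where "v = E M x"
  have v: "v \<in> K" unfolding v_def by (rule E_in_K[OF M x])
  interpret finite_measure "scalar_measure v" by (rule finite_scalar_measure[OF v])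
  have cM: "- M \<in> sets borel" using M by auto
  have "E (- M) v = 0" using E_disjoint[OF cM M _ x] by (simp add: v_def)
  then have "emeasure (scalar_measure v) (- M) = 0" by (simp add: emeasure_scalar_measure[OF v cM])
  then have AE: "AE r in scalar_measure v. r \<in> M"
    by (intro AE_I[where N = "- M"]) (auto simp: cM)
  have int: "integrable (scalar_measure v) (\<lambda>r. c * r - c * d)"
    using scalar_measure_moment(1)[OF v] by (intro Bochner_Integration.integrable_diff integrable_mult_right) auto
  have "(\<integral>r. c * r - c * d \<partial>scalar_measure v) = c * inner (R v) v - c * (d * inner v v)"
    using scalar_measure_moment[OF v] E_UNIV[OF M v]
    by (subst Bochner_Integration.integral_diff) (auto simp: measure_scalar_measure[OF v] mult_ac)
  also have "\<dots> \<le> 0" using le[OF v] by simp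
  finally have "(\<integral>r. c * r - c * d \<partial>scalar_measure v) \<le> 0" .
  moreover have AEp: "AE r in scalar_measure v. 0 < c * r - c * d"
    using AE by eventually_elim (use sgn in auto)
  moreover have "0 \<le> (\<integral>r. c * r - c * d \<partial>scalar_measure v)"
    using AEp by (intro integral_nonneg_AE) (auto elim: eventually_mono)
  ultimately have "AE r in scalar_measure v. c * r - c * d = 0"
    by (subst integral_nonneg_eq_0_iff_AE[OF int, symmetric]) (auto elim: eventually_mono)
  with AEp have "AE r in scalar_measure v. False" by eventually_elim auto
  then have "emeasure (scalar_measure v) UNIV = 0"
    using AE_iff_measurable[of UNIV "scalar_measure v" "\<lambda>_. False"] by simp
  then have "inner v v \<le> 0"
    using E_UNIV[OF M v] by (simp add: emeasure_scalar_measure[OF v] ennreal_eq_0_iff)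
  then have "v = 0" using inner_ge_zero[of v] by (simp only: inner_eq_zero_iff antisym_conv)
  then show ?thesis by (simp only: v_def)
qed

text \<open>Right of 1 the bound \<open>R \<le> I\<close> enters with \<open>c = 1\<close>,
  \<open>d = 1\<close>; left of 0 the bound \<open>0 \<le> R\<close> enters with
  \<open>c = -1\<close>, \<open>d = 0\<close>.\<close>

lemma E_outside_01:
  assumes x: "x \<in> K" and M: "M \<in> sets borel" "M \<inter> {0..1} = {}"
  shows "E M x = 0"
proof -
  have a: "E (M \<inter> {1<..}) x = 0"
    by (rule E_null_outside[OF x, of _ 1 1]) (use M R_le in auto)
  have b: "E (M \<inter> {..<0}) x = 0"
    by (rule E_null_outside[OF x, of _ "-1" 0]) (use M R_nonneg in auto)
  have "M = (M \<inter> {1<..}) \<union> (M \<inter> {..<0})" using M(2) by force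
  then have "E M x = E ((M \<inter> {1<..}) \<union> (M \<inter> {..<0})) x" by simp
  also have "\<dots> = E (M \<inter> {1<..}) x + E (M \<inter> {..<0}) x"
    using M x by (intro E_Un) auto
  finally show ?thesis using a b by simp
qed

lemma scalar_measure_01:
  assumes x: "x \<in> K"
  shows "finite_measure_01 (scalar_measure x)"
proof -
  have "emeasure (scalar_measure x) (- {0..1}) = 0"
    using E_outside_01[OF x, of "- {0..1}"] by (simp add: emeasure_scalar_measure[OF x])
  then have "AE r in scalar_measure x. r \<in> {0..1}"
    by (intro AE_I[where N = "- {0..1}"]) auto
  then show ?thesis by (simp add: finite_measure_01_def finite_scalar_measure[OF x])
qed

lemma norm_grid_decomposition:
  assumes x: "x \<in> K" and n: "n > 0"
  shows "(\<Sum>i\<le>n. E (grid_cell n i) x) = x"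
    and "(\<Sum>i\<le>n. inner (E (grid_cell n i) x) (E (grid_cell n i) x)) = inner x x"
proof -
  define U where "U = (\<Union>i<Suc n. grid_cell n i)"
  have U: "U \<in> sets borel" unfolding U_def using grid_cell_borel by auto
  have UN: "{0..1} \<subseteq> U"
  proof
    fix r :: real assume r: "r \<in> {0..1}"
    then have "r \<in> grid_cell n (nat \<lfloor>real n * r\<rfloor>)" using n by (simp add: grid_cell_iff)
    then show "r \<in> U" using grid_index_le[OF r, of n] unfolding U_def by (auto simp: less_Suc_eq_le)
  qed
  have "E (U \<union> - U) x = E U x + E (- U) x" using U x by (intro E_Un) auto
  moreover have "E (- U) x = 0" using U UN by (intro E_outside_01[OF x]) auto
  ultimately have "x = E U x" using E_UNIV[OF U x] by simp
  also have "\<dots> = (\<Sum>i<Suc n. E (grid_cell n i) x)"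
    unfolding U_def by (rule E_UN_lessThan) (use grid_cell_borel grid_cell_disjoint[OF n] x in auto)
  finally show 1: "(\<Sum>i\<le>n. E (grid_cell n i) x) = x" by (simp only: lessThan_Suc_atMost)
  have "(\<Sum>i\<le>n. inner (E (grid_cell n i) x) (E (grid_cell n i) x)) = (\<Sum>i\<le>n. inner (E (grid_cell n i) x) x)"
    by (intro sum.cong refl E_inner_self grid_cell_borel x)
  also have "\<dots> = inner x x" by (simp add: inner_sum_left[symmetric] 1)
  finally show "(\<Sum>i\<le>n. inner (E (grid_cell n i) x) (E (grid_cell n i) x)) = inner x x" .
qed

text \<open>The function \<open>r\<close> lies between its step function and that step function plus
  \<open>1 / n\<close>. Integration against the scalar measure, whose first moment is the form of
  \<open>R\<close>, turns this into sums over cells.\<close>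

lemma R_grid_bounds:
  assumes v: "v \<in> K" and n: "n > 0"
  defines "S \<equiv> \<Sum>i\<le>n. real i / real n * inner (E (grid_cell n i) v) (E (grid_cell n i) v)"
  shows "S \<le> inner (R v) v" "inner (R v) v \<le> S + inner v v / real n"
proof -
  note fm = scalar_measure_01[OF v]
  have S: "S = (\<integral>r. grid_step n (\<lambda>q. q) r \<partial>scalar_measure v)"
    unfolding integral_grid_step[OF fm] S_def by (simp add: measure_scalar_measure[OF v grid_cell_borel])
  have "poly [:0, 1:] = (\<lambda>r::real. r)" by (simp add: fun_eq_iff)
  then have id: "bounded_borel_01 (\<lambda>r. r)" using bounded_borel_01_poly[of "[:0, 1:]"] by simp
  show "S \<le> inner (R v) v"
    unfolding S scalar_measure_moment(2)[OF v, symmetric]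
  proof (rule integral_mono_01[OF fm bounded_borel_grid_step id])
    fix r :: real assume "r \<in> {0..1}"
    then show "grid_step n (\<lambda>q. q) r \<le> r" by (rule grid_step_eq[OF n]) simp
  qed
  have "inner (R v) v \<le> (\<integral>r. grid_step n (\<lambda>q. q) r + 1 / real n \<partial>scalar_measure v)"
    unfolding scalar_measure_moment(2)[OF v, symmetric]
  proof (rule integral_mono_01[OF fm id])
    show "bounded_borel_01 (\<lambda>r. grid_step n (\<lambda>q. q) r + 1 / real n)"
      by (intro bounded_borel_01_intros bounded_borel_grid_step)
    fix r :: real assume "r \<in> {0..1}"
    then show "r \<le> grid_step n (\<lambda>q. q) r + 1 / real n" by (rule grid_step_eq[OF n]) simp
  qed
  also have "\<dots> = S + inner v v / real n"
    unfolding S using E_UNIV[OF sets.top v]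
    by (subst Bochner_Integration.integral_add)
       (auto intro!: integrable_bounded_borel_01[OF fm] bounded_borel_grid_step bounded_borel_01_const
         simp: measure_scalar_measure[OF v] sets.top[of borel, simplified])
  finally show "inner (R v) v \<le> S + inner v v / real n" .
qed

section \<open>Minimising the cost in the coordinates \<open>u = T \<eta>\<close>,
  \<open>w = T \<zeta>\<close>\<close>

definition cost :: "real \<Rightarrow> 'a \<Rightarrow> 'a \<Rightarrow> real"
  where "cost t u w = inner (R u) u + t * (inner w w - inner (R w) w)"

text \<open>The error is the Lipschitz constant \<open>1 + t\<close> times the mesh
  \<open>1 / n\<close> times the total mass of the scalar measure.\<close>

lemma integral_scalar_parallel_approx:
  assumes x: "x \<in> K" and n: "n > 0" and t: "t > 0"
  shows "\<bar>(\<integral>r. scalar_parallel t r \<partial>scalar_measure x) -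
    (\<Sum>i\<le>n. scalar_parallel t (real i / real n) * inner (E (grid_cell n i) x) (E (grid_cell n i) x))\<bar>
    \<le> (1 + t) / real n * inner x x" (is "\<bar>?I - ?S\<bar> \<le> _")
proof -
  note fm = scalar_measure_01[OF x]
  note I = integrable_bounded_borel_01[OF fm]
  note bi = bounded_borel_01_intros bounded_borel_grid_step bounded_borel_scalar_parallel[OF t]
  have "?I - ?S = (\<integral>r. scalar_parallel t r - grid_step n (scalar_parallel t) r \<partial>scalar_measure x)"
    by (subst Bochner_Integration.integral_diff)
       (auto intro!: I bi simp: integral_grid_step[OF fm] measure_scalar_measure[OF x grid_cell_borel])
  also have "\<bar>\<dots>\<bar> \<le> (\<integral>r. \<bar>scalar_parallel t r - grid_step n (scalar_parallel t) r\<bar> \<partial>scalar_measure x)"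
    by (rule integral_abs_bound)
  also have "\<dots> \<le> (\<integral>r. (1 + t) / real n \<partial>scalar_measure x)"
  proof (rule integral_mono_01[OF fm])
    fix r :: real assume r: "r \<in> {0..1}"
    obtain q where q: "q \<in> {0..1}" "q \<le> r" "r \<le> q + 1 / real n" "\<And>f. grid_step n f r = f q"
      by (rule grid_step_eq[OF n r]) (rule that)
    have "\<bar>scalar_parallel t r - scalar_parallel t q\<bar> \<le> (1 + t) * \<bar>r - q\<bar>"
      by (rule scalar_parallel_lipschitz[OF t r q(1)])
    also have "\<dots> \<le> (1 + t) * (1 / real n)" using q t by (intro mult_left_mono) auto
    finally show "\<bar>scalar_parallel t r - grid_step n (scalar_parallel t) r\<bar> \<le> (1 + t) / real n"
      using q(4) by simp
  qed (intro bi)+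
  also have "\<dots> = (1 + t) / real n * inner x x"
    using E_UNIV[OF sets.top x] by (simp add: measure_scalar_measure[OF x] sets.top[of borel, simplified])
  finally show ?thesis .
qed

text \<open>On each cell the scalar inequality at the left endpoint is applied to the components of
  \<open>u\<close> and \<open>w\<close>; summation produces only errors of order
  \<open>1 / n\<close>, which vanish in the limit.\<close>

lemma cost_lower_bound:
  assumes u: "u \<in> K" and w: "w \<in> K" and t: "t > 0"
  shows "(\<integral>r. scalar_parallel t r \<partial>scalar_measure (u + w)) \<le> cost t u w"
proof -
  define x where "x = u + w"
  have x: "x \<in> K" unfolding x_def by (rule subspace_add[OF K_subspace u w])
  have le: "(\<integral>r. scalar_parallel t r \<partial>scalar_measure x) \<le> cost t u w + ((1 + t) * inner x x + t * inner w w) / real n"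
    if n: "n > 0" for n
  proof -
    define e where "e v i = inner (E (grid_cell n i) v) (E (grid_cell n i) v)" for v i
    define l where "l i = real i / real n" for i
    have pt: "scalar_parallel t (l i) * e x i \<le> l i * e u i + t * ((1 - l i) * e w i)" if "i \<le> n" for i
      using scalar_parallel_le[OF t, of "l i" "E (grid_cell n i) u" "E (grid_cell n i) w"] that n
      unfolding e_def x_def E_add[OF grid_cell_borel u w] by (simp add: l_def)
    have "(\<integral>r. scalar_parallel t r \<partial>scalar_measure x) \<le>
        (\<Sum>i\<le>n. scalar_parallel t (l i) * e x i) + (1 + t) / real n * inner x x"
      using integral_scalar_parallel_approx[OF x n t] unfolding e_def l_def by linarith
    also have "(\<Sum>i\<le>n. scalar_parallel t (l i) * e x i) \<le> (\<Sum>i\<le>n. l i * e u i + t * ((1 - l i) * e w i))"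
      by (rule sum_mono) (simp add: pt)
    also have "\<dots> = (\<Sum>i\<le>n. l i * e u i) + t * ((\<Sum>i\<le>n. e w i) - (\<Sum>i\<le>n. l i * e w i))"
      by (simp add: sum.distrib sum_distrib_left left_diff_distrib right_diff_distrib sum_subtractf)
    also have "\<dots> \<le> inner (R u) u + t * (inner w w - (inner (R w) w - inner w w / real n))"
      using R_grid_bounds[OF u n] R_grid_bounds[OF w n] norm_grid_decomposition(2)[OF w n] t
      unfolding e_def l_def by (intro add_mono mult_left_mono) auto
    finally show ?thesis by (simp add: cost_def add_divide_distrib algebra_simps)
  qed
  have "(\<integral>r. scalar_parallel t r \<partial>scalar_measure x) \<le>
      cost t u w + ((1 + t) * inner x x + t * inner w w) / real (Suc n)" for n by (rule le) simp
  moreover have "(\<lambda>n. cost t u w + ((1 + t) * inner x x + t * inner w w) / real (Suc n)) \<longlonglongrightarrow> cost t u w + 0"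
    by (intro tendsto_add tendsto_const LIMSEQ_Suc[OF lim_const_over_n])
  ultimately show ?thesis unfolding x_def[symmetric] by (intro LIMSEQ_le_const) auto
qed

text \<open>The candidate is a discretised form of \<open>parallel_weight t\<close> applied to
  \<open>R\<close>: each cell component of \<open>x\<close> is scaled by the optimal weight at the
  left endpoint. Replacing the integral by a sum costs \<open>(1 + t) / n\<close> and the upper
  bound on the form of \<open>R\<close> at \<open>u\<close> another \<open>1 / n\<close>, hence
  \<open>2 + t\<close>.\<close>

lemma cost_upper_bound:
  assumes x: "x \<in> K" and t: "t > 0" and n: "n > 0"
  shows "\<exists>u\<in>K. cost t u (x - u) \<le> (\<integral>r. scalar_parallel t r \<partial>scalar_measure x) + (2 + t) / real n * inner x x"
proof -
  define l where "l i = real i / real n" for i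
  define \<theta> where "\<theta> i = parallel_weight t (l i)" for i
  define C where "C i = grid_cell n i" for i
  have C: "C i \<in> sets borel" for i by (simp add: C_def grid_cell_borel)
  have l: "l i \<in> {0..1}" if "i \<le> n" for i using that n by (simp add: l_def)
  define u where "u = (\<Sum>i\<le>n. \<theta> i *\<^sub>R E (C i) x)"
  have uK: "u \<in> K" unfolding u_def
    by (intro subspace_sum[OF K_subspace] subspace_scale[OF K_subspace] E_in_K[OF C x])
  define w where "w = x - u"
  have wK: "w \<in> K" unfolding w_def by (rule subspace_diff[OF K_subspace x uK])
  have E_fin: "E (C j) (\<Sum>i\<in>I. \<theta> i *\<^sub>R E (C i) x) = (\<Sum>i\<in>I. \<theta> i *\<^sub>R E (C j) (E (C i) x))"
    if "finite I" for I j using that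
  proof (induction I)
    case empty
    have "E (C j) (0 *\<^sub>R x) = 0 *\<^sub>R E (C j) x" by (rule E_scaleR[OF C x])
    then show ?case by simp
  next
    case (insert a I)
    have "(\<Sum>i\<in>I. \<theta> i *\<^sub>R E (C i) x) \<in> K" "\<theta> a *\<^sub>R E (C a) x \<in> K"
      by (intro subspace_sum[OF K_subspace] subspace_scale[OF K_subspace] E_in_K[OF C x])+
    then show ?case using insert by (simp add: E_add[OF C] E_scaleR[OF C E_in_K[OF C x]])
  qed
  have Eu: "E (C j) u = \<theta> j *\<^sub>R E (C j) x" if "j \<le> n" for j
  proof -
    have "E (C j) u = (\<Sum>i\<le>n. if i = j then \<theta> j *\<^sub>R E (C j) x else 0)"
      unfolding u_def E_fin[OF finite_atMost]
    proof (rule sum.cong[OF refl])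
      fix i assume "i \<in> {..n}"
      show "\<theta> i *\<^sub>R E (C j) (E (C i) x) = (if i = j then \<theta> j *\<^sub>R E (C j) x else 0)"
        using E_disjoint[OF C C _ x, of j i] E_idem[OF C x] grid_cell_disjoint[OF n, of j i]
        by (auto simp: C_def)
    qed
    then show ?thesis using that by simp
  qed
  have Ew: "E (C j) w = (1 - \<theta> j) *\<^sub>R E (C j) x" if "j \<le> n" for j
  proof -
    have "x = u + w" by (simp add: w_def)
    then have "E (C j) x = E (C j) u + E (C j) w" using E_add[OF C uK wK, of j] by simp
    then show ?thesis by (simp add: Eu[OF that] algebra_simps)
  qed
  define e where "e i = inner (E (C i) x) (E (C i) x)" for i
  have \<theta>: "0 \<le> \<theta> i" "\<theta> i \<le> 1" if "i \<le> n" for i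
    using parallel_weight_01[OF t l[OF that]] by (auto simp: \<theta>_def)
  \<comment> \<open>Weights in [0, 1] shrink every component, so the grid error at \<open>u\<close>
    can be stated in terms of \<open>x\<close>.\<close>
  have uu: "inner u u \<le> inner x x"
  proof -
    have "inner u u = (\<Sum>i\<le>n. (\<theta> i)\<^sup>2 * e i)"
      unfolding norm_grid_decomposition(2)[OF uK n, symmetric] C_def[symmetric]
      by (rule sum.cong) (auto simp: Eu e_def power2_eq_square)
    also have "\<dots> \<le> (\<Sum>i\<le>n. 1 * e i)"
      using \<theta> by (intro sum_mono mult_right_mono) (auto simp: e_def power_le_one)
    also have "\<dots> = inner x x"
      using norm_grid_decomposition(2)[OF x n] by (simp add: e_def C_def)
    finally show ?thesis .
  qed
  have Ru: "inner (R u) u \<le> (\<Sum>i\<le>n. l i * ((\<theta> i)\<^sup>2 * e i)) + inner x x / real n"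
  proof -
    have "(\<Sum>i\<le>n. real i / real n * inner (E (grid_cell n i) u) (E (grid_cell n i) u)) = (\<Sum>i\<le>n. l i * ((\<theta> i)\<^sup>2 * e i))"
      unfolding C_def[symmetric] by (rule sum.cong) (auto simp: Eu e_def l_def power2_eq_square)
    moreover have "inner u u / real n \<le> inner x x / real n" using uu by (simp add: divide_right_mono)
    ultimately show ?thesis using R_grid_bounds(2)[OF uK n] by simp
  qed
  have Rw: "inner w w - inner (R w) w \<le> (\<Sum>i\<le>n. (1 - l i) * ((1 - \<theta> i)\<^sup>2 * e i))"
  proof -
    have a: "(\<Sum>i\<le>n. real i / real n * inner (E (grid_cell n i) w) (E (grid_cell n i) w)) = (\<Sum>i\<le>n. l i * ((1 - \<theta> i)\<^sup>2 * e i))"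
      unfolding C_def[symmetric] by (rule sum.cong) (auto simp: Ew e_def l_def power2_eq_square)
    have b: "inner w w = (\<Sum>i\<le>n. (1 - \<theta> i)\<^sup>2 * e i)"
      unfolding norm_grid_decomposition(2)[OF wK n, symmetric] C_def[symmetric]
      by (rule sum.cong) (auto simp: Ew e_def power2_eq_square)
    show ?thesis
      using R_grid_bounds(1)[OF wK n] unfolding a b by (simp add: left_diff_distrib sum_subtractf)
  qed
  have "cost t u w \<le> ((\<Sum>i\<le>n. l i * ((\<theta> i)\<^sup>2 * e i)) + inner x x / real n) +
      t * (\<Sum>i\<le>n. (1 - l i) * ((1 - \<theta> i)\<^sup>2 * e i))"
    unfolding cost_def using Ru Rw t by (intro add_mono mult_left_mono) auto
  also have "\<dots> = (\<Sum>i\<le>n. (l i * (\<theta> i)\<^sup>2 + t * (1 - l i) * (1 - \<theta> i)\<^sup>2) * e i) + inner x x / real n"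
    by (simp only: sum_distrib_left sum.distrib distrib_right mult.assoc add_ac)
  also have "(\<Sum>i\<le>n. (l i * (\<theta> i)\<^sup>2 + t * (1 - l i) * (1 - \<theta> i)\<^sup>2) * e i) = (\<Sum>i\<le>n. scalar_parallel t (l i) * e i)"
    using scalar_parallel_attained[OF t l] by (intro sum.cong) (auto simp: \<theta>_def)
  also have "\<dots> \<le> (\<integral>r. scalar_parallel t r \<partial>scalar_measure x) + (1 + t) / real n * inner x x"
    using integral_scalar_parallel_approx[OF x n t] unfolding e_def C_def l_def by linarith
  finally show ?thesis
    using uK by (intro bexI[of _ u]) (auto simp: w_def[symmetric] add_divide_distrib algebra_simps)
qed

text \<open>This is the reason for the form of \<open>cost\<close>: \<open>A = T R T\<close> and
  \<open>B = T (I - R) T\<close>.\<close>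

lemma cost_T: "cost t (T \<eta>) (T \<zeta>) = inner (A \<eta>) \<eta> + t * inner (B \<zeta>) \<zeta>"
  using A_eq[of \<eta>] B_eq[of \<zeta>] positive_op_sym[OF T_positive]
  by (simp add: cost_def inner_diff_left)

lemma persp_measure_eq:
  "persp_measure A B (vector_functional \<xi>) = scalar_measure (T \<xi>)"
proof -
  have "Re (vector_functional \<xi> (\<lambda>x. hadjoint T (E M (T x)))) = Re (cinner (E M (T \<xi>)) (T \<xi>))" for M
    using positive_op_sym[OF T_positive]
    by (simp add: vector_functional_def hadjoint_positive_op[OF T_positive] inner_cinner[symmetric])
  then show ?thesis unfolding persp_measure_def scalar_measure_def by simp
qed

lemma persp_measure_01: "finite_measure_01 (persp_measure A B (vector_functional \<xi>))"
  unfolding persp_measure_eq by (rule scalar_measure_01[OF T_in_K])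

text \<open>\<open>r\<close> corresponds to \<open>R\<close> and \<open>1 - r\<close> to
  \<open>I - R\<close>; this is how the coefficients of the variational expression meet the affine
  terms in \<open>r\<close>.\<close>

lemma persp_measure_moments:
  shows "(\<integral>r. r \<partial>persp_measure A B (vector_functional \<xi>)) = inner (A \<xi>) \<xi>"
    and "(\<integral>r. 1 - r \<partial>persp_measure A B (vector_functional \<xi>)) = inner (B \<xi>) \<xi>"
proof -
  show 1: "(\<integral>r. r \<partial>persp_measure A B (vector_functional \<xi>)) = inner (A \<xi>) \<xi>"
    unfolding persp_measure_eq scalar_measure_moment(2)[OF T_in_K]
    using A_eq[of \<xi>] positive_op_sym[OF T_positive] by simp
  interpret finite_measure "scalar_measure (T \<xi>)" by (rule finite_scalar_measure[OF T_in_K])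
  have "measure (scalar_measure (T \<xi>)) UNIV = inner (T \<xi>) (T \<xi>)"
    using E_UNIV[OF sets.top T_in_K] by (simp add: measure_scalar_measure[OF T_in_K] sets.top[of borel, simplified])
  then show "(\<integral>r. 1 - r \<partial>persp_measure A B (vector_functional \<xi>)) = inner (B \<xi>) \<xi>"
    using 1 scalar_measure_moment(1)[OF T_in_K, of \<xi>] B_eq[of \<xi>] A_eq[of \<xi>] positive_op_sym[OF T_positive]
    unfolding persp_measure_eq
    by (subst Bochner_Integration.integral_diff) (auto simp: inner_diff_left)
qed

lemma parallel_sum_lower:
  assumes "t > 0" "\<eta> + \<zeta> = \<xi>"
  shows "(\<integral>r. scalar_parallel t r \<partial>persp_measure A B (vector_functional \<xi>)) \<le>
    inner (A \<eta>) \<eta> + t * inner (B \<zeta>) \<zeta>"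
  using cost_lower_bound[OF T_in_K T_in_K assms(1), of \<eta> \<zeta>] assms(2)
  unfolding persp_measure_eq cost_T by (simp add: linear_simps(1)[OF T_linear, symmetric])

text \<open>\<open>cost_upper_bound\<close> yields a nearly optimal \<open>u\<close> that is only a
  limit of vectors \<open>T \<eta>\<close>. By continuity of \<open>cost\<close> on \<open>K\<close>
  some \<open>T \<eta>\<close> is good enough, and the complement \<open>T \<xi> - T \<eta>\<close>
  again lies in the range of \<open>T\<close>.\<close>

lemma parallel_sum_attained:
  assumes t: "t > 0" and e: "e > 0"
  shows "\<exists>\<eta> \<zeta>. \<eta> + \<zeta> = \<xi> \<and> inner (A \<eta>) \<eta> + t * inner (B \<zeta>) \<zeta> <
    (\<integral>r. scalar_parallel t r \<partial>persp_measure A B (vector_functional \<xi>)) + e"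
proof -
  define x where "x = T \<xi>"
  have x: "x \<in> K" unfolding x_def by (rule T_in_K)
  obtain n0 where n0: "real n0 > (2 + t) * inner x x / e" using reals_Archimedean2 by blast
  define n where "n = Suc n0"
  have n: "n > 0" by (simp add: n_def)
  have "(2 + t) * inner x x < e * real n0" using n0 e by (simp add: field_simps)
  also have "\<dots> < e * real n" using e by (simp add: n_def)
  finally have ne: "(2 + t) / real n * inner x x < e" using n by (simp add: divide_less_eq)
  obtain u where u: "u \<in> K"
    "cost t u (x - u) \<le> (\<integral>r. scalar_parallel t r \<partial>scalar_measure x) + (2 + t) / real n * inner x x"
    using cost_upper_bound[OF x t n] by blast
  then have lt: "cost t u (x - u) < (\<integral>r. scalar_parallel t r \<partial>scalar_measure x) + e" using ne by linarith
  have "u \<in> closure (range T)" using u(1) by (simp add: K_eq)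
  then obtain s where s: "\<And>i. s i \<in> range T" "s \<longlonglongrightarrow> u" unfolding closure_sequential by metis
  have sK: "s i \<in> K" for i using s(1)[of i] T_in_K by auto
  have Rlim: "(\<lambda>i. R (z i)) \<longlonglongrightarrow> R v" if z: "\<And>i. z i \<in> K" "v \<in> K" "z \<longlonglongrightarrow> v" for z :: "nat \<Rightarrow> 'a" and v
  proof (rule LIM_zero_cancel, rule Lim_null_comparison[OF always_eventually], rule allI)
    fix i
    have d: "z i - v \<in> K" by (rule subspace_diff[OF K_subspace z(1,2)])
    have "R (z i) = R (z i - v) + R v" using R_add[OF d z(2)] by simp
    then show "norm (R (z i) - R v) \<le> norm (z i - v)" using R_norm[OF d] by simp
  next
    show "(\<lambda>i. norm (z i - v)) \<longlonglongrightarrow> 0" using z(3) by (simp add: LIM_zero_iff tendsto_norm_zero)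
  qed
  have "(\<lambda>i. cost t (s i) (x - s i)) \<longlonglongrightarrow> cost t u (x - u)"
    unfolding cost_def
    by (intro tendsto_intros Rlim sK s u subspace_diff[OF K_subspace] x)
  from order_tendstoD(2)[OF this lt] obtain i where
    i: "cost t (s i) (x - s i) < (\<integral>r. scalar_parallel t r \<partial>scalar_measure x) + e"
    by (auto simp: eventually_sequentially)
  obtain \<eta> where \<eta>: "s i = T \<eta>" using s(1)[of i] by blast
  have "x - s i = T (\<xi> - \<eta>)" by (simp add: x_def \<eta> linear_simps(2)[OF T_linear])
  with i have "cost t (T \<eta>) (T (\<xi> - \<eta>)) < (\<integral>r. scalar_parallel t r \<partial>scalar_measure x) + e" by (simp add: \<eta>)
  then show ?thesis
    unfolding cost_T persp_measure_eq x_def by (intro exI[of _ \<eta>] exI[of _ "\<xi> - \<eta>"]) simp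
qed

end

section \<open>The scalar perspective function\<close>

text \<open>The perspective of \<open>t \<mapsto> (t - 1)\<^sup>2 / (t + l)\<close>, evaluated at \<open>(r, 1 - r)\<close>.\<close>

definition persp_kernel :: "real \<Rightarrow> real \<Rightarrow> real"
  where "persp_kernel l r = (2 * r - 1)\<^sup>2 / (r + l * (1 - r))"

context
  fixes l r :: real
  assumes l: "l > 0" and r: "r \<in> {0..1}"
begin

lemma persp_kernel_nonneg: "0 \<le> persp_kernel l r"
  using scalar_parallel_denominator_pos[OF l r] by (simp add: persp_kernel_def)

lemma persp_kernel_decomposition:
  "l / (1 + l) * persp_kernel l r =
    l / (1 + l) * r + 1 / (1 + l) * (1 - r) - (1 + l) / l * scalar_parallel l r"
proof -
  define D where "D = r + l * (1 - r)"
  have D: "D > 0" using scalar_parallel_denominator_pos[OF l r] by (simp add: D_def)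
  \<comment> \<open>The decomposition cleared of denominators: a polynomial identity in
    \<open>l\<close> and \<open>r\<close>.\<close>
  have "(l * r + (1 - r)) * D - (1 + l) * (1 + l) * (r * (1 - r)) = l * (2 * r - 1)\<^sup>2"
    by (simp add: D_def power2_eq_square algebra_simps)
  then have "l * (2 * r - 1)\<^sup>2 / D = (l * r + (1 - r)) - (1 + l) * (1 + l) * (r * (1 - r)) / D"
    using D by (simp add: field_simps)
  then have "l * (2 * r - 1)\<^sup>2 / D / (1 + l) =
      ((l * r + (1 - r)) - (1 + l) * (1 + l) * (r * (1 - r)) / D) / (1 + l)" by simp
  also have "\<dots> = l / (1 + l) * r + 1 / (1 + l) * (1 - r) - (1 + l) * (r * (1 - r)) / D"
    using l by (simp add: diff_divide_distrib add_divide_distrib)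
  finally show ?thesis
    using l by (simp add: persp_kernel_def scalar_parallel_def D_def[symmetric] mult_ac)
qed

text \<open>This bound and its companion at zero hold for every \<open>l\<close> at once. They keep
  the approximants near an endpoint below their value there, which gives upper
  semicontinuity.\<close>

lemma persp_kernel_le_at_one:
  assumes "1 / 2 \<le> r"
  shows "persp_kernel l r \<le> persp_kernel l 1"
proof -
  have "(2 * r - 1)\<^sup>2 \<le> 1 * (2 * r - 1)"
    unfolding power2_eq_square using assms r by (intro mult_right_mono) auto
  also have "\<dots> \<le> r + l * (1 - r)" using l r by (simp add: add_increasing2)
  finally show ?thesis
    using scalar_parallel_denominator_pos[OF l r] by (simp add: persp_kernel_def divide_le_eq)
qed

lemma persp_kernel_le_at_zero:
  assumes "r \<le> 1 / 2"
  shows "persp_kernel l r \<le> persp_kernel l 0"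
proof -
  have "l * (2 * r - 1)\<^sup>2 = l * ((1 - 2 * r) * (1 - 2 * r))" by (simp add: power2_eq_square algebra_simps)
  also have "\<dots> \<le> l * ((1 - r) * 1)" using assms r l by (intro mult_left_mono mult_mono) auto
  also have "\<dots> \<le> r + l * (1 - r)" using r by simp
  finally show ?thesis
    using scalar_parallel_denominator_pos[OF l r] l by (simp add: persp_kernel_def field_simps)
qed

text \<open>The factor does not depend on \<open>l\<close> and tends to 1 at the endpoint. With the
  companion at zero it gives lower semicontinuity at the endpoints, also when the value there is
  infinite.\<close>

lemma persp_kernel_ge_at_one:
  assumes "l \<le> m"
  shows "(2 * r - 1)\<^sup>2 / (r + m * (1 - r)) * persp_kernel l 1 \<le> persp_kernel l r"
proof -
  have "r + l * (1 - r) \<le> r + m * (1 - r)" using r assms by (simp add: mult_right_mono)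
  then have "(2 * r - 1)\<^sup>2 / (r + m * (1 - r)) \<le> (2 * r - 1)\<^sup>2 / (r + l * (1 - r))"
    using scalar_parallel_denominator_pos[OF l r]
    by (intro divide_left_mono mult_pos_pos zero_le_power2) linarith+
  then show ?thesis by (simp add: persp_kernel_def)
qed

lemma persp_kernel_ge_at_zero:
  assumes "1 / m \<le> l" "m > 0"
  shows "(2 * r - 1)\<^sup>2 / (m * r + (1 - r)) * persp_kernel l 0 \<le> persp_kernel l r"
proof -
  have "1 \<le> m * l" using assms l by (simp add: field_simps)
  then have "1 * r \<le> (m * l) * r" using r by (intro mult_right_mono) auto
  then have "r + l * (1 - r) \<le> (m * r + (1 - r)) * l" by (simp add: algebra_simps)
  then have "(2 * r - 1)\<^sup>2 / ((m * r + (1 - r)) * l) \<le> (2 * r - 1)\<^sup>2 / (r + l * (1 - r))"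
    using scalar_parallel_denominator_pos[OF l r]
    by (intro divide_left_mono mult_pos_pos[of "(m * r + (1 - r)) * l"] zero_le_power2) linarith+
  then show ?thesis by (simp add: persp_kernel_def)
qed

end

lemma persp_kernel_measurable [measurable]:
  "(\<lambda>r. persp_kernel l r) \<in> borel_measurable borel" "(\<lambda>l. persp_kernel l r) \<in> borel_measurable borel"
  unfolding persp_kernel_def by measurable

lemma pos_if_ge_inverse: "n > 0 \<Longrightarrow> 1 / real n \<le> l \<Longrightarrow> 0 < l"
  by (rule less_le_trans[of _ "1 / real n"]) simp_all

section \<open>The measures \<open>nu_n\<close> and the approximants\<close>

locale perspective_data =
  fixes f :: "real \<Rightarrow> real" and a b c d :: real and \<mu> :: "real measure"
  assumes c: "c \<ge> 0" and d: "d \<ge> 0"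
    and sets_mu: "sets \<mu> = sets (restrict_space borel {0<..})"
    and finite_mu: "(\<integral>\<^sup>+ l. ennreal (1 / (1 + l)) \<partial>\<mu>) < \<infinity>"
    and f_eq: "\<And>t. t > 0 \<Longrightarrow>
      f t = a + b * (t - 1) + c * (t - 1)\<^sup>2 + d * ((t - 1)\<^sup>2 / t)
        + (\<integral>l. (t - 1)\<^sup>2 / (t + l) \<partial>\<mu>)"
begin

abbreviation "\<nu> \<equiv> nu_n c d \<mu>"

lemma space_mu: "space \<mu> = {0<..}"
  using sets_eq_imp_space_eq[OF sets_mu] by (simp add: space_restrict_space)

lemma measurable_mu: "g \<in> measurable borel N \<Longrightarrow> g \<in> measurable \<mu> N"
  unfolding measurable_cong_sets[OF sets_mu refl] by (rule measurable_restrict_space1)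

lemma sets_nu [simp]: "sets (\<nu> n) = sets \<mu>" and space_nu: "space (\<nu> n) = {0<..}"
  using sets.space_closed[of \<mu>] sets.sigma_sets_eq[of \<mu>] space_mu
  by (auto simp: nu_n_def sets_measure_of space_measure_of_conv)

lemma measurable_nu: "g \<in> measurable borel N \<Longrightarrow> g \<in> measurable (\<nu> n) N"
  unfolding measurable_cong_sets[OF sets_nu refl] by (rule measurable_mu)

definition nu_density :: "nat \<Rightarrow> real \<Rightarrow> ennreal"
  where "nu_density n l = indicator {1 / real n..real n} l * ennreal ((1 + l) / l)"

lemma nu_density_measurable: "nu_density n \<in> borel_measurable \<mu>"
  unfolding nu_density_def[abs_def] by (intro measurable_mu) measurable

lemma emeasure_nu:
  assumes M: "M \<in> sets \<mu>"
  shows "emeasure (\<nu> n) M = ennreal ((1 + real n) * c) * indicator M (real n) +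
    ennreal ((1 + real n) * d) * indicator M (1 / real n) + emeasure (density \<mu> (nu_density n)) M"
proof (rule emeasure_measure_of)
  show "\<nu> n = measure_of (space \<mu>) (sets \<mu>) (\<lambda>M. ennreal ((1 + real n) * c) * indicator M (real n) +
    ennreal ((1 + real n) * d) * indicator M (1 / real n) + emeasure (density \<mu> (nu_density n)) M)"
    by (simp add: nu_n_def nu_density_def[abs_def])
  show "sets \<mu> \<subseteq> Pow (space \<mu>)" by (rule sets.space_closed)
  show "M \<in> sets (\<nu> n)" using M by simp
  show "positive (sets (\<nu> n)) (\<lambda>M. ennreal ((1 + real n) * c) * indicator M (real n) +
    ennreal ((1 + real n) * d) * indicator M (1 / real n) + emeasure (density \<mu> (nu_density n)) M)"
    by (simp add: positive_def)
  show "countably_additive (sets (\<nu> n)) (\<lambda>M. ennreal ((1 + real n) * c) * indicator M (real n) +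
    ennreal ((1 + real n) * d) * indicator M (1 / real n) + emeasure (density \<mu> (nu_density n)) M)"
  proof (rule countably_additiveI)
    fix N :: "nat \<Rightarrow> real set" assume N: "range N \<subseteq> sets (\<nu> n)" "disjoint_family N"
    have "(\<Sum>i. emeasure (density \<mu> (nu_density n)) (N i)) = emeasure (density \<mu> (nu_density n)) (\<Union> (range N))"
      using N by (intro suminf_emeasure) auto
    then show "(\<Sum>i. ennreal ((1 + real n) * c) * indicator (N i) (real n) +
        ennreal ((1 + real n) * d) * indicator (N i) (1 / real n) + emeasure (density \<mu> (nu_density n)) (N i)) =
      ennreal ((1 + real n) * c) * indicator (\<Union> (range N)) (real n) +
        ennreal ((1 + real n) * d) * indicator (\<Union> (range N)) (1 / real n) +
        emeasure (density \<mu> (nu_density n)) (\<Union> (range N))"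
      by (simp add: suminf_add[symmetric] suminf_indicator[OF N(2)])
  qed
qed

text \<open>Induction over measurable functions; both atoms lie in the space of \<mu> because
  \<open>n > 0\<close>. For \<open>n = 1\<close> they coincide and their weights add, as in the
  formula.\<close>

lemma nn_integral_nu:
  assumes n: "n > 0" and P: "P \<in> borel_measurable \<mu>"
  shows "(\<integral>\<^sup>+t. P t \<partial>\<nu> n) = ennreal ((1 + real n) * c) * P (real n) +
    ennreal ((1 + real n) * d) * P (1 / real n) + (\<integral>\<^sup>+l. nu_density n l * P l \<partial>\<mu>)"
proof -
  have pn: "real n \<in> space \<mu>" "1 / real n \<in> space \<mu>" using n by (simp_all add: space_mu)
  note m = nu_density_measurable[of n]
  have "(\<integral>\<^sup>+t. P t \<partial>\<nu> n) = ennreal ((1 + real n) * c) * P (real n) +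
    ennreal ((1 + real n) * d) * P (1 / real n) + (\<integral>\<^sup>+l. P l \<partial>density \<mu> (nu_density n))"
    using P
  proof (induction rule: borel_measurable_induct)
    case (cong f g)
    have "(\<integral>\<^sup>+t. f t \<partial>\<nu> n) = (\<integral>\<^sup>+t. g t \<partial>\<nu> n)"
      using cong(3) by (intro nn_integral_cong) (simp add: space_nu space_mu)
    moreover have "(\<integral>\<^sup>+l. f l \<partial>density \<mu> (nu_density n)) = (\<integral>\<^sup>+l. g l \<partial>density \<mu> (nu_density n))"
      using cong(3) by (intro nn_integral_cong) simp
    ultimately show ?case using cong(3)[OF pn(1)] cong(3)[OF pn(2)] cong(4) by simp
  next
    case (set A)
    then show ?case by (simp add: emeasure_nu)
  next
    case (mult u v)
    then have "u \<in> borel_measurable (\<nu> n)" by (simp add: measurable_cong_sets[OF sets_nu refl])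
    then show ?case using mult by (simp add: nn_integral_cmult distrib_left mult_ac)
  next
    case (add u v)
    then have "u \<in> borel_measurable (\<nu> n)" "v \<in> borel_measurable (\<nu> n)"
      by (simp_all add: measurable_cong_sets[OF sets_nu refl])
    then show ?case using add by (simp add: nn_integral_add distrib_left add_ac)
  next
    case (seq U)
    have mU: "U i \<in> borel_measurable (\<nu> n)" for i
      using seq(1) by (simp add: measurable_cong_sets[OF sets_nu refl])
    have incU: "incseq (\<lambda>i. U i x)" for x using seq(3) by (simp add: incseq_def le_fun_def)
    have L: "(\<lambda>i. U i x) \<longlonglongrightarrow> (SUP i. U i) x" for x using LIMSEQ_SUP[OF incU] by (simp add: image_comp)
    have "(\<lambda>i. \<integral>\<^sup>+t. U i t \<partial>\<nu> n) \<longlonglongrightarrow> (\<integral>\<^sup>+t. (SUP i. U i) t \<partial>\<nu> n)"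
      by (rule nn_integral_LIMSEQ[OF seq(3) mU L])
    moreover have "(\<lambda>i. ennreal ((1 + real n) * c) * U i (real n) +
        ennreal ((1 + real n) * d) * U i (1 / real n) + (\<integral>\<^sup>+l. U i l \<partial>density \<mu> (nu_density n)))
      \<longlonglongrightarrow> ennreal ((1 + real n) * c) * (SUP i. U i) (real n) +
        ennreal ((1 + real n) * d) * (SUP i. U i) (1 / real n) +
        (\<integral>\<^sup>+l. (SUP i. U i) l \<partial>density \<mu> (nu_density n))"
      by (intro tendsto_add ennreal_tendsto_cmult L nn_integral_LIMSEQ[OF seq(3) _ L]) (auto simp: seq(1))
    ultimately show ?case unfolding seq.IH by (rule LIMSEQ_unique)
  qed
  then show ?thesis by (simp add: nn_integral_density[OF m P])
qed

lemma AE_nu: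
  assumes n: "n > 0"
  shows "AE t in \<nu> n. t \<in> {1 / real n..real n}"
proof -
  let ?P = "\<lambda>t. indicator (- {1 / real n..real n}) t :: ennreal"
  have P: "?P \<in> borel_measurable \<mu>" by (intro measurable_mu) measurable
  have "1 / real n \<le> real n" using n by (intro order_trans[of "1 / real n" 1 "real n"]) auto
  moreover have "(\<integral>\<^sup>+l. nu_density n l * ?P l \<partial>\<mu>) = (\<integral>\<^sup>+l. 0 \<partial>\<mu>)"
    by (rule nn_integral_cong) (simp add: nu_density_def indicator_def)
  ultimately have "(\<integral>\<^sup>+t. ?P t \<partial>\<nu> n) = 0" unfolding nn_integral_nu[OF n P] by simp
  then have "AE t in \<nu> n. ?P t = 0"
    using P by (subst (asm) nn_integral_0_iff_AE) (auto simp: measurable_cong_sets[OF sets_nu refl])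
  then show ?thesis by eventually_elim (auto simp: indicator_def split: if_splits)
qed

text \<open>On the interval \<open>1 \<le> (1 + n) / (1 + l)\<close>, so the integrability
  hypothesis on \<mu> bounds its mass there.\<close>

lemma nn_integral_mu_interval_finite:
  assumes n: "n > 0"
  shows "(\<integral>\<^sup>+l. indicator {1 / real n..real n} l \<partial>\<mu>) < \<infinity>"
proof -
  have m: "(\<lambda>l. ennreal (1 / (1 + l))) \<in> borel_measurable \<mu>" by (intro measurable_mu) measurable
  have "(\<integral>\<^sup>+l. indicator {1 / real n..real n} l \<partial>\<mu>) \<le> (\<integral>\<^sup>+l. ennreal (1 + real n) * ennreal (1 / (1 + l)) \<partial>\<mu>)"
  proof (rule nn_integral_mono)
    fix l assume "l \<in> space \<mu>"
    then have l: "l > 0" by (simp add: space_mu)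
    show "indicator {1 / real n..real n} l \<le> ennreal (1 + real n) * ennreal (1 / (1 + l))"
    proof (cases "l \<in> {1 / real n..real n}")
      case True
      then have "1 \<le> (1 + real n) * (1 / (1 + l))" using l by simp
      then have "ennreal 1 \<le> ennreal ((1 + real n) * (1 / (1 + l)))" by (rule ennreal_leI)
      also have "\<dots> = ennreal (1 + real n) * ennreal (1 / (1 + l))" using l by (intro ennreal_mult) auto
      finally show ?thesis using True by simp
    qed simp
  qed
  also have "\<dots> = ennreal (1 + real n) * (\<integral>\<^sup>+l. ennreal (1 / (1 + l)) \<partial>\<mu>)" by (rule nn_integral_cmult[OF m])
  also have "\<dots> < \<infinity>" using finite_mu by (simp add: ennreal_mult_less_top)
  finally show ?thesis .
qed

lemma finite_nu:
  assumes n: "n > 0"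
  shows "finite_measure (\<nu> n)"
proof (rule finite_measureI)
  have "(\<integral>\<^sup>+l. nu_density n l * 1 \<partial>\<mu>) \<le> (\<integral>\<^sup>+l. ennreal (1 + real n) * indicator {1 / real n..real n} l \<partial>\<mu>)"
  proof (rule nn_integral_mono)
    fix l assume "l \<in> space \<mu>"
    have "(1 + l) / l \<le> 1 + real n" if "1 / real n \<le> l"
    proof -
      have l: "l > 0" using pos_if_ge_inverse[OF n that] .
      then have "1 \<le> real n * l" using that n by (simp add: field_simps)
      then show ?thesis using l by (simp add: field_simps)
    qed
    then show "nu_density n l * 1 \<le> ennreal (1 + real n) * indicator {1 / real n..real n} l"
      by (auto simp: nu_density_def indicator_def simp del: ennreal_plus intro!: ennreal_leI)
  qed
  also have "\<dots> = ennreal (1 + real n) * (\<integral>\<^sup>+l. indicator {1 / real n..real n} l \<partial>\<mu>)"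
    by (rule nn_integral_cmult) (intro measurable_mu, measurable)
  also have "\<dots> < \<infinity>" using nn_integral_mu_interval_finite[OF n] by (simp add: ennreal_mult_less_top)
  finally have "(\<integral>\<^sup>+t. 1 \<partial>\<nu> n) < \<infinity>"
    by (subst nn_integral_nu[OF n]) (auto simp: ennreal_mult_less_top)
  then show "emeasure (\<nu> n) (space (\<nu> n)) \<noteq> \<infinity>" by simp
qed

definition Phi :: "nat \<Rightarrow> real \<Rightarrow> ennreal"
  where "Phi n r = (\<integral>\<^sup>+t. ennreal (t / (1 + t) * persp_kernel t r) \<partial>\<nu> n)"

text \<open>The factor \<open>t / (1 + t)\<close> cancels the density \<open>(1 + l) / l\<close> and
  reduces the atoms to \<open>c n k(n, r)\<close> and \<open>d k(1 / n, r)\<close>. In this form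
  \<open>n\<close> enters only through decreasing denominators and a growing interval.\<close>

lemma Phi_eq:
  assumes n: "n > 0" and r: "r \<in> {0..1}"
  shows "Phi n r = ennreal (c * ((2 * r - 1)\<^sup>2 / (r / real n + (1 - r)))) +
    ennreal (d * ((2 * r - 1)\<^sup>2 / (r + (1 - r) / real n))) +
    (\<integral>\<^sup>+l. indicator {1 / real n..real n} l * ennreal (persp_kernel l r) \<partial>\<mu>)"
proof -
  have pn: "1 / real n > 0" "real n > 0" using n by simp_all
  note nn = persp_kernel_nonneg[OF _ r]
  have k1: "real n * persp_kernel (real n) r = (2 * r - 1)\<^sup>2 / (r / real n + (1 - r))"
  proof -
    have "real n * persp_kernel (real n) r = (2 * r - 1)\<^sup>2 / ((r + real n * (1 - r)) / real n)"
      by (simp add: persp_kernel_def)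
    also have "(r + real n * (1 - r)) / real n = r / real n + (1 - r)"
      using n by (simp add: add_divide_distrib)
    finally show ?thesis .
  qed
  have "ennreal ((1 + real n) * c) * ennreal (real n / (1 + real n) * persp_kernel (real n) r) =
      ennreal (c * (real n * persp_kernel (real n) r))"
    using c nn[OF pn(2)] by (simp add: ennreal_mult[symmetric] add_nonneg_eq_0_iff)
  moreover have "ennreal ((1 + real n) * d) * ennreal ((1 / real n) / (1 + 1 / real n) * persp_kernel (1 / real n) r) =
      ennreal (d * persp_kernel (1 / real n) r)"
  proof -
    have "(1 / real n) / (1 + 1 / real n) = 1 / (1 + real n)" using n by (simp add: field_simps)
    then show ?thesis
      using d nn[OF pn(1)] by (simp add: ennreal_mult[symmetric] add_nonneg_eq_0_iff)
  qed
  moreover have "(\<integral>\<^sup>+l. nu_density n l * ennreal (l / (1 + l) * persp_kernel l r) \<partial>\<mu>) =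
      (\<integral>\<^sup>+l. indicator {1 / real n..real n} l * ennreal (persp_kernel l r) \<partial>\<mu>)"
  proof (rule nn_integral_cong)
    fix l assume "l \<in> space \<mu>"
    then have l: "l > 0" by (simp add: space_mu)
    have "(1 + l) / l * (l / (1 + l) * persp_kernel l r) = persp_kernel l r" using l by simp
    then have "ennreal ((1 + l) / l) * ennreal (l / (1 + l) * persp_kernel l r) = ennreal (persp_kernel l r)"
      using l nn[OF l] by (subst ennreal_mult[symmetric]) auto
    then show "nu_density n l * ennreal (l / (1 + l) * persp_kernel l r) =
        indicator {1 / real n..real n} l * ennreal (persp_kernel l r)"
      by (simp add: nu_density_def mult.assoc)
  qed
  ultimately show ?thesis
    unfolding Phi_def k1
    by (subst nn_integral_nu[OF n]) (auto intro!: measurable_mu simp: persp_kernel_def[of "1 / real n"])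
qed

lemma Phi_mono:
  assumes "0 < m" "m \<le> n" and r: "r \<in> {0..1}"
  shows "Phi m r \<le> Phi n r"
proof -
  have n: "n > 0" using assms by simp
  have inv: "1 / real n \<le> 1 / real m" "real m \<le> real n" using assms by (simp_all add: frac_le)
  have pos: "r / real n + (1 - r) > 0" "r + (1 - r) / real n > 0"
    using scalar_parallel_denominator_pos[of "1 / real n" r] scalar_parallel_denominator_pos[of "real n" r] n r
    by (simp_all add: field_simps)
  have "r / real n \<le> r / real m" "(1 - r) / real n \<le> (1 - r) / real m"
    using assms r by (auto intro!: divide_left_mono)
  then have "(2 * r - 1)\<^sup>2 / (r / real m + (1 - r)) \<le> (2 * r - 1)\<^sup>2 / (r / real n + (1 - r))"
    "(2 * r - 1)\<^sup>2 / (r + (1 - r) / real m) \<le> (2 * r - 1)\<^sup>2 / (r + (1 - r) / real n)"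
    using pos by (auto intro!: divide_left_mono mult_pos_pos)
  note h = this
  have "c * ((2 * r - 1)\<^sup>2 / (r / real m + (1 - r))) \<le> c * ((2 * r - 1)\<^sup>2 / (r / real n + (1 - r)))"
    "d * ((2 * r - 1)\<^sup>2 / (r + (1 - r) / real m)) \<le> d * ((2 * r - 1)\<^sup>2 / (r + (1 - r) / real n))"
    by (rule mult_left_mono[OF h(1) c], rule mult_left_mono[OF h(2) d])
  moreover have "(\<integral>\<^sup>+l. indicator {1 / real m..real m} l * ennreal (persp_kernel l r) \<partial>\<mu>) \<le>
      (\<integral>\<^sup>+l. indicator {1 / real n..real n} l * ennreal (persp_kernel l r) \<partial>\<mu>)"
    using inv by (intro nn_integral_mono mult_right_mono) (auto simp: indicator_def)
  ultimately show ?thesis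
    unfolding Phi_eq[OF assms(1) r] Phi_eq[OF n r] by (intro add_mono ennreal_leI)
qed

section \<open>The limit of the approximants and its endpoint values\<close>

definition Phi_sup :: "real \<Rightarrow> ennreal"
  where "Phi_sup r = (SUP n. Phi (Suc n) r)"

lemma Phi_tendsto:
  assumes "r \<in> {0..1}"
  shows "(\<lambda>n. Phi (Suc n) r) \<longlonglongrightarrow> Phi_sup r"
  unfolding Phi_sup_def by (rule LIMSEQ_SUP) (auto simp: incseq_def intro!: Phi_mono[OF _ _ assms])

definition affine_part :: "real \<Rightarrow> real"
  where "affine_part r = a * (1 - r) + b * (2 * r - 1)"

lemma Phi_sup_interior:
  assumes r: "0 < r" "r < 1"
  shows "ereal (affine_part r) + enn2ereal (Phi_sup r) = ereal ((1 - r) * f (r / (1 - r)))"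
proof -
  define s where "s = 1 - r"
  have s: "s > 0" "s = 1 - r" using r by (simp_all add: s_def)
  have r01: "r \<in> {0..1}" using r by simp
  let ?q = "(2 * r - 1)\<^sup>2"
  note nn = persp_kernel_nonneg[OF _ r01]
  have km: "(\<lambda>l. persp_kernel l r) \<in> borel_measurable \<mu>" by (intro measurable_mu) measurable
  have kint: "integrable \<mu> (\<lambda>l. persp_kernel l r)"
  proof (rule integrableI_bounded[OF km])
    \<comment> \<open>\<open>r + l (1 - r)\<close> is at least \<open>e (1 + l)\<close>, so the
      kernel is dominated by a multiple of \<open>1 / (1 + l)\<close>.\<close>
    define e where "e = min r s"
    have e: "e > 0" using r s by (simp add: e_def)
    have "(\<integral>\<^sup>+l. ennreal (norm (persp_kernel l r)) \<partial>\<mu>) \<le> (\<integral>\<^sup>+l. ennreal (1 / e) * ennreal (1 / (1 + l)) \<partial>\<mu>)"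
    proof (rule nn_integral_mono)
      fix l assume "l \<in> space \<mu>"
      then have l: "l > 0" by (simp add: space_mu)
      have "e * (1 + l) \<le> r + l * s"
        using l mult_left_mono[of e s l] by (simp add: e_def algebra_simps add_mono)
      moreover have "?q \<le> 1" using r by (simp add: abs_square_le_1 abs_le_iff)
      ultimately have "?q / (r + l * s) \<le> 1 / (e * (1 + l))"
        using e l by (intro frac_le) auto
      then show "ennreal (norm (persp_kernel l r)) \<le> ennreal (1 / e) * ennreal (1 / (1 + l))"
        using e l unfolding real_norm_def abs_of_nonneg[OF nn[OF l]]
        by (simp add: persp_kernel_def s(2) ennreal_mult[symmetric] ennreal_leI)
    qed
    also have "\<dots> = ennreal (1 / e) * (\<integral>\<^sup>+l. ennreal (1 / (1 + l)) \<partial>\<mu>)"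
      by (rule nn_integral_cmult) (intro measurable_mu, measurable)
    also have "\<dots> < \<infinity>" using finite_mu by (simp add: ennreal_mult_less_top)
    finally show "(\<integral>\<^sup>+l. ennreal (norm (persp_kernel l r)) \<partial>\<mu>) < \<infinity>" .
  qed
  define I where "I = (\<integral>l. persp_kernel l r \<partial>\<mu>)"
  have I: "(\<integral>\<^sup>+l. ennreal (persp_kernel l r) \<partial>\<mu>) = ennreal I" "I \<ge> 0"
    unfolding I_def using nn space_mu
    by (auto intro!: nn_integral_eq_integral kint integral_nonneg_AE AE_I2)
  have inv0: "(\<lambda>n. 1 / real (Suc n)) \<longlonglongrightarrow> 0" by (rule lim_inverse_n'[THEN LIMSEQ_Suc])
  have l1: "(\<lambda>n. c * (?q / (r / real (Suc n) + (1 - r)))) \<longlonglongrightarrow> c * (?q / (r * 0 + (1 - r)))"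
    using tendsto_mult_left[OF inv0, of r] s by (intro tendsto_intros) auto
  have l2: "(\<lambda>n. d * (?q / (r + (1 - r) / real (Suc n)))) \<longlonglongrightarrow> d * (?q / (r + (1 - r) * 0))"
    using tendsto_mult_left[OF inv0, of "1 - r"] r by (intro tendsto_intros) auto
  have l3: "(\<lambda>n. \<integral>\<^sup>+l. indicator {1 / real (Suc n)..real (Suc n)} l * ennreal (persp_kernel l r) \<partial>\<mu>)
      \<longlonglongrightarrow> (\<integral>\<^sup>+l. indicator {0<..} l * ennreal (persp_kernel l r) \<partial>\<mu>)"
  proof (rule nn_integral_LIMSEQ)
    have i: "1 / real (Suc n) \<le> 1 / real (Suc m)" if "m \<le> n" for m n using that by (simp add: frac_le)
    have "{1 / real (Suc m)..real (Suc m)} \<subseteq> {1 / real (Suc n)..real (Suc n)}" if "m \<le> n" for m n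
      using i[OF that] that by auto
    note sub = this
    show "incseq (\<lambda>n l. indicator {1 / real (Suc n)..real (Suc n)} l * ennreal (persp_kernel l r))"
      unfolding incseq_def le_fun_def
      by (intro allI impI mult_right_mono indicator_leI) (rule subsetD[OF sub], assumption+, simp)
    show "(\<lambda>l. indicator {1 / real (Suc n)..real (Suc n)} l * ennreal (persp_kernel l r)) \<in> borel_measurable \<mu>" for n
      by (intro measurable_mu) measurable
    show "(\<lambda>n. indicator {1 / real (Suc n)..real (Suc n)} l * ennreal (persp_kernel l r))
        \<longlonglongrightarrow> indicator {0<..} l * ennreal (persp_kernel l r)" for l
    proof (rule tendsto_eventually)
      show "\<forall>\<^sub>F n in sequentially. indicator {1 / real (Suc n)..real (Suc n)} l * ennreal (persp_kernel l r) =
          indicator {0<..} l * ennreal (persp_kernel l r)"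
      proof (cases "l > 0")
        case True
        obtain N where N: "real N > max l (1 / l)" using reals_Archimedean2 by blast
        show ?thesis using eventually_ge_at_top[of N]
        proof eventually_elim
          case (elim n)
          then have "real (Suc n) > l" "real (Suc n) > 1 / l" using N by auto
          then have "1 / real (Suc n) \<le> l" using True by (simp add: field_simps)
          then show ?case using \<open>real (Suc n) > l\<close> True by (simp add: indicator_def)
        qed
      next
        case False
        then have "\<not> 1 / real (Suc n) \<le> l" for n
          using pos_if_ge_inverse[of "Suc n" l] by auto
        then show ?thesis using False by (simp add: indicator_def)
      qed
    qed
  qed
  have "(\<integral>\<^sup>+l. indicator {0<..} l * ennreal (persp_kernel l r) \<partial>\<mu>) = ennreal I"
    unfolding I(1)[symmetric] by (rule nn_integral_cong) (simp add: space_mu)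
  with l3 have l3': "(\<lambda>n. \<integral>\<^sup>+l. indicator {1 / real (Suc n)..real (Suc n)} l * ennreal (persp_kernel l r) \<partial>\<mu>)
      \<longlonglongrightarrow> ennreal I" by simp
  have "(\<lambda>n. Phi (Suc n) r) \<longlonglongrightarrow> ennreal (c * (?q / s)) + ennreal (d * (?q / r)) + ennreal I"
    unfolding Phi_eq[OF zero_less_Suc r01]
    using l1 l2 by (intro tendsto_add l3' tendsto_ennrealI) (simp_all add: s(2))
  then have "Phi_sup r = ennreal (c * (?q / s)) + ennreal (d * (?q / r)) + ennreal I"
    using LIMSEQ_unique Phi_tendsto[OF r01] by blast
  also have "\<dots> = ennreal (c * (?q / s) + d * (?q / r) + I)"
    using c d I(2) r s by simp
  finally have P: "Phi_sup r = ennreal (c * (?q / s) + d * (?q / r) + I)" .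
  \<comment> \<open>At \<open>t = r / s\<close> the expression \<open>s (t - 1)^2 / (t + l)\<close>
    is the kernel, which links the limit to the representation of \<open>f\<close>.\<close>
  have "s * (\<integral>l. (r / s - 1)\<^sup>2 / (r / s + l) \<partial>\<mu>) = (\<integral>l. s * ((r / s - 1)\<^sup>2 / (r / s + l)) \<partial>\<mu>)"
    by (rule integral_mult_right_zero[symmetric])
  also have "\<dots> = I"
    unfolding I_def
  proof (rule Bochner_Integration.integral_cong[OF refl])
    fix l assume "l \<in> space \<mu>"
    then have l: "l > 0" by (simp add: space_mu)
    have D: "r + l * s > 0" using r s l by (simp add: add_pos_pos)
    have "r / s - 1 = (2 * r - 1) / s" using s by (simp add: field_simps)
    moreover have "r / s + l = (r + l * s) / s" using s by (simp add: add_divide_distrib)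
    ultimately have "s * ((r / s - 1)\<^sup>2 / (r / s + l)) = s * (((2 * r - 1) / s)\<^sup>2 / ((r + l * s) / s))" by simp
    also have "\<dots> = (2 * r - 1)\<^sup>2 / (r + l * s)"
      using s(1) D by (simp add: power_divide power2_eq_square)
    finally show "s * ((r / s - 1)\<^sup>2 / (r / s + l)) = persp_kernel l r"
      by (simp add: persp_kernel_def s(2))
  qed
  finally have sI: "s * (\<integral>l. (r / s - 1)\<^sup>2 / (r / s + l) \<partial>\<mu>) = I" .
  have t: "r / s > 0" using r s by simp
  have r1: "r / s - 1 = (2 * r - 1) / s" using s by (simp add: field_simps)
  have "s * f (r / s) = s * a + s * (b * (r / s - 1)) + s * (c * (r / s - 1)\<^sup>2) + s * (d * ((r / s - 1)\<^sup>2 / (r / s))) + I"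
    unfolding f_eq[OF t] by (simp add: distrib_left sI)
  also have "\<dots> = affine_part r + (c * (?q / s) + d * (?q / r) + I)"
    unfolding r1 using s(1) r by (simp add: affine_part_def s(2)[symmetric] power_divide power2_eq_square)
  finally have fs: "s * f (r / s) = affine_part r + (c * (?q / s) + d * (?q / r) + I)" .
  have "0 \<le> c * (?q / s) + d * (?q / r) + I" using c d I(2) r s by simp
  then show ?thesis unfolding P s(2)[symmetric] fs by simp
qed

text \<open>The perspective takes limits of \<open>f\<close> as its endpoint values, so continuity
  in [0, infinity] at 0 and 1 is required. From below, a single \<open>Phi n e\<close> is compared
  with \<open>Phi n (w t)\<close> through a factor \<open>\<rho>\<close> tending to 1; from above,
  the kernel near \<open>e\<close> is bounded by its value at \<open>e\<close>.\<close>

lemma Phi_sup_tendsto_endpoint: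
  assumes e: "e \<in> {0, 1}" and F: "F \<noteq> bot" "(w \<longlongrightarrow> e) F" "\<forall>\<^sub>F t in F. w t \<in> {0..1}"
  shows "((\<lambda>t. Phi_sup (w t)) \<longlongrightarrow> Phi_sup e) F"
proof (rule order_tendstoI)
  fix z assume "z < Phi_sup e"
  then obtain m where m: "z < Phi (Suc m) e" unfolding Phi_sup_def less_SUP_iff by blast
  define n where "n = Suc m"
  have n: "n > 0" "z < Phi n e" using m by (simp_all add: n_def)
  define \<rho> where "\<rho> r = (if e = 1 then (2 * r - 1)\<^sup>2 / (r + real n * (1 - r)) else (2 * r - 1)\<^sup>2 / (real n * r + (1 - r)))" for r
  have \<rho>: "\<rho> r * persp_kernel l e \<le> persp_kernel l r" if "r \<in> {0..1}" "l \<in> {1 / real n..real n}" for l r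
  proof -
    have l: "l > 0" using that n by (auto intro: pos_if_ge_inverse)
    show ?thesis
      using e persp_kernel_ge_at_one[OF l that(1), of "real n"] persp_kernel_ge_at_zero[OF l that(1), of "real n"] that(2) n
      by (auto simp: \<rho>_def)
  qed
  have low: "ennreal (\<rho> r) * Phi n e \<le> Phi n r" if r: "r \<in> {0..1}" for r
  proof -
    have "0 \<le> \<rho> r" using r n by (auto simp: \<rho>_def)
    have "ennreal (\<rho> r) * Phi n e = (\<integral>\<^sup>+t. ennreal (\<rho> r) * ennreal (t / (1 + t) * persp_kernel t e) \<partial>\<nu> n)"
      unfolding Phi_def by (rule nn_integral_cmult[symmetric]) (intro measurable_nu, measurable)
    also have "\<dots> \<le> Phi n r"
      unfolding Phi_def
    proof (rule nn_integral_mono_AE)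
      show "AE t in \<nu> n. ennreal (\<rho> r) * ennreal (t / (1 + t) * persp_kernel t e) \<le> ennreal (t / (1 + t) * persp_kernel t r)"
        using AE_nu[OF n(1)]
      proof eventually_elim
        case (elim t)
        have t: "t > 0" using elim n by (auto intro: pos_if_ge_inverse)
        have "t / (1 + t) * (\<rho> r * persp_kernel t e) \<le> t / (1 + t) * persp_kernel t r"
          using t by (intro mult_left_mono \<rho>[OF r elim]) auto
        moreover have "0 \<le> persp_kernel t e" using e t by (intro persp_kernel_nonneg) auto
        ultimately show ?case using \<open>0 \<le> \<rho> r\<close> t by (simp add: ennreal_mult[symmetric] ennreal_leI mult_ac)
      qed
    qed
    finally show ?thesis .
  qed
  have "(\<rho> \<longlongrightarrow> \<rho> e) (at e within UNIV)"
    using e n unfolding \<rho>_def[abs_def] by (auto intro!: tendsto_eq_intros)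
  moreover have "\<rho> e = 1" using e by (auto simp: \<rho>_def)
  ultimately have "isCont \<rho> e" by (simp add: isCont_def)
  then have "((\<lambda>t. \<rho> (w t)) \<longlongrightarrow> \<rho> e) F" by (rule isCont_tendsto_compose[OF _ F(2)])
  then have "((\<lambda>t. ennreal (\<rho> (w t)) * Phi n e) \<longlongrightarrow> ennreal 1 * Phi n e) F"
    unfolding \<open>\<rho> e = 1\<close> by (intro tendsto_mult_ennreal tendsto_ennrealI tendsto_const) simp_all
  then have "((\<lambda>t. ennreal (\<rho> (w t)) * Phi n e) \<longlongrightarrow> Phi n e) F" by simp
  from order_tendstoD(1)[OF this n(2)] F(3) show "\<forall>\<^sub>F t in F. z < Phi_sup (w t)"
  proof eventually_elim
    case (elim t)
    have "ennreal (\<rho> (w t)) * Phi n e \<le> Phi_sup (w t)"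
      using low[OF elim(2)] unfolding Phi_sup_def n_def
      by (rule order_trans) (rule SUP_upper[of m UNIV "\<lambda>n. Phi (Suc n) (w t)", OF UNIV_I])
    with elim(1) show ?case by simp
  qed
next
  fix z assume z: "Phi_sup e < z"
  have "\<forall>\<^sub>F t in F. \<bar>w t - e\<bar> < 1 / 2"
    using tendstoD[OF F(2), of "1 / 2"] by (simp add: dist_real_def)
  with F(3) show "\<forall>\<^sub>F t in F. Phi_sup (w t) < z"
  proof eventually_elim
    case (elim t)
    have "persp_kernel l (w t) \<le> persp_kernel l e" if "l > 0" for l
      using e elim persp_kernel_le_at_one[OF that elim(1)] persp_kernel_le_at_zero[OF that elim(1)]
      by (auto simp: abs_less_iff)
    then have "Phi n (w t) \<le> Phi n e" for n
      unfolding Phi_def by (intro nn_integral_mono ennreal_leI mult_left_mono) (auto simp: space_nu)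
    then have "Phi_sup (w t) \<le> Phi_sup e" unfolding Phi_sup_def by (rule SUP_mono')
    with z show ?case by simp
  qed
qed

lemma persp_eq:
  assumes r: "r \<in> {0..1}"
  shows "persp f r (1 - r) = ereal (affine_part r) + enn2ereal (Phi_sup r)"
proof -
  define G where "G r = ereal (affine_part r) + enn2ereal (Phi_sup r)" for r
  have G: "((\<lambda>t. G (w t)) \<longlongrightarrow> G e) F"
    if "e \<in> {0, 1}" "F \<noteq> bot" "(w \<longlongrightarrow> e) F" "\<forall>\<^sub>F t in F. w t \<in> {0..1}" for e w and F :: "real filter"
    unfolding G_def
  proof (rule tendsto_add_ereal_nonneg)
    show "((\<lambda>t. ereal (affine_part (w t))) \<longlongrightarrow> ereal (affine_part e)) F"
      unfolding affine_part_def by (intro tendsto_intros that)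
    show "((\<lambda>t. enn2ereal (Phi_sup (w t))) \<longlongrightarrow> enn2ereal (Phi_sup e)) F"
      using Phi_sup_tendsto_endpoint[OF that] by simp
    show "enn2ereal (Phi_sup e) \<noteq> - \<infinity>" using enn2ereal_nonneg[of "Phi_sup e"] by auto
  qed simp
  \<comment> \<open>\<open>w t\<close> and \<open>1 - w t\<close> have ratio \<open>t\<close>, so
    \<open>t\<close> tending to infinity or to 0 reaches the endpoint 1 or 0. There
    \<open>G (w t)\<close> differs from \<open>f t / t\<close>, respectively \<open>f t\<close>, by
    a factor tending to 1.\<close>
  define w where "w t = t / (1 + t)" for t :: real
  have w: "0 < w t" "w t < 1" "1 - w t = 1 / (1 + t)" "w t / (1 - w t) = t" if "t > 0" for t
    using that by (auto simp: w_def field_simps)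
  have Gw: "G (w t) = ereal (f t / (1 + t))" if "t > 0" for t
  proof -
    have "G (w t) = ereal ((1 - w t) * f (w t / (1 - w t)))"
      unfolding G_def by (rule Phi_sup_interior[OF w(1,2)[OF that]])
    also have "\<dots> = ereal ((1 - w t) * f t)" by (simp only: w(4)[OF that])
    finally show ?thesis by (simp add: w(3)[OF that])
  qed
  have one: "slope_at_infinity f = G 1"
    unfolding slope_at_infinity_def
  proof (rule tendsto_Lim)
    have "(w \<longlongrightarrow> 1) at_top" unfolding w_def[abs_def] by real_asymp
    moreover have "\<forall>\<^sub>F t in at_top. w t \<in> {0..1}"
      using eventually_gt_at_top[of 0] by eventually_elim (use w in \<open>auto intro: less_imp_le\<close>)
    ultimately have "((\<lambda>t. G (w t)) \<longlongrightarrow> G 1) at_top" by (intro G) auto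
    moreover have "((\<lambda>t. ereal ((1 + t) / t)) \<longlongrightarrow> ereal 1) at_top"
      by (intro tendsto_ereal) real_asymp
    ultimately have "((\<lambda>t. G (w t) * ereal ((1 + t) / t)) \<longlongrightarrow> G 1 * ereal 1) at_top"
      by (intro tendsto_mult_ereal) auto
    then have "((\<lambda>t. G (w t) * ereal ((1 + t) / t)) \<longlongrightarrow> G 1) at_top" by simp
    then show "((\<lambda>t. ereal (f t / t)) \<longlongrightarrow> G 1) at_top"
    proof (rule Lim_transform_eventually)
      show "\<forall>\<^sub>F t in at_top. G (w t) * ereal ((1 + t) / t) = ereal (f t / t)"
        using eventually_gt_at_top[of 0] by eventually_elim (simp add: Gw)
    qed
  qed simp
  have zero: "limit_at_zero f = G 0"
    unfolding limit_at_zero_def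
  proof (rule tendsto_Lim)
    have "(w \<longlongrightarrow> 0) (at_right 0)" unfolding w_def[abs_def] by real_asymp
    moreover have "\<forall>\<^sub>F t in at_right 0. w t \<in> {0..1}"
      using eventually_at_right_less[of 0] by eventually_elim (use w in \<open>auto intro: less_imp_le\<close>)
    ultimately have "((\<lambda>t. G (w t)) \<longlongrightarrow> G 0) (at_right 0)" by (intro G) auto
    moreover have "((\<lambda>t. ereal (1 + t)) \<longlongrightarrow> ereal 1) (at_right 0)"
      by (intro tendsto_ereal) real_asymp
    ultimately have "((\<lambda>t. G (w t) * ereal (1 + t)) \<longlongrightarrow> G 0 * ereal 1) (at_right 0)"
      by (intro tendsto_mult_ereal) auto
    then have "((\<lambda>t. G (w t) * ereal (1 + t)) \<longlongrightarrow> G 0) (at_right 0)" by simp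
    then show "((\<lambda>t. ereal (f t)) \<longlongrightarrow> G 0) (at_right 0)"
    proof (rule Lim_transform_eventually)
      show "\<forall>\<^sub>F t in at_right 0. G (w t) * ereal (1 + t) = ereal (f t)"
        using eventually_at_right_less[of 0] by eventually_elim (simp add: Gw)
    qed
  qed simp
  consider "r = 0" | "r = 1" | "0 < r" "r < 1" using r by force
  then show ?thesis
  proof cases
    case 1
    then show ?thesis by (simp add: persp_def zero G_def one_ereal_def[symmetric])
  next
    case 2
    then show ?thesis by (simp add: persp_def one G_def one_ereal_def[symmetric])
  next
    case 3
    then show ?thesis by (simp add: persp_def Phi_sup_interior)
  qed
qed

end

section \<open>The variational expression\<close>

lemma bounded_borel_01_ident: "bounded_borel_01 (\<lambda>r. r)"
  by (intro bounded_borel_01_continuous) auto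

text \<open>As \<psi> may be infinite on a set of positive measure, the parts are compared by
  \<open>F^+ + g^- = F^- + g^+ + \<psi>\<close>, which is free of subtraction. Since
  \<open>F^- \<le> g^-\<close> has finite integral, the integrated identity can be solved for the
  difference.\<close>

lemma integral_affine_plus_nonneg:
  fixes g :: "real \<Rightarrow> real" and \<psi> :: "real \<Rightarrow> ennreal"
  assumes M: "finite_measure_01 M" and g: "bounded_borel_01 g" and \<psi>: "\<psi> \<in> borel_measurable borel"
    and F: "\<And>r. r \<in> {0..1} \<Longrightarrow> F r = ereal (g r) + enn2ereal (\<psi> r)"
  shows "enn2ereal (\<integral>\<^sup>+r\<in>{0..1}. e2ennreal (F r) \<partial>M) - enn2ereal (\<integral>\<^sup>+r\<in>{0..1}. e2ennreal (- F r) \<partial>M) =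
    ereal (\<integral>r. g r \<partial>M) + enn2ereal (\<integral>\<^sup>+r. \<psi> r \<partial>M)"
proof -
  note sM = finite_measure_01D(2)[OF M] and AE = finite_measure_01D(4)[OF M]
  define G where "G r = ereal (g r) + enn2ereal (\<psi> r)" for r
  have gm[measurable]: "g \<in> borel_measurable M" and pm[measurable]: "\<psi> \<in> borel_measurable M"
    using g \<psi> by (simp_all add: bounded_borel_01_def measurable_cong_sets[OF sM refl])
  have Gm[measurable]: "G \<in> borel_measurable M" unfolding G_def[abs_def] by measurable
  have mG: "(\<lambda>r. e2ennreal (G r)) \<in> borel_measurable M" "(\<lambda>r. e2ennreal (- G r)) \<in> borel_measurable M"
    "(\<lambda>r. ennreal (g r)) \<in> borel_measurable M" "(\<lambda>r. ennreal (- g r)) \<in> borel_measurable M"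
    by measurable
  define X Y where "X = (\<integral>\<^sup>+r. e2ennreal (G r) \<partial>M)" and "Y = (\<integral>\<^sup>+r. e2ennreal (- G r) \<partial>M)"
  define P N Z where "P = (\<integral>\<^sup>+r. ennreal (g r) \<partial>M)" and "N = (\<integral>\<^sup>+r. ennreal (- g r) \<partial>M)"
    and "Z = (\<integral>\<^sup>+r. \<psi> r \<partial>M)"
  have X: "(\<integral>\<^sup>+r\<in>{0..1}. e2ennreal (F r) \<partial>M) = X"
    unfolding X_def by (rule nn_integral_cong_AE, rule AE_mp[OF AE], rule AE_I2) (simp add: F G_def)
  have Y: "(\<integral>\<^sup>+r\<in>{0..1}. e2ennreal (- F r) \<partial>M) = Y"
    unfolding Y_def by (rule nn_integral_cong_AE, rule AE_mp[OF AE], rule AE_I2) (simp add: F G_def)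
  have pt: "e2ennreal (G r) + ennreal (- g r) = e2ennreal (- G r) + ennreal (g r) + \<psi> r"
    and ptN: "e2ennreal (- G r) \<le> ennreal (- g r)" for r
  proof -
    have "e2ennreal (G r) + ennreal (- g r) = e2ennreal (- G r) + ennreal (g r) + \<psi> r \<and>
        e2ennreal (- G r) \<le> ennreal (- g r)"
    proof (cases "\<psi> r")
      case (real p)
      have Gp: "G r = ereal (g r + p)" using real by (simp add: G_def)
      \<comment> \<open>\<open>ennreal\<close> truncates negative reals to 0; writing the truncation
        as \<open>max 0\<close> returns the identity to real arithmetic.\<close>
      have e: "ennreal x = ennreal (max 0 x)" for x by (cases "x \<ge> 0") (auto simp: ennreal_neg)
      have "max 0 (g r + p) + max 0 (- g r) = max 0 (- (g r + p)) + max 0 (g r) + p"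
        using real by (simp add: max_def)
      then have "ennreal (max 0 (g r + p) + max 0 (- g r)) = ennreal (max 0 (- (g r + p)) + max 0 (g r) + p)"
        by (rule arg_cong)
      then have "ennreal (g r + p) + ennreal (- g r) = ennreal (- (g r + p)) + ennreal (g r) + ennreal p"
        using real by (subst e[of "g r + p"], subst e[of "- g r"], subst e[of "- (g r + p)"], subst e[of "g r"])
          (simp del: max_def)
      moreover have "ennreal (- (g r + p)) \<le> ennreal (- g r)" using real by (intro ennreal_leI) simp
      ultimately show ?thesis unfolding Gp uminus_ereal.simps e2ennreal_ereal real(2) by blast
    next
      case top
      then have "G r = \<infinity>" by (simp add: G_def)
      then show ?thesis using top by (simp add: e2ennreal_neg)
    qed
    then show "e2ennreal (G r) + ennreal (- g r) = e2ennreal (- G r) + ennreal (g r) + \<psi> r"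
      "e2ennreal (- G r) \<le> ennreal (- g r)" by auto
  qed
  have sum: "X + N = Y + P + Z"
    unfolding X_def N_def Y_def P_def Z_def
    by (simp only: nn_integral_add[symmetric] mG borel_measurable_add pm pt)
  have int: "integrable M g" by (rule integrable_bounded_borel_01[OF M g])
  then have fin: "P \<noteq> \<infinity>" "N \<noteq> \<infinity>" unfolding P_def N_def real_integrable_def by auto
  have "Y \<le> N" unfolding Y_def N_def by (intro nn_integral_mono ptN)
  with fin have "Y \<noteq> \<infinity>" by (auto simp: top_unique)
  have I: "(\<integral>r. g r \<partial>M) = enn2real P - enn2real N"
    unfolding P_def N_def by (rule real_lebesgue_integral_def[OF int])
  obtain p where p: "P = ennreal p" "p \<ge> 0" using fin(1) by (cases P) auto
  obtain k where k: "N = ennreal k" "k \<ge> 0" using fin(2) by (cases N) auto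
  obtain y where y: "Y = ennreal y" "y \<ge> 0" using \<open>Y \<noteq> \<infinity>\<close> by (cases Y) auto
  show ?thesis
  proof (cases Z)
    case (real z)
    have XN: "X + ennreal k = ennreal (y + p + z)" using sum real p k y by simp
    then have "X \<noteq> \<infinity>" by auto
    then obtain x where x: "X = ennreal x" "x \<ge> 0" by (cases X) auto
    have "ennreal (x + k) = ennreal (y + p + z)" using XN x k by simp
    then have "x + k = y + p + z" using x k y p real by (subst (asm) ennreal_inj) auto
    then show ?thesis
      unfolding X Y I Z_def[symmetric] using x y p k real by simp
  next
    case top
    then have "X + ennreal k = \<infinity>" using sum k by simp
    then have "X = \<infinity>" by auto
    then show ?thesis unfolding X Y I Z_def[symmetric] using top y by simp
  qed
qed

section \<open>Piecewise constant functions\<close>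

lemma piecewise_constant_borel:
  fixes \<phi> :: "'b \<Rightarrow> real"
  assumes "piecewise_constant_on p q \<eta>"
  shows "(\<lambda>t. indicator {p..q} t * \<phi> (\<eta> t)) \<in> borel_measurable borel"
    and "\<exists>C. \<forall>t. \<bar>indicator {p..q} t * \<phi> (\<eta> t)\<bar> \<le> C"
proof -
  obtain J where J: "finite J" "partition_on {p..q} J"
    "\<And>I. I \<in> J \<Longrightarrow> is_interval I" "\<And>I. I \<in> J \<Longrightarrow> \<eta> constant_on I"
    using assms unfolding piecewise_constant_on_def by auto
  from J(4) obtain v where v: "\<And>I t. I \<in> J \<Longrightarrow> t \<in> I \<Longrightarrow> \<eta> t = v I"
    unfolding constant_on_def by metis
  have eq: "indicator {p..q} t * \<phi> (\<eta> t) = (\<Sum>I\<in>J. indicator I t * \<phi> (v I))" for t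
  proof (cases "t \<in> {p..q}")
    case True
    then obtain I\<^sub>0 where I0: "I\<^sub>0 \<in> J" "t \<in> I\<^sub>0" using partition_onD1[OF J(2)] by auto
    have "(\<Sum>I\<in>J. indicator I t * \<phi> (v I)) = (\<Sum>I\<in>J. if I = I\<^sub>0 then \<phi> (v I\<^sub>0) else 0)"
    proof (rule sum.cong[OF refl])
      fix I assume I: "I \<in> J"
      have "I = I\<^sub>0" if "t \<in> I"
        using disjointD[OF partition_onD2[OF J(2)] I I0(1)] that I0(2) by auto
      then have "t \<notin> I" if "I \<noteq> I\<^sub>0" using that by blast
      then show "indicator I t * \<phi> (v I) = (if I = I\<^sub>0 then \<phi> (v I\<^sub>0) else 0)"
        using I0(2) by (cases "I = I\<^sub>0") simp_all
    qed
    also have "\<dots> = \<phi> (\<eta> t)" using J(1) I0(1) by (simp add: v[OF I0])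
    finally show ?thesis using True by simp
  next
    case False
    then have "\<And>I. I \<in> J \<Longrightarrow> t \<notin> I" using partition_onD1[OF J(2)] by auto
    then show ?thesis using False by simp
  qed
  show "(\<lambda>t. indicator {p..q} t * \<phi> (\<eta> t)) \<in> borel_measurable borel"
    unfolding eq
    by (intro borel_measurable_sum borel_measurable_times borel_measurable_indicator borel_measurable_const
        real_interval_borel_measurable J(3))
  have "\<bar>indicator {p..q} t * \<phi> (\<eta> t)\<bar> \<le> (\<Sum>I\<in>J. \<bar>\<phi> (v I)\<bar>)" for t
    unfolding eq by (rule order_trans[OF sum_abs]) (intro sum_mono, simp add: abs_mult indicator_def)
  then show "\<exists>C. \<forall>t. \<bar>indicator {p..q} t * \<phi> (\<eta> t)\<bar> \<le> C" by blast
qed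

text \<open>The floor index is monotone in \<open>t\<close>, so its level sets are
  intervals.\<close>

lemma piecewise_constant_step:
  assumes w: "w > 0"
  shows "piecewise_constant_on p q (\<lambda>t. G (nat \<lfloor>(t - p) / w\<rfloor>))"
proof -
  define i where "i t = nat \<lfloor>(t - p) / w\<rfloor>" for t
  have mono: "i s \<le> i t" if "s \<le> t" for s t
    unfolding i_def using that w by (intro nat_mono floor_mono divide_right_mono) auto
  define C where "C j = {t \<in> {p..q}. i t = j}" for j
  \<comment> \<open>The empty level set is removed because \<open>partition_on\<close> excludes
    it.\<close>
  define J where "J = C ` {..i q} - {{}}"
  have "partition_on {p..q} J"
  proof (rule partition_onI)
    have "t \<in> \<Union> J" if t: "t \<in> {p..q}" for t
    proof -
      have "i t \<le> i q" using t by (intro mono) simp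
      then have "C (i t) \<in> C ` {..i q}" by simp
      moreover have "t \<in> C (i t)" using t by (simp add: C_def)
      ultimately show ?thesis unfolding J_def by blast
    qed
    moreover have "\<Union> J \<subseteq> {p..q}" unfolding J_def C_def by blast
    ultimately show "\<Union> J = {p..q}" by blast
    show "disjnt I I'" if "I \<in> J" "I' \<in> J" "I \<noteq> I'" for I I'
      using that by (auto simp: J_def C_def disjnt_def)
  qed (auto simp: J_def)
  moreover have "is_interval I" if IJ: "I \<in> J" for I
  proof -
    obtain j where I: "I = C j" using IJ unfolding J_def by blast
    have "i x = j" if "s \<le> x" "x \<le> t" "i s = j" "i t = j" for s t x
      using mono[OF that(1)] mono[OF that(2)] that(3,4) by simp
    then show ?thesis unfolding is_interval_1 I C_def by auto
  qed
  moreover have "(\<lambda>t. G (i t)) constant_on I" if "I \<in> J" for I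
    using that by (auto simp: J_def C_def constant_on_def)
  moreover have "finite J" by (simp add: J_def)
  ultimately show ?thesis unfolding piecewise_constant_on_def i_def[symmetric] by blast
qed

section \<open>The coefficients as integrals against \<open>nu_n\<close>\<close>

context perspective_data
begin

lemma integrable_nu:
  fixes h :: "real \<Rightarrow> real"
  assumes n: "n > 0" and h: "h \<in> borel_measurable borel"
    and B: "\<And>t. t \<in> {1 / real n..real n} \<Longrightarrow> \<bar>h t\<bar> \<le> B"
  shows "integrable (\<nu> n) h"
proof (rule finite_measure.integrable_const_bound[OF finite_nu[OF n]])
  show "AE t in \<nu> n. norm (h t) \<le> B"
    using AE_nu[OF n] by eventually_elim (use B in auto)
qed (rule measurable_nu[OF h])

lemma integral_nu_mono:
  fixes h h' :: "real \<Rightarrow> real"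
  assumes n: "n > 0" and "integrable (\<nu> n) h" "integrable (\<nu> n) h'"
    and le: "\<And>t. t \<in> {1 / real n..real n} \<Longrightarrow> h t \<le> h' t"
  shows "integral\<^sup>L (\<nu> n) h \<le> integral\<^sup>L (\<nu> n) h'"
proof (rule integral_mono_AE[OF assms(2,3)])
  show "AE t in \<nu> n. h t \<le> h' t" using AE_nu[OF n] by eventually_elim (rule le)
qed

lemma interval_bounds:
  assumes n: "n > 0" and t: "t \<in> {1 / real n..real n}"
  shows "t > 0" "\<bar>t / (1 + t)\<bar> \<le> 1" "\<bar>1 / (1 + t)\<bar> \<le> 1" "0 \<le> (1 + t) / t" "(1 + t) / t \<le> 1 + real n"
proof -
  show t0: "t > 0" using pos_if_ge_inverse[OF n] t by auto
  then show "\<bar>t / (1 + t)\<bar> \<le> 1" "\<bar>1 / (1 + t)\<bar> \<le> 1" "0 \<le> (1 + t) / t" by auto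
  have "1 \<le> real n * t" using t n by (simp add: field_simps)
  then show "(1 + t) / t \<le> 1 + real n" using t0 by (simp add: field_simps)
qed

lemma integrable_nu_weights:
  assumes n: "n > 0"
  shows "integrable (\<nu> n) (\<lambda>t. t / (1 + t))" "integrable (\<nu> n) (\<lambda>t. 1 / (1 + t))"
    "integrable (\<nu> n) (\<lambda>t. (1 + t) / t)"
proof -
  show "integrable (\<nu> n) (\<lambda>t. t / (1 + t))"
    by (rule integrable_nu[OF n _ interval_bounds(2)[OF n]]) measurable
  show "integrable (\<nu> n) (\<lambda>t. 1 / (1 + t))"
    by (rule integrable_nu[OF n _ interval_bounds(3)[OF n]]) measurable
  show "integrable (\<nu> n) (\<lambda>t. (1 + t) / t)"
  proof (rule integrable_nu[OF n])
    show "\<bar>(1 + t) / t\<bar> \<le> 1 + real n" if "t \<in> {1 / real n..real n}" for t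
      unfolding abs_of_nonneg[OF interval_bounds(4)[OF n that]] by (rule interval_bounds(5)[OF n that])
  qed measurable
qed

text \<open>The origin of \<open>alpha_n\<close>: the coefficient of \<open>r\<close> in the affine
  part plus the integral of its coefficient \<open>t / (1 + t)\<close> in the kernel decomposition.
  The atoms contribute \<open>n c\<close> and \<open>d\<close>; for \<open>beta_n\<close>, with
  weight \<open>1 / (1 + t)\<close>, they contribute \<open>c\<close> and
  \<open>n d\<close>.\<close>

lemma alpha_n_eq:
  assumes n: "n > 0"
  shows "alpha_n b c d \<mu> n = b + (\<integral>t. t / (1 + t) \<partial>\<nu> n)"
proof -
  have m: "{1 / real n..real n} \<in> sets \<mu>"
    using measurable_sets[OF measurable_mu[OF measurable_ident], of "{1 / real n..real n}"] pos_if_ge_inverse[OF n]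
    by (auto simp: space_mu Int_absorb2 subset_eq)
  have "(\<integral>\<^sup>+l. nu_density n l * ennreal (l / (1 + l)) \<partial>\<mu>) = (\<integral>\<^sup>+l. indicator {1 / real n..real n} l \<partial>\<mu>)"
    by (rule nn_integral_cong) (auto simp: nu_density_def indicator_def space_mu ennreal_mult[symmetric])
  also have "\<dots> = ennreal (measure \<mu> {1 / real n..real n})"
    using nn_integral_mu_interval_finite[OF n] m by (simp add: emeasure_eq_ennreal_measure)
  finally have 3: "(\<integral>\<^sup>+l. nu_density n l * ennreal (l / (1 + l)) \<partial>\<mu>) = ennreal (measure \<mu> {1 / real n..real n})" .
  have 1: "ennreal ((1 + real n) * c) * ennreal (real n / (1 + real n)) = ennreal (real n * c)"
    using c by (simp add: ennreal_mult[symmetric] add_nonneg_eq_0_iff)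
  have "(1 / real n) / (1 + 1 / real n) = 1 / (1 + real n)" using n by (simp add: field_simps)
  then have 2: "ennreal ((1 + real n) * d) * ennreal ((1 / real n) / (1 + 1 / real n)) = ennreal d"
    using d by (simp add: ennreal_mult[symmetric] add_nonneg_eq_0_iff)
  have "(\<integral>\<^sup>+t. ennreal (t / (1 + t)) \<partial>\<nu> n) = ennreal (real n * c + d + measure \<mu> {1 / real n..real n})"
    by (subst nn_integral_nu[OF n measurable_mu]) (use c d in \<open>simp_all only: 1 2 3, simp_all\<close>)
  moreover have "(\<integral>t. t / (1 + t) \<partial>\<nu> n) = enn2real (\<integral>\<^sup>+t. ennreal (t / (1 + t)) \<partial>\<nu> n)"
    by (intro integral_eq_nn_integral measurable_nu AE_I2) (auto simp: space_nu)
  ultimately have "(\<integral>t. t / (1 + t) \<partial>\<nu> n) = real n * c + d + measure \<mu> {1 / real n..real n}"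
    using c d by (simp del: ennreal_plus)
  then show ?thesis by (simp add: alpha_n_def)
qed

lemma beta_n_eq:
  assumes n: "n > 0"
  shows "beta_n a b c d \<mu> n = a - b + (\<integral>t. 1 / (1 + t) \<partial>\<nu> n)"
proof -
  let ?S = "{1 / real n..real n}"
  have "(\<integral>\<^sup>+l. nu_density n l * ennreal (1 / (1 + l)) \<partial>\<mu>) = (\<integral>\<^sup>+l. ennreal (indicator ?S l *\<^sub>R (1 / l)) \<partial>\<mu>)"
    by (rule nn_integral_cong) (auto simp: nu_density_def indicator_def space_mu ennreal_mult[symmetric])
  moreover have "(\<integral>l. indicator ?S l *\<^sub>R (1 / l) \<partial>\<mu>) = enn2real (\<integral>\<^sup>+l. ennreal (indicator ?S l *\<^sub>R (1 / l)) \<partial>\<mu>)"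
    by (intro integral_eq_nn_integral measurable_mu AE_I2) (auto simp: space_mu)
  \<comment> \<open>The Bochner integral is recovered through \<open>enn2real\<close>, which sends
    infinity to 0, so finiteness has to be checked.\<close>
  moreover have "(\<integral>\<^sup>+l. nu_density n l * ennreal (1 / (1 + l)) \<partial>\<mu>) < \<infinity>"
  proof -
    have "(\<integral>\<^sup>+l. nu_density n l * ennreal (1 / (1 + l)) \<partial>\<mu>) \<le> (\<integral>\<^sup>+t. ennreal (1 / (1 + t)) \<partial>\<nu> n)"
      by (subst nn_integral_nu[OF n measurable_mu]) simp_all
    also have "\<dots> < \<infinity>"
      using integrable_nu_weights(2)[OF n] unfolding real_integrable_def by (simp add: less_top)
    finally show ?thesis .
  qed
  ultimately have 3: "(\<integral>\<^sup>+l. nu_density n l * ennreal (1 / (1 + l)) \<partial>\<mu>) = ennreal (LINT l:?S|\<mu>. 1 / l)"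
    unfolding set_lebesgue_integral_def by (simp add: ennreal_enn2real_if less_top)
  have nn: "0 \<le> (LINT l:?S|\<mu>. 1 / l)"
    unfolding set_lebesgue_integral_def by (intro integral_nonneg_AE AE_I2) (auto simp: space_mu)
  have 1: "ennreal ((1 + real n) * c) * ennreal (1 / (1 + real n)) = ennreal c"
    using c by (simp add: ennreal_mult[symmetric] add_nonneg_eq_0_iff)
  have "1 / (1 + 1 / real n) = real n / (1 + real n)" using n by (simp add: field_simps)
  then have 2: "ennreal ((1 + real n) * d) * ennreal (1 / (1 + 1 / real n)) = ennreal (real n * d)"
    using d by (simp add: ennreal_mult[symmetric] add_nonneg_eq_0_iff)
  have "(\<integral>\<^sup>+t. ennreal (1 / (1 + t)) \<partial>\<nu> n) = ennreal (c + real n * d + (LINT l:?S|\<mu>. 1 / l))"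
    by (subst nn_integral_nu[OF n measurable_mu]) (use c d nn in \<open>simp_all only: 1 2 3, simp_all\<close>)
  moreover have "(\<integral>t. 1 / (1 + t) \<partial>\<nu> n) = enn2real (\<integral>\<^sup>+t. ennreal (1 / (1 + t)) \<partial>\<nu> n)"
    by (intro integral_eq_nn_integral measurable_nu AE_I2) (auto simp: space_nu)
  ultimately have "(\<integral>t. 1 / (1 + t) \<partial>\<nu> n) = c + real n * d + (LINT l:?S|\<mu>. 1 / l)"
    using c d nn by (simp del: ennreal_plus)
  then show ?thesis by (simp add: beta_n_def)
qed

end

section \<open>Evaluation of the perspective as a supremum\<close>

locale perspective_setting = positive_op_pair A B + perspective_data f a b c d \<mu>
  for A B :: "'a::complex_hilbert \<Rightarrow> 'a" and f a b c d \<mu> +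
  fixes \<xi> :: 'a
begin

abbreviation "m \<equiv> persp_measure A B (vector_functional \<xi>)"

text \<open>By \<open>parallel_sum_lower\<close> and \<open>parallel_sum_attained\<close> this is
  the quadratic form at \<xi> of the parallel sum of \<open>A\<close> and
  \<open>t B\<close>.\<close>

definition par :: "real \<Rightarrow> real"
  where "par t = (\<integral>r. scalar_parallel t r \<partial>m)"

abbreviation "par_integral n \<equiv> \<integral>t. (1 + t) / t * par t \<partial>\<nu> n"

lemmas m01 = persp_measure_01[of \<xi>]

lemma par_measurable [measurable]: "par \<in> borel_measurable borel"
proof -
  interpret finite_measure m by (rule finite_measure_01D(1)[OF m01])
  have [measurable]: "(\<lambda>x. snd x) \<in> borel_measurable (borel \<Otimes>\<^sub>M m)"
    using measurable_snd[of borel m] by (simp add: measurable_cong_sets[OF refl finite_measure_01D(2)[OF m01]])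
  have "(\<lambda>(t, r). scalar_parallel t r) \<in> borel_measurable (borel \<Otimes>\<^sub>M m)"
    unfolding scalar_parallel_def split_beta' by measurable
  then show ?thesis unfolding par_def[abs_def] by (rule borel_measurable_lebesgue_integral)
qed

lemma zero_ops: "A 0 = 0" "B 0 = 0"
  using positive_op_clinear[OF A] positive_op_clinear[OF B]
  by (simp_all add: bounded_clinear_def linear_simps)

lemma par_bounds:
  assumes t: "t > 0"
  shows "0 \<le> par t" "par t \<le> inner (A \<xi>) \<xi>"
proof -
  have "(\<integral>r. 0 \<partial>m) \<le> par t"
    unfolding par_def
    by (rule integral_mono_01[OF m01 bounded_borel_01_const bounded_borel_scalar_parallel[OF t] scalar_parallel_nonneg[OF t]])
  then show "0 \<le> par t" by simp
  \<comment> \<open>The trial decomposition \<open>\<eta> = \<xi>\<close>,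
    \<open>\<zeta> = 0\<close> gives a bound independent of \<open>t\<close>.\<close>
  show "par t \<le> inner (A \<xi>) \<xi>"
    using parallel_sum_lower[OF t, of \<xi> 0 \<xi>] by (simp add: par_def zero_ops)
qed

text \<open>Pointwise cross-multiplication reduces the comparison to \<open>s \<le> t\<close>.
  Monotonicity lets a near-minimiser at a grid point be reused for slightly larger
  \<open>t\<close>.\<close>

lemma par_mono:
  assumes s: "0 < s" and st: "s \<le> t"
  shows "par s \<le> par t"
  unfolding par_def
proof (rule integral_mono_01[OF m01])
  have t: "t > 0" using assms by simp
  show "bounded_borel_01 (scalar_parallel s)" "bounded_borel_01 (scalar_parallel t)"
    by (rule bounded_borel_scalar_parallel[OF s], rule bounded_borel_scalar_parallel[OF t])
  fix r :: real assume r: "r \<in> {0..1}"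
  have "r * r * (1 - r) * s \<le> r * r * (1 - r) * t" using r st by (intro mult_left_mono) auto
  then have "s * r * (1 - r) * (r + t * (1 - r)) \<le> t * r * (1 - r) * (r + s * (1 - r))"
    by (simp add: algebra_simps)
  then show "scalar_parallel s r \<le> scalar_parallel t r"
    unfolding scalar_parallel_def
    using scalar_parallel_denominator_pos[OF s r] scalar_parallel_denominator_pos[OF t r]
    by (intro frac_le_eq[THEN iffD2] divide_nonpos_pos) (auto simp: mult_ac)
qed

lemma integral_affine_part:
  "(\<integral>r. affine_part r \<partial>m) = b * inner (A \<xi>) \<xi> + (a - b) * inner (B \<xi>) \<xi>"
proof -
  note id = bounded_borel_01_ident bounded_borel_01_diff[OF bounded_borel_01_const[of 1] bounded_borel_01_ident]
  have "(\<integral>r. affine_part r \<partial>m) = (\<integral>r. b * r + (a - b) * (1 - r) \<partial>m)"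
    by (rule Bochner_Integration.integral_cong) (simp_all add: affine_part_def algebra_simps)
  also have "\<dots> = (\<integral>r. b * r \<partial>m) + (\<integral>r. (a - b) * (1 - r) \<partial>m)"
    by (intro Bochner_Integration.integral_add integrable_bounded_borel_01[OF m01] bounded_borel_01_mult bounded_borel_01_const id)
  finally show ?thesis by (simp only: integral_mult_right_zero persp_measure_moments)
qed

lemma Phi_measurable:
  assumes n: "n > 0"
  shows "Phi n \<in> borel_measurable borel"
    and "(\<lambda>(r, t). ennreal (t / (1 + t) * persp_kernel t r)) \<in> borel_measurable (borel \<Otimes>\<^sub>M \<nu> n)"
proof -
  interpret finite_measure "\<nu> n" by (rule finite_nu[OF n])
  have [measurable]: "(\<lambda>x. snd x) \<in> borel_measurable (borel \<Otimes>\<^sub>M \<nu> n)"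
    using measurable_compose[OF measurable_snd measurable_nu[OF measurable_ident]] by (simp add: id_def)
  show jm: "(\<lambda>(r, t). ennreal (t / (1 + t) * persp_kernel t r)) \<in> borel_measurable (borel \<Otimes>\<^sub>M \<nu> n)"
    unfolding persp_kernel_def split_beta' by measurable
  show "Phi n \<in> borel_measurable borel"
    unfolding Phi_def[abs_def] using borel_measurable_nn_integral[OF jm] .
qed

text \<open>Tonelli exchanges the integrals. The inner integral \<open>j t\<close> is a difference
  whose nonnegativity comes from the kernel, so the value is carried by a real witness
  \<open>J\<close> and subtraction stays outside the extended reals.\<close>

lemma nn_integral_Phi:
  assumes n: "n > 0"
  shows "\<exists>J. (\<integral>\<^sup>+r. Phi n r \<partial>m) = ennreal J \<and> 0 \<le> J \<and>
    J = (\<integral>t. t / (1 + t) \<partial>\<nu> n) * inner (A \<xi>) \<xi> + (\<integral>t. 1 / (1 + t) \<partial>\<nu> n) * inner (B \<xi>) \<xi> -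
      par_integral n"
proof -
  interpret N: finite_measure "\<nu> n" by (rule finite_nu[OF n])
  interpret M: finite_measure m by (rule finite_measure_01D(1)[OF m01])
  interpret MN: pair_sigma_finite m "\<nu> n"
    by (intro pair_sigma_finite.intro M.sigma_finite_measure_axioms N.sigma_finite_measure_axioms)
  define IA IB where "IA = inner (A \<xi>) \<xi>" and "IB = inner (B \<xi>) \<xi>"
  define j where "j t = t / (1 + t) * IA + 1 / (1 + t) * IB - (1 + t) / t * par t" for t
  note id = bounded_borel_01_ident bounded_borel_01_diff[OF bounded_borel_01_const[of 1] bounded_borel_01_ident]
  have inner: "(\<integral>\<^sup>+r. ennreal (t / (1 + t) * persp_kernel t r) \<partial>m) = ennreal (j t) \<and> 0 \<le> j t" if t: "t > 0" for t
  proof -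
    let ?h = "\<lambda>r. t / (1 + t) * r + 1 / (1 + t) * (1 - r) - (1 + t) / t * scalar_parallel t r"
    note bi = bounded_borel_01_add bounded_borel_01_diff bounded_borel_01_mult bounded_borel_01_const
      id bounded_borel_scalar_parallel[OF t]
    note I = integrable_bounded_borel_01[OF m01]
    have h0: "0 \<le> ?h r" if "r \<in> {0..1}" for r
      using persp_kernel_decomposition[OF t that] persp_kernel_nonneg[OF t that] t
      by (metis divide_nonneg_nonneg add_nonneg_nonneg less_imp_le mult_nonneg_nonneg zero_le_one)
    have AE: "AE r in m. r \<in> {0..1}" by (rule finite_measure_01D(4)[OF m01])
    have AE0: "AE r in m. 0 \<le> ?h r" using AE by eventually_elim (rule h0)
    have "(\<integral>\<^sup>+r. ennreal (t / (1 + t) * persp_kernel t r) \<partial>m) = (\<integral>\<^sup>+r. ennreal (?h r) \<partial>m)"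
    proof (rule nn_integral_cong_AE)
      show "AE r in m. ennreal (t / (1 + t) * persp_kernel t r) = ennreal (?h r)"
        using AE by eventually_elim (simp only: persp_kernel_decomposition[OF t])
    qed
    also have "\<dots> = ennreal (\<integral>r. ?h r \<partial>m)"
      by (rule nn_integral_eq_integral[OF _ AE0]) (intro I bi)
    finally have 1: "(\<integral>\<^sup>+r. ennreal (t / (1 + t) * persp_kernel t r) \<partial>m) = ennreal (\<integral>r. ?h r \<partial>m)" .
    have "(\<integral>r. ?h r \<partial>m) = (\<integral>r. t / (1 + t) * r \<partial>m) + (\<integral>r. 1 / (1 + t) * (1 - r) \<partial>m) - (\<integral>r. (1 + t) / t * scalar_parallel t r \<partial>m)"
      by (subst Bochner_Integration.integral_diff, (intro I bi)+, subst Bochner_Integration.integral_add, (intro I bi)+, rule refl)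
    also have "\<dots> = j t"
      by (simp only: integral_mult_right_zero persp_measure_moments j_def IA_def IB_def par_def)
    finally have 2: "(\<integral>r. ?h r \<partial>m) = j t" .
    have "0 \<le> (\<integral>r. ?h r \<partial>m)" by (rule integral_nonneg_AE[OF AE0])
    then show ?thesis unfolding 1 2 by simp
  qed
  have parb: "\<bar>(1 + t) / t * par t\<bar> \<le> (1 + real n) * IA" if "t \<in> {1 / real n..real n}" for t
    unfolding abs_mult using interval_bounds[OF n that] par_bounds[OF interval_bounds(1)[OF n that]]
    by (intro mult_mono) (auto simp: IA_def)
  have intp: "integrable (\<nu> n) (\<lambda>t. (1 + t) / t * par t)"
    by (rule integrable_nu[OF n _ parb]) measurable
  have intj: "integrable (\<nu> n) j"
    unfolding j_def[abs_def]
    by (intro Bochner_Integration.integrable_diff Bochner_Integration.integrable_add integrable_mult_left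
        integrable_nu_weights[OF n] intp)
  have jm: "(\<lambda>(r, t). ennreal (t / (1 + t) * persp_kernel t r)) \<in> borel_measurable (m \<Otimes>\<^sub>M \<nu> n)"
    using Phi_measurable(2)[OF n]
    by (simp add: measurable_cong_sets[OF sets_pair_measure_cong[OF finite_measure_01D(2)[OF m01] refl] refl])
  have "(\<integral>\<^sup>+r. Phi n r \<partial>m) = (\<integral>\<^sup>+t. (\<integral>\<^sup>+r. ennreal (t / (1 + t) * persp_kernel t r) \<partial>m) \<partial>\<nu> n)"
    unfolding Phi_def using MN.Fubini'[OF jm] by simp
  also have "\<dots> = (\<integral>\<^sup>+t. ennreal (j t) \<partial>\<nu> n)"
    using inner by (intro nn_integral_cong) (simp add: space_nu)
  also have "\<dots> = ennreal (\<integral>t. j t \<partial>\<nu> n)"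
    by (rule nn_integral_eq_integral[OF intj]) (use inner in \<open>auto intro!: AE_I2 simp: space_nu\<close>)
  finally have eq: "(\<integral>\<^sup>+r. Phi n r \<partial>m) = ennreal (\<integral>t. j t \<partial>\<nu> n)" .
  have "(\<integral>t. j t \<partial>\<nu> n) = (\<integral>t. t / (1 + t) \<partial>\<nu> n) * IA + (\<integral>t. 1 / (1 + t) \<partial>\<nu> n) * IB - par_integral n"
    unfolding j_def
    by (subst Bochner_Integration.integral_diff, intro Bochner_Integration.integrable_add integrable_mult_left integrable_nu_weights[OF n], rule intp,
        subst Bochner_Integration.integral_add, (intro integrable_mult_left integrable_nu_weights[OF n])+,
        simp only: integral_mult_left_zero)
  moreover have "0 \<le> (\<integral>t. j t \<partial>\<nu> n)"
    by (rule integral_nonneg_AE) (use inner in \<open>auto intro!: AE_I2 simp: space_nu\<close>)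
  ultimately show ?thesis using eq unfolding IA_def IB_def by blast
qed

text \<open>Monotone convergence moves the supremum out of the integral, and each term is evaluated
  by \<open>nn_integral_Phi\<close>. The shift by \<open>Suc\<close> matches the range
  \<open>n \<ge> 1\<close>.\<close>

lemma op_persp_eq_SUP:
  "op_persp f A B (vector_functional \<xi>) = (SUP n\<in>{1::nat..}.
    ereal (alpha_n b c d \<mu> n * inner (A \<xi>) \<xi> + beta_n a b c d \<mu> n * inner (B \<xi>) \<xi> -
      par_integral n))"
proof -
  let ?V = "\<lambda>n. ereal (alpha_n b c d \<mu> n * inner (A \<xi>) \<xi> + beta_n a b c d \<mu> n * inner (B \<xi>) \<xi> -
      par_integral n)"
  have V: "?V n = ereal (\<integral>r. affine_part r \<partial>m) + enn2ereal (\<integral>\<^sup>+r. Phi n r \<partial>m)" if n: "n > 0" for n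
  proof -
    obtain J where J: "(\<integral>\<^sup>+r. Phi n r \<partial>m) = ennreal J" "0 \<le> J"
      "J = (\<integral>t. t / (1 + t) \<partial>\<nu> n) * inner (A \<xi>) \<xi> + (\<integral>t. 1 / (1 + t) \<partial>\<nu> n) * inner (B \<xi>) \<xi> -
        par_integral n"
      using nn_integral_Phi[OF n] by blast
    show ?thesis
      unfolding J(1) integral_affine_part alpha_n_eq[OF n] beta_n_eq[OF n]
      using J(2) by (simp add: J(3) algebra_simps)
  qed
  have Pm: "Phi (Suc n) \<in> borel_measurable borel" for n by (rule Phi_measurable(1)) simp
  have mm: "borel_measurable m = borel_measurable borel"
    by (rule measurable_cong_sets[OF finite_measure_01D(2)[OF m01] refl])
  have Sm: "Phi_sup \<in> borel_measurable borel"
    unfolding Phi_sup_def[abs_def] by (intro borel_measurable_SUP Pm) auto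
  have ap: "bounded_borel_01 affine_part"
    by (rule bounded_borel_01_continuous) (auto simp: affine_part_def[abs_def] intro!: continuous_intros)
  have "op_persp f A B (vector_functional \<xi>) = ereal (\<integral>r. affine_part r \<partial>m) + enn2ereal (\<integral>\<^sup>+r. Phi_sup r \<partial>m)"
    unfolding op_persp_def by (rule integral_affine_plus_nonneg[OF m01 ap Sm persp_eq])
  also have "(\<integral>\<^sup>+r. Phi_sup r \<partial>m) = (SUP n. \<integral>\<^sup>+r. Phi (Suc n) r \<partial>m)"
    unfolding Phi_sup_def
  proof (rule nn_integral_monotone_convergence_SUP_AE)
    show "AE r in m. Phi (Suc n) r \<le> Phi (Suc (Suc n)) r" for n
      using finite_measure_01D(4)[OF m01] by eventually_elim (intro Phi_mono, auto)
    show "Phi (Suc n) \<in> borel_measurable m" for n unfolding mm by (rule Pm)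
  qed
  \<comment> \<open>\<open>enn2ereal\<close> is continuous and the sequence increases, so both sides
    are limits of the same sequence.\<close>
  also have "enn2ereal (SUP n. \<integral>\<^sup>+r. Phi (Suc n) r \<partial>m) = (SUP n. enn2ereal (\<integral>\<^sup>+r. Phi (Suc n) r \<partial>m))"
  proof -
    have "(\<integral>\<^sup>+r. Phi (Suc k) r \<partial>m) \<le> (\<integral>\<^sup>+r. Phi (Suc n) r \<partial>m)" if "k \<le> n" for k n
    proof (rule nn_integral_mono_AE)
      show "AE r in m. Phi (Suc k) r \<le> Phi (Suc n) r"
        using finite_measure_01D(4)[OF m01] by eventually_elim (use that in \<open>intro Phi_mono, auto\<close>)
    qed
    then have inc: "incseq (\<lambda>n. \<integral>\<^sup>+r. Phi (Suc n) r \<partial>m)" by (simp add: incseq_def)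
    then have "incseq (\<lambda>n. enn2ereal (\<integral>\<^sup>+r. Phi (Suc n) r \<partial>m))"
      by (simp add: incseq_def less_eq_ennreal.rep_eq)
    from LIMSEQ_SUP[OF this] tendsto_enn2erealI[OF LIMSEQ_SUP[OF inc]] show ?thesis
      by (rule LIMSEQ_unique[symmetric])
  qed
  also have "ereal (\<integral>r. affine_part r \<partial>m) + \<dots> =
      (SUP n. ereal (\<integral>r. affine_part r \<partial>m) + enn2ereal (\<integral>\<^sup>+r. Phi (Suc n) r \<partial>m))"
    by (rule SUP_ereal_add_right[symmetric]) auto
  also have "\<dots> = (SUP n. ?V (Suc n))" by (simp only: V[OF zero_less_Suc])
  also have "\<dots> = (SUP n\<in>Suc ` UNIV. ?V n)" by (simp only: image_image)
  also have "Suc ` UNIV = {1..}" by (auto simp: image_iff Suc_le_eq gr0_conv_Suc)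
  finally show ?thesis .
qed

section \<open>Energies of piecewise constant decompositions\<close>

definition energy :: "nat \<Rightarrow> (real \<Rightarrow> 'a) \<Rightarrow> (real \<Rightarrow> 'a) \<Rightarrow> real"
  where "energy n \<eta> \<zeta> = (LINT t:{1 / real n..real n}|\<nu> n. (1 + t) / t *
    (inner (A (\<eta> t)) (\<eta> t) + t * inner (B (\<zeta> t)) (\<zeta> t)))"

lemma integrable_par:
  assumes n: "n > 0"
  shows "integrable (\<nu> n) (\<lambda>t. (1 + t) / t * par t)"
proof (rule integrable_nu[OF n])
  show "\<bar>(1 + t) / t * par t\<bar> \<le> (1 + real n) * inner (A \<xi>) \<xi>" if "t \<in> {1 / real n..real n}" for t
    unfolding abs_mult using interval_bounds[OF n that] par_bounds[OF interval_bounds(1)[OF n that]]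
    by (intro mult_mono) auto
qed measurable

text \<open>Off the interval \<eta> and \<zeta> are arbitrary, so measurability is guaranteed only
  with the indicator attached; inside, the integrand is bounded and \<open>nu_n\<close> is
  finite.\<close>

lemma energy_integrable:
  assumes n: "n > 0" and D: "(\<eta>, \<zeta>) \<in> decompositions n \<xi>"
  shows "integrable (\<nu> n) (\<lambda>t. indicator {1 / real n..real n} t *\<^sub>R
    ((1 + t) / t * (inner (A (\<eta> t)) (\<eta> t) + t * inner (B (\<zeta> t)) (\<zeta> t))))"
proof -
  let ?S = "{1 / real n..real n}"
  have pc: "piecewise_constant_on (1 / real n) (real n) \<eta>" "piecewise_constant_on (1 / real n) (real n) \<zeta>"
    using D by (auto simp: decompositions_def)
  define u v where "u t = indicator ?S t * inner (A (\<eta> t)) (\<eta> t)" and "v t = indicator ?S t * inner (B (\<zeta> t)) (\<zeta> t)" for t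
  have m[measurable]: "u \<in> borel_measurable borel" "v \<in> borel_measurable borel"
    using piecewise_constant_borel(1)[OF pc(1), of "\<lambda>x. inner (A x) x"]
      piecewise_constant_borel(1)[OF pc(2), of "\<lambda>x. inner (B x) x"]
    by (simp_all add: u_def[abs_def] v_def[abs_def])
  obtain C C' where C: "\<And>t. \<bar>u t\<bar> \<le> C" "\<And>t. \<bar>v t\<bar> \<le> C'"
    using piecewise_constant_borel(2)[OF pc(1), of "\<lambda>x. inner (A x) x"]
      piecewise_constant_borel(2)[OF pc(2), of "\<lambda>x. inner (B x) x"]
    unfolding u_def v_def by blast
  have eq: "(\<lambda>t. indicator ?S t *\<^sub>R ((1 + t) / t * (inner (A (\<eta> t)) (\<eta> t) + t * inner (B (\<zeta> t)) (\<zeta> t)))) =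
      (\<lambda>t. (1 + t) / t * (u t + t * v t))"
    by (auto simp: u_def v_def fun_eq_iff indicator_def)
  show ?thesis
    unfolding eq
  proof (rule integrable_nu[OF n])
    fix t assume t: "t \<in> ?S"
    note ib = interval_bounds[OF n t]
    have "\<bar>t * v t\<bar> \<le> real n * C'"
      unfolding abs_mult using t ib C(2)[of t] by (intro mult_mono) auto
    then have "\<bar>u t + t * v t\<bar> \<le> C + real n * C'"
      using C(1)[of t] abs_triangle_ineq[of "u t" "t * v t"] by linarith
    then show "\<bar>(1 + t) / t * (u t + t * v t)\<bar> \<le> (1 + real n) * (C + real n * C')"
      unfolding abs_mult using ib by (intro mult_mono) auto
  qed measurable
qed

lemma energy_lower:
  assumes n: "n > 0" and D: "(\<eta>, \<zeta>) \<in> decompositions n \<xi>"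
  shows "par_integral n \<le> energy n \<eta> \<zeta>"
  unfolding energy_def set_lebesgue_integral_def
proof (rule integral_nu_mono[OF n integrable_par[OF n] energy_integrable[OF n D]])
  fix t assume t: "t \<in> {1 / real n..real n}"
  have "\<eta> t + \<zeta> t = \<xi>" using D t by (auto simp: decompositions_def)
  from parallel_sum_lower[OF interval_bounds(1)[OF n t] this]
  have "(1 + t) / t * par t \<le> (1 + t) / t * (inner (A (\<eta> t)) (\<eta> t) + t * inner (B (\<zeta> t)) (\<zeta> t))"
    unfolding par_def by (intro mult_left_mono interval_bounds(4)[OF n t])
  then show "(1 + t) / t * par t \<le> indicator {1 / real n..real n} t *\<^sub>R
      ((1 + t) / t * (inner (A (\<eta> t)) (\<eta> t) + t * inner (B (\<zeta> t)) (\<zeta> t)))"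
    using t by simp
qed

text \<open>Near-minimisers at the grid points \<open>\<tau> i\<close> are kept constant up to the
  next one. The mesh \<open>\<delta> p\<close> is relative to the left end \<open>p = 1 / n\<close>,
  so \<open>t \<le> (1 + \<delta>) * \<tau> i\<close> on each step. Scaling the energy by
  \<open>1 + \<delta>\<close> and monotonicity of \<open>par\<close> then bound the excess at
  \<open>t\<close> by \<open>\<delta> * (IA + 2)\<close>.\<close>

lemma energy_attained:
  assumes n: "n > 0" and e: "e > 0"
  shows "\<exists>(\<eta>, \<zeta>)\<in>decompositions n \<xi>. energy n \<eta> \<zeta> \<le> par_integral n + e"
proof -
  define IA where "IA = inner (A \<xi>) \<xi>"
  have IA: "IA \<ge> 0" unfolding IA_def by (rule positive_op_nonneg[OF A])
  define W where "W = (\<integral>t. (1 + t) / t \<partial>\<nu> n)"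
  have W: "W \<ge> 0" unfolding W_def by (intro integral_nonneg_AE AE_I2) (auto simp: space_nu)
  \<comment> \<open>The total excess per unit of \<delta> after weighting by
    \<open>(1 + t) / t\<close>, plus 1 to be positive.\<close>
  define k where "k = (IA + 2) * W + 1"
  have k: "k > 0" using IA W by (simp add: k_def add_nonneg_pos)
  define \<delta> where "\<delta> = min 1 (e / k)"
  have \<delta>: "\<delta> > 0" "\<delta> \<le> 1" "\<delta> * k \<le> e" using e k by (auto simp: \<delta>_def min_def field_simps)
  define p where "p = 1 / real n"
  have p: "p > 0" using n by (simp add: p_def)
  define w where "w = \<delta> * p"
  have w: "w > 0" using \<delta> p by (simp add: w_def)
  define \<tau> where "\<tau> i = p + real i * w" for i :: nat
  have \<tau>: "\<tau> i > 0" "p \<le> \<tau> i" for i using p w by (auto simp: \<tau>_def add_pos_nonneg)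
  have "\<exists>y z. y + z = \<xi> \<and> inner (A y) y + \<tau> i * inner (B z) z < par (\<tau> i) + \<delta>" for i
    unfolding par_def by (rule parallel_sum_attained[OF \<tau>(1) \<delta>(1)])
  then obtain y z where yz: "\<And>i. y i + z i = \<xi>"
    "\<And>i. inner (A (y i)) (y i) + \<tau> i * inner (B (z i)) (z i) < par (\<tau> i) + \<delta>" by metis
  define i where "i t = nat \<lfloor>(t - p) / w\<rfloor>" for t
  define \<eta> \<zeta> where "\<eta> t = y (i t)" and "\<zeta> t = z (i t)" for t
  have D: "(\<eta>, \<zeta>) \<in> decompositions n \<xi>"
    using piecewise_constant_step[OF w, of p "real n" y] piecewise_constant_step[OF w, of p "real n" z] yz(1)
    by (simp add: decompositions_def \<eta>_def[abs_def] \<zeta>_def[abs_def] i_def p_def)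
  have "energy n \<eta> \<zeta> \<le> (\<integral>t. (1 + t) / t * par t + (1 + t) / t * (\<delta> * (IA + 2)) \<partial>\<nu> n)"
    unfolding energy_def set_lebesgue_integral_def
  proof (rule integral_nu_mono[OF n energy_integrable[OF n D]])
    show "integrable (\<nu> n) (\<lambda>t. (1 + t) / t * par t + (1 + t) / t * (\<delta> * (IA + 2)))"
      by (intro Bochner_Integration.integrable_add integrable_par[OF n] integrable_mult_left integrable_nu_weights[OF n])
    fix t assume t: "t \<in> {1 / real n..real n}"
    note ib = interval_bounds[OF n t]
    have tp: "t \<ge> p" using t by (simp add: p_def)
    have "(t - p) / w \<ge> 0" using tp w by simp
    then have fl: "real (i t) \<le> (t - p) / w" "(t - p) / w < real (i t) + 1"
      unfolding i_def by (simp_all add: of_nat_nat)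
    have "real (i t) * w \<le> t - p" "t - p < (real (i t) + 1) * w"
      using fl w by (simp_all add: pos_le_divide_eq pos_divide_less_eq)
    then have lo: "\<tau> (i t) \<le> t" and "t \<le> \<tau> (i t) + w" by (simp_all add: \<tau>_def algebra_simps)
    moreover have "w \<le> \<delta> * \<tau> (i t)" unfolding w_def using \<tau>(2) \<delta>(1) by (intro mult_left_mono) auto
    ultimately have hi: "t \<le> (1 + \<delta>) * \<tau> (i t)" by (simp add: algebra_simps)
    have nn: "0 \<le> inner (A (\<eta> t)) (\<eta> t)" "0 \<le> inner (B (\<zeta> t)) (\<zeta> t)"
      by (rule positive_op_nonneg[OF A], rule positive_op_nonneg[OF B])
    have "inner (A (\<eta> t)) (\<eta> t) + t * inner (B (\<zeta> t)) (\<zeta> t) \<le>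
        (1 + \<delta>) * inner (A (\<eta> t)) (\<eta> t) + ((1 + \<delta>) * \<tau> (i t)) * inner (B (\<zeta> t)) (\<zeta> t)"
      using nn hi \<delta>(1) by (intro add_mono mult_right_mono) (auto simp: distrib_right)
    also have "\<dots> = (1 + \<delta>) * (inner (A (\<eta> t)) (\<eta> t) + \<tau> (i t) * inner (B (\<zeta> t)) (\<zeta> t))"
      by (simp add: distrib_left mult.assoc)
    also have "\<dots> \<le> (1 + \<delta>) * (par t + \<delta>)"
      using yz(2)[of "i t"] par_mono[OF \<tau>(1) lo] \<delta>(1)
      by (intro mult_left_mono) (auto simp: \<eta>_def \<zeta>_def)
    \<comment> \<open>The excess consists of \<open>\<delta> par t \<le> \<delta> IA\<close>,
      \<open>\<delta>\<close> and \<open>\<delta>^2 \<le> \<delta>\<close>, hence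
      \<open>IA + 2\<close>.\<close>
    also have "\<dots> \<le> par t + \<delta> * (IA + 2)"
    proof -
      have "\<delta> * par t \<le> \<delta> * IA" using par_bounds(2)[OF ib(1)] \<delta>(1) unfolding IA_def by (intro mult_left_mono) auto
      moreover have "\<delta> * \<delta> \<le> \<delta> * 1" using \<delta> by (intro mult_left_mono) auto
      ultimately show ?thesis by (simp add: algebra_simps)
    qed
    finally have "(1 + t) / t * (inner (A (\<eta> t)) (\<eta> t) + t * inner (B (\<zeta> t)) (\<zeta> t)) \<le>
        (1 + t) / t * (par t + \<delta> * (IA + 2))" by (rule mult_left_mono[OF _ ib(4)])
    then show "indicator {1 / real n..real n} t *\<^sub>R ((1 + t) / t * (inner (A (\<eta> t)) (\<eta> t) + t * inner (B (\<zeta> t)) (\<zeta> t))) \<le>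
        (1 + t) / t * par t + (1 + t) / t * (\<delta> * (IA + 2))"
      unfolding distrib_left using t by simp
  qed
  also have "\<dots> = par_integral n + W * (\<delta> * (IA + 2))"
    unfolding W_def
    by (subst Bochner_Integration.integral_add[OF integrable_par[OF n]])
       (intro integrable_mult_left integrable_nu_weights[OF n], simp only: integral_mult_left_zero)
  also have "W * (\<delta> * (IA + 2)) \<le> e"
  proof -
    have "W * (\<delta> * (IA + 2)) \<le> \<delta> * k" using \<delta>(1) by (simp add: k_def algebra_simps)
    then show ?thesis using \<delta>(3) by simp
  qed
  finally show ?thesis using D by (intro bexI[of _ "(\<eta>, \<zeta>)"]) auto
qed

lemma SUP_decompositions:
  assumes n: "n > 0"
  shows "(SUP (\<eta>, \<zeta>)\<in>decompositions n \<xi>. ereal (\<kappa> - energy n \<eta> \<zeta>)) =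
    ereal (\<kappa> - par_integral n)" (is "?S = ereal (\<kappa> - ?Q)")
proof (rule antisym)
  show "?S \<le> ereal (\<kappa> - ?Q)"
    by (rule SUP_least) (use energy_lower[OF n] in force)
  show "ereal (\<kappa> - ?Q) \<le> ?S"
  proof (rule ereal_le_epsilon2)
    fix e :: real assume "0 < e"
      from energy_attained[OF n this] obtain \<eta> \<zeta> where D: "(\<eta>, \<zeta>) \<in> decompositions n \<xi>"
        "energy n \<eta> \<zeta> \<le> ?Q + e" by auto
      have "ereal (\<kappa> - energy n \<eta> \<zeta>) \<le> ?S" by (rule SUP_upper2[OF D(1)]) simp
      then have "ereal (\<kappa> - energy n \<eta> \<zeta>) + ereal e \<le> ?S + ereal e" by (rule add_right_mono)
      moreover have "ereal (\<kappa> - ?Q) \<le> ereal (\<kappa> - energy n \<eta> \<zeta>) + ereal e" using D(2) by simp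
      ultimately show "ereal (\<kappa> - ?Q) \<le> ?S + ereal e" by (rule order_trans[rotated])
  qed
qed

end

theorem theorem9p4:
  fixes f :: "real \<Rightarrow> real" and a b c d :: real and \<mu> :: "real measure"
    and A B :: "'a::complex_hilbert \<Rightarrow> 'a" and \<xi> :: 'a
  assumes "operator_convex f"
    and "c \<ge> 0" and "d \<ge> 0"
    and "sets \<mu> = sets (restrict_space borel {0<..})"
    and "(\<integral>\<^sup>+ l. ennreal (1 / (1 + l)) \<partial>\<mu>) < \<infinity>"
    and "\<And>t. t > 0 \<Longrightarrow>
      f t = a + b * (t - 1) + c * (t - 1)\<^sup>2 + d * ((t - 1)\<^sup>2 / t)
        + (\<integral>l. (t - 1)\<^sup>2 / (t + l) \<partial>\<mu>)"
    and "positive_op A" and "positive_op B"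
  shows "op_persp f A B (vector_functional \<xi>) =
    (SUP n\<in>{1::nat..}. SUP (\<eta>, \<zeta>)\<in>decompositions n \<xi>.
      ereal (alpha_n b c d \<mu> n * Re (cinner (A \<xi>) \<xi>)
        + beta_n a b c d \<mu> n * Re (cinner (B \<xi>) \<xi>)
        - (LINT t:{1 / real n..real n}|nu_n c d \<mu> n.
            (1 + t) / t *
            (Re (cinner (A (\<eta> t)) (\<eta> t)) + t * Re (cinner (B (\<zeta> t)) (\<zeta> t))))))"
proof -
  interpret perspective_setting A B f a b c d \<mu> \<xi>
    by unfold_locales (use assms in auto)
  show ?thesis
    unfolding op_persp_eq_SUP inner_cinner[symmetric] energy_def[symmetric]
    by (intro SUP_cong refl) (simp add: SUP_decompositions)
qed

end
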